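(* Let $(W,S)$ be a Coxeter system with set of reflections $T$, and let $w\in W$ be such that $\ell_T(w)=3$. Then the interval group $G([1,w]_T)$ is a quasi-Garside group.
   Context: $(W,S)$ is a Coxeter system, where $S$ is not assumed to be finite. $T:=\bigcup_{x\in W} xSx^{-1}$ is its set of reflections, and $\ell_T:W\to\mathbb{Z}_{\geq 0}$ is the length function with respect to the generating set $T$. The absolute order is defined by $u\leq_T v$ if and only if $\ell_T(u)+\ell_T(u^{-1}v)=\ell_T(v)$, and $[1,w]_T=\{u\in W\mid u\leq_T w\}$, ordered by $\leq_T$. Interval group: $G([1,w]_T)$ is the group with generators $\mathbf{u}$, one for each $u\in[1,w]_T$, and relations $\mathbf{u}\,\mathbf{v}=\mathbf{x}$ whenever $u,v,x\in[1,w]_T$ satisfy $uv=x$ in $W$ and $\ell_T(u)+\ell_T(v)=\ell_T(x)$. Quasi-Garside monoid: a pair $(M,\Delta)$ where $M$ is a monoid and $\Delta\in M$ such that: (i) $M$ is left- and right-cancellative; (ii) there is a map $\lambda:M\to\mathbb{Z}_{\geq 0}$ with $\lambda(ab)\geq\lambda(a)+\lambda(b)$ for all $a,b\in M$ and $\lambda(a)\neq 0$ for $a\neq 1$; (iii) any two elements of $M$ have a greatest common divisor and a least common multiple for left-divisibility, and likewise for right-divisibility; (iv) the set of left divisors of $\Delta$ coincides with its set of right divisors, and this set generates $M$. (The set of divisors of $\Delta$ is allowed to be infinite; if it is finite one speaks of a Garside monoid.) A quasi-Garside group is the group of fractions of a quasi-Garside monoid. *)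

theory Defs
  imports "HOL-Algebra.Divisibility" "HOL-Library.Extended_Nat"
begin

section \<open>Groups given by generators and relations\<close>

text \<open>
  A letter \<open>(x, True)\<close> stands for the generator \<open>x\<close> and \<open>(x, False)\<close> for its formal inverse.
  A relation \<open>(l, r)\<close> is a pair of words, to be read as \<open>l = r\<close>.
\<close>

type_synonym 'a gword = "('a \<times> bool) list"

definition gwords :: "'a set \<Rightarrow> 'a gword set" where
  "gwords X = {u. fst ` set u \<subseteq> X}"

inductive_set pres_cong :: "'a set \<Rightarrow> ('a gword \<times> 'a gword) set \<Rightarrow> ('a gword \<times> 'a gword) set"
  for X :: "'a set" and R :: "('a gword \<times> 'a gword) set" where
  refl: "u \<in> gwords X \<Longrightarrow> (u, u) \<in> pres_cong X R"
| sym: "(u, v) \<in> pres_cong X R \<Longrightarrow> (v, u) \<in> pres_cong X R"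
| trans: "(u, v) \<in> pres_cong X R \<Longrightarrow> (v, w) \<in> pres_cong X R \<Longrightarrow> (u, w) \<in> pres_cong X R"
| cancel: "p \<in> gwords X \<Longrightarrow> q \<in> gwords X \<Longrightarrow> x \<in> X \<Longrightarrow>
    (p @ [(x, b), (x, \<not> b)] @ q, p @ q) \<in> pres_cong X R"
| relation: "p \<in> gwords X \<Longrightarrow> q \<in> gwords X \<Longrightarrow> l \<in> gwords X \<Longrightarrow> r \<in> gwords X \<Longrightarrow>
    (l, r) \<in> R \<Longrightarrow> (p @ l @ q, p @ r @ q) \<in> pres_cong X R"

definition presented_group ::
  "'a set \<Rightarrow> ('a gword \<times> 'a gword) set \<Rightarrow> 'a gword set monoid" where
  "presented_group X R =
    \<lparr>carrier = gwords X // pres_cong X R,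
     mult = (\<lambda>A B. \<Union>u\<in>A. \<Union>v\<in>B. pres_cong X R `` {u @ v}),
     one = pres_cong X R `` {[]}\<rparr>"

definition presented_gen ::
  "'a set \<Rightarrow> ('a gword \<times> 'a gword) set \<Rightarrow> 'a \<Rightarrow> 'a gword set" where
  "presented_gen X R x = pres_cong X R `` {[(x, True)]}"


section \<open>Coxeter systems, reflections and the absolute order\<close>

definition coxeter_matrix :: "'a set \<Rightarrow> ('a \<Rightarrow> 'a \<Rightarrow> enat) \<Rightarrow> bool" where
  "coxeter_matrix S m \<longleftrightarrow>
    (\<forall>s\<in>S. m s s = 1) \<and>
    (\<forall>s\<in>S. \<forall>t\<in>S. s \<noteq> t \<longrightarrow> m s t = m t s \<and> 2 \<le> m s t)"

text \<open>The relations \<open>(s t)^(m s t) = 1\<close>; there is none when \<open>m s t = \<infinity>\<close>.\<close>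

definition coxeter_relations ::
  "'a set \<Rightarrow> ('a \<Rightarrow> 'a \<Rightarrow> enat) \<Rightarrow> ('a gword \<times> 'a gword) set" where
  "coxeter_relations S m =
    {(concat (replicate n [(s, True), (t, True)]), []) | s t n.
      s \<in> S \<and> t \<in> S \<and> m s t = enat n}"

locale coxeter_system = group W for W :: "('a, 'b) monoid_scheme" (structure) +
  fixes S :: "'a set"
  assumes S_subset: "S \<subseteq> carrier W"
    and coxeter_presentation:
      "\<exists>m. coxeter_matrix S m \<and>
        (\<exists>h \<in> iso (presented_group S (coxeter_relations S m)) W.
          \<forall>s\<in>S. h (presented_gen S (coxeter_relations S m) s) = s)"

definition reflections :: "('a, 'b) monoid_scheme \<Rightarrow> 'a set \<Rightarrow> 'a set" where
  "reflections W S = {x \<otimes>\<^bsub>W\<^esub> s \<otimes>\<^bsub>W\<^esub> inv\<^bsub>W\<^esub> x | x s. x \<in> carrier W \<and> s \<in> S}"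

text \<open>
  The word length with respect to a generating set \<open>A\<close> that is closed under inverses (as is the
  case for the reflections of a Coxeter system, which are involutions).
\<close>

definition word_length :: "('a, 'b) monoid_scheme \<Rightarrow> 'a set \<Rightarrow> 'a \<Rightarrow> nat" where
  "word_length G A g =
    (LEAST n. \<exists>as. set as \<subseteq> A \<and> length as = n \<and> foldr (\<otimes>\<^bsub>G\<^esub>) as \<one>\<^bsub>G\<^esub> = g)"

definition reflection_length :: "('a, 'b) monoid_scheme \<Rightarrow> 'a set \<Rightarrow> 'a \<Rightarrow> nat" where
  "reflection_length W S = word_length W (reflections W S)"

definition absolute_le :: "('a, 'b) monoid_scheme \<Rightarrow> 'a set \<Rightarrow> 'a \<Rightarrow> 'a \<Rightarrow> bool" where
  "absolute_le W S u v \<longleftrightarrow>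
    reflection_length W S u + reflection_length W S (inv\<^bsub>W\<^esub> u \<otimes>\<^bsub>W\<^esub> v) = reflection_length W S v"

definition absolute_interval :: "('a, 'b) monoid_scheme \<Rightarrow> 'a set \<Rightarrow> 'a \<Rightarrow> 'a set" where
  "absolute_interval W S w = {u \<in> carrier W. absolute_le W S u w}"


section \<open>Interval groups\<close>

definition interval_relations ::
  "('a, 'b) monoid_scheme \<Rightarrow> 'a set \<Rightarrow> 'a \<Rightarrow> ('a gword \<times> 'a gword) set" where
  "interval_relations W S w =
    {([(u, True), (v, True)], [(x, True)]) | u v x.
      u \<in> absolute_interval W S w \<and> v \<in> absolute_interval W S w \<and>
      x \<in> absolute_interval W S w \<and> u \<otimes>\<^bsub>W\<^esub> v = x \<and>
      reflection_length W S u + reflection_length W S v = reflection_length W S x}"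

definition interval_group ::
  "('a, 'b) monoid_scheme \<Rightarrow> 'a set \<Rightarrow> 'a \<Rightarrow> 'a gword set monoid" where
  "interval_group W S w =
    presented_group (absolute_interval W S w) (interval_relations W S w)"


section \<open>Quasi-Garside monoids and groups\<close>

text \<open>
  The library relation \<open>a divides\<^bsub>M\<^esub> b\<close> means \<open>b = a c\<close> for some \<open>c\<close>, which in a non-commutative
  monoid is left-divisibility, so that \<open>gcdof\<close> and \<open>lcmof\<close> are the left versions. The right
  versions are obtained from the opposite monoid.
\<close>

definition opposite :: "('a, 'b) monoid_scheme \<Rightarrow> 'a monoid" where
  "opposite M = \<lparr>carrier = carrier M, mult = (\<lambda>a b. b \<otimes>\<^bsub>M\<^esub> a), one = \<one>\<^bsub>M\<^esub>\<rparr>"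

locale quasi_garside_monoid = monoid_cancel M for M :: "('a, 'b) monoid_scheme" (structure) +
  fixes \<Delta> :: 'a
  assumes Delta_closed: "\<Delta> \<in> carrier M"
    and superadditive_length:
      "\<exists>len :: 'a \<Rightarrow> nat.
        (\<forall>a\<in>carrier M. \<forall>b\<in>carrier M. len (a \<otimes> b) \<ge> len a + len b) \<and>
        (\<forall>a\<in>carrier M. a \<noteq> \<one> \<longrightarrow> len a \<noteq> 0)"
    and left_gcd: "\<lbrakk>a \<in> carrier M; b \<in> carrier M\<rbrakk> \<Longrightarrow> \<exists>d\<in>carrier M. d gcdof a b"
    and left_lcm: "\<lbrakk>a \<in> carrier M; b \<in> carrier M\<rbrakk> \<Longrightarrow> \<exists>d\<in>carrier M. d lcmof a b"
    and right_gcd: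
      "\<lbrakk>a \<in> carrier M; b \<in> carrier M\<rbrakk> \<Longrightarrow> \<exists>d\<in>carrier M. d gcdof\<^bsub>opposite M\<^esub> a b"
    and right_lcm:
      "\<lbrakk>a \<in> carrier M; b \<in> carrier M\<rbrakk> \<Longrightarrow> \<exists>d\<in>carrier M. d lcmof\<^bsub>opposite M\<^esub> a b"
    and divisors_Delta:
      "{a \<in> carrier M. a divides \<Delta>} = {a \<in> carrier M. a divides\<^bsub>opposite M\<^esub> \<Delta>}"
    and divisors_Delta_generate:
      "\<lbrakk>submonoid H M; {a \<in> carrier M. a divides \<Delta>} \<subseteq> H\<rbrakk> \<Longrightarrow> H = carrier M"

text \<open>
  \<open>G\<close>, with \<open>\<iota>\<close>, is the group of fractions of \<open>M\<close>: \<open>M\<close> embeds in \<open>G\<close> and every element of \<open>G\<close>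
  is a fraction. By Ore's theorem such a \<open>G\<close> exists and is unique up to a unique isomorphism over
  \<open>M\<close> when \<open>M\<close> is cancellative and any two elements have a common right multiple; if common left
  multiples exist as well, fractions \<open>a\<inverse> b\<close> and \<open>a b\<inverse>\<close> give the same notion.
\<close>

definition group_of_fractions ::
  "('a, 'b) monoid_scheme \<Rightarrow> ('c, 'd) monoid_scheme \<Rightarrow> ('a \<Rightarrow> 'c) \<Rightarrow> bool" where
  "group_of_fractions M G \<iota> \<longleftrightarrow>
    group G \<and> \<iota> \<in> hom M G \<and> inj_on \<iota> (carrier M) \<and>
    (\<forall>g\<in>carrier G. \<exists>a\<in>carrier M. \<exists>b\<in>carrier M. g = \<iota> a \<otimes>\<^bsub>G\<^esub> inv\<^bsub>G\<^esub> (\<iota> b))"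

text \<open>
  The element type of \<open>M\<close> is that of \<open>G\<close>; this is no restriction, because \<open>M\<close> embeds in its
  group of fractions and may be replaced by its image.
\<close>

definition quasi_garside_group :: "('a, 'b) monoid_scheme \<Rightarrow> bool" where
  "quasi_garside_group G \<longleftrightarrow>
    (\<exists>(M :: 'a monoid) \<Delta> \<iota>. quasi_garside_monoid M \<Delta> \<and> group_of_fractions M G \<iota>)"

end

(*
Two distinct reflections below two distinct elements u, v of reflection length 2 would force w to
be a reflection: in the geometric representation all the reflections involved have their roots
in one plane, the reflection subgroup of a plane has at most two canonical generators in the sense
of Dyer, and in a dihedral group products of three reflections are reflections. Hence the interval
below an element of reflection length 3 is a lattice. The lattice property makes the complement of
two elements of the interval compatible with the defining relations, so that it extends to words by
filling grids (Dehornoy); this gives left cancellation and least common multiples for the monoid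
with the same presentation. As w is quasi-central, fractions with denominator a power of w show
that this monoid embeds in the interval group.
*)
theory Submission
  imports Defs "HOL-Analysis.Finite_Function_Topology"
begin

section \<open>The geometric representation\<close>

text \<open>The Tits form of an infinite Coxeter group need not be positive definite, so coplanarity
  of roots cannot be read off orthogonal complements of fixed spaces. Roots are used as linear
  functionals instead: a functional vanishing on the common kernel of two others is a combination of
  them, and a pairing that determines the roots turns this into a statement about the roots
  themselves. Length 3 enters only through the lattice property. With the possible lengths 0 to 3, a
  join can be missing only for two reflections with two different upper bounds of length 2.
  Everything later about words, monoid and group uses just a conjugation-invariant length and the
  joins below \<open>w\<close>. Grids of complements work from one side only. The passage to the
  other side always goes through \<open>w\<close>: conjugation by \<open>w\<close> preserves the
  interval, so right cancellation of \<open>w\<close> reduces to left cancellation, and right common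
  multiples become left common divisors of complements in a power of \<open>w\<close>.\<close>

lemma lookup_scaleR [simp]:
  "Poly_Mapping.lookup (r *\<^sub>R v) i = r *\<^sub>R Poly_Mapping.lookup v i"
proof -
  have "finite {i. r *\<^sub>R Poly_Mapping.lookup v i \<noteq> 0}"
    by (rule finite_subset[OF _ finite_keys[of v]]) (auto simp: in_keys_iff)
  then show ?thesis by (simp add: scaleR_poly_mapping_def)
qed

section \<open>Forms given by a Gram matrix on finitely supported vectors\<close>

definition gram_form :: "('i \<Rightarrow> 'i \<Rightarrow> real) \<Rightarrow> ('i \<Rightarrow>\<^sub>0 real) \<Rightarrow> ('i \<Rightarrow>\<^sub>0 real) \<Rightarrow> real" where
  "gram_form K v w = (\<Sum>i\<in>Poly_Mapping.keys v. Poly_Mapping.lookup v i *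
     (\<Sum>j\<in>Poly_Mapping.keys w. Poly_Mapping.lookup w j * K i j))"

text \<open>The support of a sum may be smaller than the union of the supports. Summation over fixed
  larger index sets lets linearity be checked termwise.\<close>

lemma gram_form_superset:
  assumes "finite A" "Poly_Mapping.keys v \<subseteq> A" "finite C" "Poly_Mapping.keys w \<subseteq> C"
  shows "gram_form K v w =
    (\<Sum>i\<in>A. \<Sum>j\<in>C. Poly_Mapping.lookup v i * Poly_Mapping.lookup w j * K i j)"
proof -
  have "(\<Sum>j\<in>Poly_Mapping.keys w. Poly_Mapping.lookup w j * K i j) =
        (\<Sum>j\<in>C. Poly_Mapping.lookup w j * K i j)" for i
    by (rule sum.mono_neutral_left) (use assms in \<open>auto simp: in_keys_iff\<close>)
  then have "gram_form K v w = (\<Sum>i\<in>Poly_Mapping.keys v. Poly_Mapping.lookup v i *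
      (\<Sum>j\<in>C. Poly_Mapping.lookup w j * K i j))"
    by (simp add: gram_form_def)
  also have "\<dots> = (\<Sum>i\<in>A. Poly_Mapping.lookup v i * (\<Sum>j\<in>C. Poly_Mapping.lookup w j * K i j))"
    by (rule sum.mono_neutral_left) (use assms in \<open>auto simp: in_keys_iff\<close>)
  finally show ?thesis
    by (simp add: sum_distrib_left mult.assoc)
qed

lemma gram_form_add_left: "gram_form K (v + v') w = gram_form K v w + gram_form K v' w"
proof -
  let ?A = "Poly_Mapping.keys v \<union> Poly_Mapping.keys v'"
  have "Poly_Mapping.keys (v + v') \<subseteq> ?A" by (rule Poly_Mapping.keys_add)
  then show ?thesis
    by (simp add: gram_form_superset[where A = ?A and C = "Poly_Mapping.keys w"]
        lookup_add distrib_right sum.distrib)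
qed

lemma gram_form_scaleR_left: "gram_form K (r *\<^sub>R v) w = r * gram_form K v w"
proof -
  have "Poly_Mapping.keys (r *\<^sub>R v) \<subseteq> Poly_Mapping.keys v"
    by (auto simp: in_keys_iff)
  then show ?thesis
    by (simp add: gram_form_superset[where A = "Poly_Mapping.keys v" and C = "Poly_Mapping.keys w"]
        mult.assoc flip: sum_distrib_left)
qed

lemma gram_form_commute:
  assumes "\<And>i j. K i j = K j i"
  shows "gram_form K v w = gram_form K w v"
  unfolding gram_form_superset[OF finite_keys subset_refl finite_keys subset_refl]
  by (subst sum.swap, rule sum.cong[OF HOL.refl], rule sum.cong[OF HOL.refl]) (metis assms mult.commute)

lemma gram_form_single:
  "gram_form K (Poly_Mapping.single i 1) w = (\<Sum>j\<in>Poly_Mapping.keys w. Poly_Mapping.lookup w j * K i j)"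
  by (simp add: gram_form_def)

text \<open>This is the Chebyshev polynomial of the second kind U_(n-1) at c / 2. Its values are the
  coordinates of roots in a dihedral group.\<close>

fun cheb :: "real \<Rightarrow> nat \<Rightarrow> real" where
  "cheb c 0 = 0"
| "cheb c (Suc 0) = 1"
| "cheb c (Suc (Suc n)) = c * cheb c (Suc n) - cheb c n"

lemma cheb_cos: "cheb (2 * cos x) n * sin x = sin (real n * x)"
proof (induction "2 * cos x" n rule: cheb.induct)
  case (3 n)
  have "sin (real n * x) + sin (real (Suc (Suc n)) * x) = 2 * sin (real (Suc n) * x) * cos x"
    using sin_add[of "real (Suc n) * x" x] sin_diff[of "real (Suc n) * x" x]
    by (simp add: algebra_simps)
  with 3 show ?case by (simp add: algebra_simps)
qed simp_all

lemma cheb_two: "cheb 2 n = real n"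
proof (induction "2::real" n rule: cheb.induct)
qed simp_all

text \<open>\<open>t\<close> is always the last letter, hence the first to act, so that longer
  alternating words prolong shorter ones on the left.\<close>

fun alt :: "nat \<Rightarrow> 'a \<Rightarrow> 'a \<Rightarrow> 'a list" where
  "alt 0 s t = []"
| "alt (Suc k) s t = alt k t s @ [t]"

lemma length_alt [simp]: "length (alt k s t) = k"
  by (induction k s t rule: alt.induct) simp_all

lemma set_alt: "set (alt k s t) \<subseteq> {s, t}"
  by (induction k s t rule: alt.induct) auto

lemma alt_Suc_Cons: "alt (Suc k) s t = (if even k then t else s) # alt k s t"
  by (induction k s t rule: alt.induct) auto

lemma rev_alt: "rev (alt k s t) = (if even k then alt k t s else alt k s t)"
proof (induction k arbitrary: s t)
  case (Suc k)
  have "rev (alt (Suc k) s t) = t # rev (alt k t s)" by simp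
  then show ?case unfolding Suc alt_Suc_Cons by simp
qed simp

lemma alt_even: "alt (2 * n) s t = concat (replicate n [s, t])"
proof (induction n)
  case (Suc n)
  have "alt (2 * Suc n) s t = s # t # alt (2 * n) s t"
    using alt_Suc_Cons[of "Suc (2 * n)" s t] alt_Suc_Cons[of "2 * n" s t] by simp
  with Suc show ?case by simp
qed simp

text \<open>Twice the usual Tits form, so that reflections need no factor 2. The diagonal case
  \<open>m s s = 1\<close> gives -2 cos pi = 2, and -2 is the limit of the entries for growing
  order.\<close>

definition tits_entry :: "('a \<Rightarrow> 'a \<Rightarrow> enat) \<Rightarrow> 'a \<Rightarrow> 'a \<Rightarrow> real" where
  "tits_entry m s t = (case m s t of enat n \<Rightarrow> - 2 * cos (pi / real n) | \<infinity> \<Rightarrow> - 2)"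

text \<open>
  The Tits form on the span of the simple roots \<open>(s, False)\<close> may be degenerate. It is extended by
  isotropic vectors \<open>(s, True)\<close> that are dual to the simple roots.
\<close>

definition tits_gram :: "'a set \<Rightarrow> ('a \<Rightarrow> 'a \<Rightarrow> enat) \<Rightarrow> 'a \<times> bool \<Rightarrow> 'a \<times> bool \<Rightarrow> real" where
  "tits_gram S m i j =
    (if snd i \<noteq> snd j then of_bool (fst i = fst j)
     else if snd i then 0
     else if fst i \<in> S \<and> fst j \<in> S then tits_entry m (fst i) (fst j) else 0)"

locale tits_representation =
  fixes S :: "'a set" and m :: "'a \<Rightarrow> 'a \<Rightarrow> enat"
  assumes coxeter_matrix: "coxeter_matrix S m"
begin

abbreviation B :: "('a \<times> bool \<Rightarrow>\<^sub>0 real) \<Rightarrow> ('a \<times> bool \<Rightarrow>\<^sub>0 real) \<Rightarrow> real" where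
  "B \<equiv> gram_form (tits_gram S m)"

definition sroot :: "'a \<Rightarrow> ('a \<times> bool \<Rightarrow>\<^sub>0 real)" where
  "sroot s = Poly_Mapping.single (s, False) 1"

definition coord :: "('a \<times> bool \<Rightarrow>\<^sub>0 real) \<Rightarrow> 'a \<Rightarrow> real" where
  "coord v s = Poly_Mapping.lookup v (s, False)"

definition srefl :: "'a \<Rightarrow> ('a \<times> bool \<Rightarrow>\<^sub>0 real) \<Rightarrow> ('a \<times> bool \<Rightarrow>\<^sub>0 real)" where
  "srefl s v = v - B v (sroot s) *\<^sub>R sroot s"

definition act :: "'a list \<Rightarrow> ('a \<times> bool \<Rightarrow>\<^sub>0 real) \<Rightarrow> ('a \<times> bool \<Rightarrow>\<^sub>0 real)" where
  "act = foldr srefl"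

lemma order_ge_2:
  assumes "s \<in> S" "t \<in> S" "s \<noteq> t"
  shows "enat 2 \<le> m s t"
  using coxeter_matrix assms by (auto simp: coxeter_matrix_def numeral_eq_enat)

lemma entry_commute: "\<lbrakk>s \<in> S; t \<in> S\<rbrakk> \<Longrightarrow> tits_entry m s t = tits_entry m t s"
  using coxeter_matrix by (cases "s = t") (auto simp: coxeter_matrix_def tits_entry_def)

lemma B_commute: "B v w = B w v"
  by (rule gram_form_commute) (auto simp: tits_gram_def entry_commute)

lemma B_add_left: "B (v + v') w = B v w + B v' w"
  by (rule gram_form_add_left)

lemma B_scaleR_left: "B (r *\<^sub>R v) w = r * B v w"
  by (rule gram_form_scaleR_left)

lemma B_add_right: "B w (v + v') = B w v + B w v'"
  using B_add_left[of v v' w] B_commute[of w] by simp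

lemma B_scaleR_right: "B w (r *\<^sub>R v) = r * B w v"
  using B_scaleR_left[of r v w] B_commute[of w] by simp

lemma B_minus_left: "B (- v) w = - B v w"
  using B_scaleR_left[of "-1" v w] by simp

lemma B_minus_right: "B w (- v) = - B w v"
  using B_scaleR_right[of w "-1" v] by simp

lemma B_diff_left: "B (v - v') w = B v w - B v' w"
  using B_add_left[of v "- v'" w] by (simp add: B_minus_left)

lemma B_diff_right: "B w (v - v') = B w v - B w v'"
  using B_add_right[of w v "- v'"] by (simp add: B_minus_right)

lemma B_zero_right [simp]: "B w 0 = 0"
  using B_scaleR_right[of w 0 0] by simp

lemmas B_simps = B_add_left B_add_right B_scaleR_left B_scaleR_right B_minus_left B_minus_right
  B_diff_left B_diff_right

lemma B_sroot: "\<lbrakk>s \<in> S; t \<in> S\<rbrakk> \<Longrightarrow> B (sroot s) (sroot t) = tits_entry m s t"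
  by (simp add: sroot_def gram_form_single tits_gram_def)

lemma B_sroot_self: "s \<in> S \<Longrightarrow> B (sroot s) (sroot s) = 2"
  using coxeter_matrix by (simp add: B_sroot tits_entry_def coxeter_matrix_def one_enat_def)

lemma B_dual: "B (Poly_Mapping.single (s, True) 1) w = coord w s"
proof -
  have "B (Poly_Mapping.single (s, True) 1) w =
      (\<Sum>j\<in>Poly_Mapping.keys w. if j = (s, False) then Poly_Mapping.lookup w j else 0)"
    unfolding gram_form_single
    by (rule sum.cong) (auto simp: tits_gram_def)
  also have "\<dots> = coord w s"
    by (auto simp: coord_def in_keys_iff)
  finally show ?thesis .
qed

lemma coord_simps [simp]:
  "coord (v + w) s = coord v s + coord w s"
  "coord (v - w) s = coord v s - coord w s"
  "coord (- v) s = - coord v s"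
  "coord (r *\<^sub>R v) s = r * coord v s"
  "coord 0 s = 0"
  by (simp_all add: coord_def lookup_add lookup_minus)

lemma srefl_simps:
  "srefl s (v + w) = srefl s v + srefl s w"
  "srefl s (v - w) = srefl s v - srefl s w"
  "srefl s (- v) = - srefl s v"
  "srefl s (r *\<^sub>R v) = r *\<^sub>R srefl s v"
  by (simp_all add: srefl_def B_simps algebra_simps)

lemma srefl_sroot: "s \<in> S \<Longrightarrow> srefl s (sroot s) = - sroot s"
  by (simp add: srefl_def B_sroot_self scaleR_2)

lemma srefl_srefl: "s \<in> S \<Longrightarrow> srefl s (srefl s v) = v"
  by (simp add: srefl_def B_simps B_sroot_self algebra_simps)

lemma B_srefl: "s \<in> S \<Longrightarrow> B (srefl s v) (srefl s w) = B v w"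
  using B_commute[of "sroot s" w] by (simp add: srefl_def B_simps B_sroot_self)

lemma act_Nil [simp]: "act [] v = v"
  and act_Cons [simp]: "act (s # xs) v = srefl s (act xs v)"
  and act_append: "act (xs @ ys) v = act xs (act ys v)"
  by (simp_all add: act_def)

lemma act_simps:
  "act xs (v + w) = act xs v + act xs w"
  "act xs (v - w) = act xs v - act xs w"
  "act xs (- v) = - act xs v"
  "act xs (r *\<^sub>R v) = r *\<^sub>R act xs v"
  by (induction xs) (simp_all add: srefl_simps)

lemma B_act: "set xs \<subseteq> S \<Longrightarrow> B (act xs v) (act xs w) = B v w"
  by (induction xs) (simp_all add: B_srefl)

text \<open>The next reflection changes only one of the two coordinates, and the new value is given
  by the three-term recursion of \<open>cheb\<close>.\<close>

lemma act_alt_sroot: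
  assumes "s \<in> S" "t \<in> S"
  defines "p \<equiv> cheb (- tits_entry m s t)"
  shows "act (alt k s t) (sroot s) =
    (if even k then p (Suc k) *\<^sub>R sroot s + p k *\<^sub>R sroot t
     else p k *\<^sub>R sroot s + p (Suc k) *\<^sub>R sroot t)"
proof (induction k)
  case 0
  then show ?case by (simp add: p_def)
next
  case (Suc k)
  have "B (sroot s) (sroot t) = tits_entry m s t" "B (sroot t) (sroot s) = tits_entry m s t"
    using assms B_commute by (simp_all add: B_sroot)
  then show ?case
    using Suc assms(1,2)
    unfolding alt_Suc_Cons
    by (auto simp: srefl_simps srefl_sroot srefl_def[of s "sroot t"] srefl_def[of t "sroot s"] 
        p_def algebra_simps)
qed

text \<open>For finite order n the value is sin (k pi / n) / sin (pi / n), where the angle stays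
  within a half turn; for infinite order it is k.\<close>

lemma cheb_entry_nonneg:
  assumes "s \<in> S" "t \<in> S" "s \<noteq> t" "enat k \<le> m s t"
  shows "cheb (- tits_entry m s t) k \<ge> 0"
proof (cases "m s t")
  case (enat n)
  have n: "2 \<le> n" 
    using order_ge_2[OF assms(1-3)] enat by simp
  define x where "x = pi / real n"
  have x: "0 < x" "x < pi" and kx: "real k * x \<le> pi"
    using n assms(4) enat by (auto simp: x_def field_simps)
  have "cheb (2 * cos x) k * sin x \<ge> 0"
    unfolding cheb_cos using x kx by (intro sin_ge_zero) auto
  then show ?thesis
    using sin_gt_zero[OF x] enat by (simp add: tits_entry_def x_def zero_le_mult_iff)
next
  case infinity
  then show ?thesis by (simp add: tits_entry_def cheb_two)
qed

text \<open>Each of the 2n letters advances the angle in \<open>cheb_cos\<close> by pi / n, so the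
  whole word makes a full turn.\<close>

lemma act_alt_full_sroot:
  assumes "s \<in> S" "t \<in> S" "m s t = enat n" "s \<noteq> t"
  shows "act (alt (2 * n) s t) (sroot s) = sroot s"
proof -
  have n: "2 \<le> n" 
    using order_ge_2[OF assms(1,2) assms(4)] assms(3) by simp
  define x where "x = pi / real n"
  have x: "0 < x" "x < pi" and nx: "real n * x = pi"
    using n by (auto simp: x_def field_simps)
  have c: "- tits_entry m s t = 2 * cos x" by (simp add: tits_entry_def assms(3) x_def)
  have "cheb (2 * cos x) (2 * n) * sin x = 0" 
    using nx unfolding cheb_cos by (metis mult.assoc of_nat_mult of_nat_numeral sin_two_pi)
  moreover have "real (Suc (2 * n)) * x = 2 * pi + x" using nx by (simp add: algebra_simps)
  then have "cheb (2 * cos x) (Suc (2 * n)) * sin x = sin x" 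
    unfolding cheb_cos by (simp add: sin_add)
  ultimately have "cheb (2 * cos x) (2 * n) = 0" "cheb (2 * cos x) (Suc (2 * n)) = 1"
    using sin_gt_zero[OF x] by auto
  then show ?thesis
    using act_alt_sroot[OF assms(1,2), of "2 * n"] by (simp add: c)
qed

lemma act_rev: "set xs \<subseteq> S \<Longrightarrow> act (rev xs) (act xs v) = v"
  by (induction xs) (simp_all add: act_append srefl_srefl)

text \<open>For finite \<open>m s t\<close> the form is nondegenerate on the plane spanned by the two simple roots.\<close>

lemma act_relation:
  assumes "s \<in> S" "t \<in> S" "m s t = enat n"
  shows "act (concat (replicate n [s, t])) v = v"
proof (cases "s = t")
  case True
  then have "act (concat (replicate k [s, t])) v = v" for k
    using assms(1) by (induction k) (simp_all add: srefl_srefl)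
  then show ?thesis .
next
  case False
  have n: "2 \<le> n" 
    using order_ge_2[OF assms(1,2) False] assms(3) by simp
  let ?A = "alt (2 * n) s t"
  have fs: "act ?A (sroot s) = sroot s"
    using act_alt_full_sroot[OF assms False] .
  have "m t s = enat n" 
    using coxeter_matrix assms False by (auto simp: coxeter_matrix_def)
  \<comment> \<open>The reversed word is the alternating word with \<open>s\<close> and
    \<open>t\<close> exchanged, so it fixes \<open>sroot t\<close> by the same computation; undoing
    it shows that \<open>?A\<close> fixes \<open>sroot t\<close> too.\<close>
  then have "act (rev ?A) (sroot t) = sroot t"
    using rev_alt[of "2 * n" s t] act_alt_full_sroot[of t s n] assms False by simp
  then have ft: "act ?A (sroot t) = sroot t"
    using act_rev[of "rev ?A" "sroot t"] set_alt[of "2 * n" s t] assms(1,2) by auto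
  define c where "c = B (sroot s) (sroot t)"
  have cc: "c = - 2 * cos (pi / real n)"
    using assms by (simp add: c_def B_sroot tits_entry_def)
  have "0 < pi / real n" "pi / real n < pi" using n by (auto simp: field_simps)
  then have "0 < (sin (pi / real n))\<^sup>2" using sin_gt_zero by fastforce
  then have "(cos (pi / real n))\<^sup>2 < 1" by (simp add: sin_squared_eq)
  then have d: "4 - c\<^sup>2 \<noteq> 0" by (simp add: cc power_mult_distrib)
  \<comment> \<open>\<open>a\<close> and \<open>b\<close> solve, by Cramer's rule, the two equations
    saying that \<open>v0\<close> is orthogonal to both roots. The Gram determinant is 4 sin^2 (pi /
    n).\<close>
  define a where "a = (2 * B v (sroot s) - c * B v (sroot t)) / (4 - c\<^sup>2)"
  define b where "b = (2 * B v (sroot t) - c * B v (sroot s)) / (4 - c\<^sup>2)"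
  define v0 where "v0 = v - (a *\<^sub>R sroot s + b *\<^sub>R sroot t)"
  have ct: "B (sroot t) (sroot s) = c" by (simp add: c_def B_commute)
  have "a * (4 - c\<^sup>2) = 2 * B v (sroot s) - c * B v (sroot t)"
    "b * (4 - c\<^sup>2) = 2 * B v (sroot t) - c * B v (sroot s)"
    using d by (simp_all add: a_def b_def)
  then have "(4 - c\<^sup>2) * (2 * a + c * b) = (4 - c\<^sup>2) * B v (sroot s)"
    "(4 - c\<^sup>2) * (c * a + 2 * b) = (4 - c\<^sup>2) * B v (sroot t)"
    by algebra+
  then have "2 * a + c * b = B v (sroot s)" "c * a + 2 * b = B v (sroot t)" using d by auto
  then have vs: "B v0 (sroot s) = 0" and vt: "B v0 (sroot t) = 0"
    by (simp_all add: v0_def B_simps B_sroot_self assms ct mult.commute flip: c_def) 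
  have "set xs \<subseteq> {s, t} \<Longrightarrow> act xs v0 = v0" for xs
    using vs vt by (induction xs) (auto simp: srefl_def)
  then have "act ?A v0 = v0" using set_alt by metis
  moreover have "v = v0 + a *\<^sub>R sroot s + b *\<^sub>R sroot t" by (simp add: v0_def)
  ultimately have "act ?A v = v" by (simp add: act_simps fs ft)
  then show ?thesis by (simp add: alt_even)
qed

end

section \<open>Presented groups and words\<close>

lemma gwords_Nil [simp]: "[] \<in> gwords X"
  and gwords_Cons [simp]: "(a # u) \<in> gwords X \<longleftrightarrow> fst a \<in> X \<and> u \<in> gwords X"
  and gwords_append [simp]: "u @ v \<in> gwords X \<longleftrightarrow> u \<in> gwords X \<and> v \<in> gwords X"
  and gwords_map_True [simp]: "map (\<lambda>x. (x, b)) us \<in> gwords X \<longleftrightarrow> set us \<subseteq> X"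
  by (auto simp: gwords_def image_subset_iff)

lemma pres_cong_gwords:
  "(u, v) \<in> pres_cong X R \<Longrightarrow> u \<in> gwords X \<and> v \<in> gwords X"
  by (induction rule: pres_cong.induct) auto

lemma equiv_pres_cong: "equiv (gwords X) (pres_cong X R)"
proof (rule equivI)
  show "pres_cong X R \<subseteq> gwords X \<times> gwords X" using pres_cong_gwords by fastforce
  show "refl_on (gwords X) (pres_cong X R)"
    by (rule refl_onI) (auto intro: pres_cong.refl)
  show "sym_on UNIV (pres_cong X R)" by (rule symI) (rule pres_cong.sym)
  show "trans_on UNIV (pres_cong X R)" by (rule transI) (rule pres_cong.trans)
qed

lemma pres_cong_append_context:
  assumes "(u, v) \<in> pres_cong X R" "p \<in> gwords X" "q \<in> gwords X"
  shows "(p @ u @ q, p @ v @ q) \<in> pres_cong X R"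
  using assms
proof (induction rule: pres_cong.induct)
  case (refl u)
  then show ?case by (auto intro: pres_cong.refl)
next
  case (cancel p' q' x b)
  then show ?case using pres_cong.cancel[of "p @ p'" X "q' @ q" x b R] by simp
next
  case (relation p' q' l r)
  then show ?case using pres_cong.relation[of "p @ p'" X "q' @ q" l r R] by simp
qed (auto intro: pres_cong.sym pres_cong.trans)

lemma pres_cong_append:
  assumes "(u, u') \<in> pres_cong X R" "(v, v') \<in> pres_cong X R"
  shows "(u @ v, u' @ v') \<in> pres_cong X R"
proof (rule pres_cong.trans)
  show "(u @ v, u' @ v) \<in> pres_cong X R"
    using pres_cong_append_context[OF assms(1), of "[]" v] pres_cong_gwords[OF assms(2)] by simp
  show "(u' @ v, u' @ v') \<in> pres_cong X R"
    using pres_cong_append_context[OF assms(2), of u' "[]"] pres_cong_gwords[OF assms(1)] by simp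
qed

definition pres_class where
  "pres_class X R u = pres_cong X R `` {u}"

lemma pres_class_eq_iff:
  assumes "u \<in> gwords X" "v \<in> gwords X"
  shows "pres_class X R u = pres_class X R v \<longleftrightarrow> (u, v) \<in> pres_cong X R"
  unfolding pres_class_def
  using eq_equiv_class_iff[OF equiv_pres_cong assms] by simp

lemma presented_group_simps:
  "carrier (presented_group X R) = pres_class X R ` gwords X"
  "\<one>\<^bsub>presented_group X R\<^esub> = pres_class X R []"
  by (auto simp: presented_group_def pres_class_def quotient_def)

lemma pres_class_closed [simp]:
  "u \<in> gwords X \<Longrightarrow> pres_class X R u \<in> carrier (presented_group X R)"
  by (simp add: presented_group_simps)

lemma pres_class_mult:
  assumes "u \<in> gwords X" "v \<in> gwords X"
  shows "pres_class X R u \<otimes>\<^bsub>presented_group X R\<^esub> pres_class X R v = pres_class X R (u @ v)"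
proof -
  have "(\<Union>u'\<in>pres_class X R u. \<Union>v'\<in>pres_class X R v. pres_class X R (u' @ v')) =
      pres_class X R (u @ v)" (is "?L = _")
  proof -
    have "pres_class X R (u' @ v') = pres_class X R (u @ v)"
      if "u' \<in> pres_class X R u" "v' \<in> pres_class X R v" for u' v'
    proof -
      have "(u, u') \<in> pres_cong X R" "(v, v') \<in> pres_cong X R"
        using that by (auto simp: pres_class_def)
      then have "(u @ v, u' @ v') \<in> pres_cong X R" by (rule pres_cong_append)
      then show ?thesis using pres_class_eq_iff pres_cong_gwords by metis
    qed
    moreover have "u \<in> pres_class X R u" "v \<in> pres_class X R v"
      using assms by (auto simp: pres_class_def intro: pres_cong.refl)
    ultimately show ?thesis by blast
  qed
  then show ?thesis by (simp add: presented_group_def pres_class_def)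
qed

lemma pres_cong_inverse:
  assumes "u \<in> gwords X"
  shows "(map (\<lambda>(x, b). (x, \<not> b)) (rev u) @ u, []) \<in> pres_cong X R"
  using assms
proof (induction u)
  case (Cons a u)
  obtain x b where a: "a = (x, b)" by (cases a)
  let ?r = "map (\<lambda>(x, b). (x, \<not> b)) (rev u)"
  have r: "?r \<in> gwords X" using Cons.prems by (auto simp: gwords_def)
  have "(?r @ [(x, \<not> b), (x, \<not> \<not> b)] @ u, ?r @ u) \<in> pres_cong X R"
    using Cons.prems r a by (intro pres_cong.cancel) auto
  then show ?case using Cons a by (auto intro: pres_cong.trans)
qed (auto intro: pres_cong.refl)

lemma group_presented_group: "group (presented_group X R)"
proof (rule groupI)
  show "\<exists>y\<in>carrier (presented_group X R). y \<otimes>\<^bsub>presented_group X R\<^esub> x = \<one>\<^bsub>presented_group X R\<^esub>"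
    if x: "x \<in> carrier (presented_group X R)" for x
  proof -
    obtain u where u: "u \<in> gwords X" "x = pres_class X R u"
      using x by (auto simp: presented_group_simps)
    let ?r = "map (\<lambda>(x, b). (x, \<not> b)) (rev u)"
    have r: "?r \<in> gwords X" using u(1) by (auto simp: gwords_def)
    show ?thesis
      using u r pres_cong_inverse[OF u(1), of R]
      by (intro bexI[of _ "pres_class X R ?r"])
         (simp_all add: pres_class_mult presented_group_simps pres_class_eq_iff)
  qed
qed (auto simp: presented_group_simps pres_class_mult)

section \<open>Word length in groups generated by involutions\<close>

definition wprod :: "('a, 'b) monoid_scheme \<Rightarrow> 'a list \<Rightarrow> 'a" where
  "wprod G as = foldr (\<otimes>\<^bsub>G\<^esub>) as \<one>\<^bsub>G\<^esub>"

lemma wprod_Nil [simp]: "wprod G [] = \<one>\<^bsub>G\<^esub>"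
  and wprod_Cons [simp]: "wprod G (a # as) = a \<otimes>\<^bsub>G\<^esub> wprod G as"
  by (simp_all add: wprod_def)

lemma (in monoid) wprod_closed [simp]: "set as \<subseteq> carrier G \<Longrightarrow> wprod G as \<in> carrier G"
  by (induction as) auto

lemma (in monoid) wprod_append:
  "\<lbrakk>set as \<subseteq> carrier G; set bs \<subseteq> carrier G\<rbrakk> \<Longrightarrow> wprod G (as @ bs) = wprod G as \<otimes> wprod G bs"
  by (induction as) (auto simp: m_assoc)

lemma word_length_wprod:
  "word_length G A g = (LEAST n. \<exists>as. set as \<subseteq> A \<and> length as = n \<and> wprod G as = g)"
  by (simp add: word_length_def wprod_def)

lemma (in group) inv_mult_cancel [simp]:
  assumes "g \<in> carrier G" "x \<in> carrier G"
  shows "inv g \<otimes> (g \<otimes> x) = x" "g \<otimes> (inv g \<otimes> x) = x"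
  using assms by (simp_all flip: m_assoc)

lemma (in group) mult_involution_cancel:
  assumes "t \<in> carrier G" "t \<otimes> t = \<one>" "x \<in> carrier G"
  shows "t \<otimes> (t \<otimes> x) = x"
  using assms by (simp flip: m_assoc)

text \<open>Used twice for a Coxeter group: with the simple generators it gives the usual length,
  with all reflections the reflection length.\<close>

locale involution_generated = group G for G :: "('a, 'b) monoid_scheme" (structure) +
  fixes A :: "'a set"
  assumes gens_closed: "A \<subseteq> carrier G"
    and gens_invol: "a \<in> A \<Longrightarrow> a \<otimes> a = \<one>"
    and gens_generate: "g \<in> carrier G \<Longrightarrow> \<exists>as. set as \<subseteq> A \<and> wprod G as = g"
begin

abbreviation len :: "'a \<Rightarrow> nat" where "len \<equiv> word_length G A"

lemma gen_closed [simp]: "a \<in> A \<Longrightarrow> a \<in> carrier G"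
  using gens_closed by blast

lemma gens_list_closed [simp]: "set as \<subseteq> A \<Longrightarrow> set as \<subseteq> carrier G"
  using gens_closed by blast

lemma inv_gen: "a \<in> A \<Longrightarrow> inv a = a"
  using gens_invol by (simp add: inv_equality)

lemma len_le: "\<lbrakk>set as \<subseteq> A; wprod G as = g\<rbrakk> \<Longrightarrow> len g \<le> length as"
  unfolding word_length_wprod by (rule Least_le) auto

lemma len_word:
  assumes "g \<in> carrier G"
  obtains as where "set as \<subseteq> A" "length as = len g" "wprod G as = g"
proof -
  have "\<exists>n as. set as \<subseteq> A \<and> length as = n \<and> wprod G as = g"
    using gens_generate[OF assms] by blast
  then have "\<exists>as. set as \<subseteq> A \<and> length as = len g \<and> wprod G as = g"
    unfolding word_length_wprod by (rule LeastI_ex)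
  then show ?thesis using that by blast
qed

lemma len_one [simp]: "len \<one> = 0"
  using len_le[of "[]" \<one>] by simp

lemma len_eq_0: "g \<in> carrier G \<Longrightarrow> len g = 0 \<longleftrightarrow> g = \<one>"
  by (metis len_one len_word length_0_conv wprod_Nil)

lemma len_mult: "\<lbrakk>g \<in> carrier G; h \<in> carrier G\<rbrakk> \<Longrightarrow> len (g \<otimes> h) \<le> len g + len h"
proof -
  assume "g \<in> carrier G" "h \<in> carrier G"
  then obtain as bs where "set as \<subseteq> A" "length as = len g" "wprod G as = g"
    "set bs \<subseteq> A" "length bs = len h" "wprod G bs = h"
    using len_word by metis
  then show ?thesis using len_le[of "as @ bs" "g \<otimes> h"] by (simp add: wprod_append)
qed

lemma wprod_rev: "set as \<subseteq> A \<Longrightarrow> wprod G (rev as) = inv (wprod G as)"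
  by (induction as) (simp_all add: wprod_append inv_mult_group inv_gen)

lemma len_inv: "g \<in> carrier G \<Longrightarrow> len (inv g) = len g"
proof -
  have le: "len (inv g) \<le> len g" if g: "g \<in> carrier G" for g
  proof -
    obtain as where as: "set as \<subseteq> A" "length as = len g" "wprod G as = g"
      using len_word[OF g] .
    then have "wprod G (rev as) = inv g" using wprod_rev by blast
    then show ?thesis using len_le[of "rev as" "inv g"] as by simp
  qed
  assume "g \<in> carrier G"
  then show ?thesis using le[of g] le[of "inv g"] by simp
qed

lemma len_gen_le: "a \<in> A \<Longrightarrow> len a \<le> 1"
  using len_le[of "[a]" a] by simp

lemma len_eq_1: 
  assumes "len g = 1" "g \<in> carrier G" shows "g \<in> A"
proof -
  obtain as where "set as \<subseteq> A" "length as = 1" "wprod G as = g"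
    using len_word[OF assms(2)] assms(1) by metis
  then show ?thesis by (auto simp: length_Suc_conv)
qed

lemma wprod_conj:
  "\<lbrakk>g \<in> carrier G; set as \<subseteq> carrier G\<rbrakk> \<Longrightarrow>
    wprod G (map (\<lambda>a. g \<otimes> a \<otimes> inv g) as) = g \<otimes> wprod G as \<otimes> inv g"
proof (induction as)
  case (Cons a as)
  then show ?case by (simp add: m_assoc)
qed simp

lemma len_conj:
  assumes conj: "\<And>g a. \<lbrakk>g \<in> carrier G; a \<in> A\<rbrakk> \<Longrightarrow> g \<otimes> a \<otimes> inv g \<in> A"
    and "g \<in> carrier G" "x \<in> carrier G"
  shows "len (g \<otimes> x \<otimes> inv g) = len x"
proof -
  have le: "len (g \<otimes> x \<otimes> inv g) \<le> len x" if g: "g \<in> carrier G" "x \<in> carrier G" for g x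
  proof -
    obtain as where as: "set as \<subseteq> A" "length as = len x" "wprod G as = x"
      using len_word[OF g(2)] .
    then have "set (map (\<lambda>a. g \<otimes> a \<otimes> inv g) as) \<subseteq> A" using conj g(1) by auto
    moreover have "wprod G (map (\<lambda>a. g \<otimes> a \<otimes> inv g) as) = g \<otimes> x \<otimes> inv g"
      using as wprod_conj[OF g(1)] by auto
    ultimately show ?thesis using len_le as(2) by (metis length_map)
  qed
  have "inv g \<otimes> (g \<otimes> x \<otimes> inv g) \<otimes> inv (inv g) = x"
    using assms by (simp add: m_assoc)
  then show ?thesis
    using le[OF assms(2,3)] le[of "inv g" "g \<otimes> x \<otimes> inv g"] assms by simp
qed

end

text \<open>The matrix and the isomorphism, which a Coxeter system only asserts to exist, become
  parameters so that the representation can depend on them.\<close>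

locale coxeter_presented = group W for W :: "('a, 'b) monoid_scheme" (structure) +
  fixes S :: "'a set" and m :: "'a \<Rightarrow> 'a \<Rightarrow> enat" and h :: "'a gword set \<Rightarrow> 'a"
  assumes S_closed: "S \<subseteq> carrier W"
    and matrix: "coxeter_matrix S m"
    and h_iso: "h \<in> iso (presented_group S (coxeter_relations S m)) W"
    and h_gen: "s \<in> S \<Longrightarrow> h (presented_gen S (coxeter_relations S m) s) = s"

sublocale coxeter_presented \<subseteq> tits_representation S m
  by unfold_locales (rule matrix)

context coxeter_presented
begin

abbreviation P where "P \<equiv> presented_group S (coxeter_relations S m)"
abbreviation cls where "cls \<equiv> pres_class S (coxeter_relations S m)"

lemma group_P: "group P" by (rule group_presented_group)

lemma h_hom: "h \<in> hom P W" and h_inj: "inj_on h (carrier P)" and h_surj: "h ` carrier P = carrier W"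
  using h_iso by (auto simp: iso_def bij_betw_def)

lemma h_mult: "\<lbrakk>u \<in> gwords S; v \<in> gwords S\<rbrakk> \<Longrightarrow> h (cls (u @ v)) = h (cls u) \<otimes> h (cls v)"
  using hom_mult[OF h_hom, of "cls u" "cls v"] by (simp add: pres_class_mult)

lemma h_Nil: "h (cls []) = \<one>"
  using hom_one[OF h_hom group_P] is_group by (simp add: presented_group_simps)

lemma h_True: "s \<in> S \<Longrightarrow> h (cls [(s, True)]) = s"
  using h_gen by (simp add: presented_gen_def pres_class_def)

lemma relation_P:
  assumes "s \<in> S" "t \<in> S" "m s t = enat n"
  shows "(concat (replicate n [(s, True), (t, True)]), []) \<in> pres_cong S (coxeter_relations S m)"
proof -
  let ?l = "concat (replicate n [(s, True), (t, True)])"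
  have "?l \<in> gwords S" using assms(1,2) by (induction n) auto
  moreover have "(?l, []) \<in> coxeter_relations S m"
    using assms by (auto simp: coxeter_relations_def)
  ultimately show ?thesis
    using pres_cong.relation[of "[]" S "[]" ?l "[]" "coxeter_relations S m"] by simp
qed

lemma S_invol: "s \<in> S \<Longrightarrow> s \<otimes> s = \<one>"
proof -
  assume s: "s \<in> S"
  then have "m s s = enat 1" using matrix by (simp add: coxeter_matrix_def one_enat_def)
  then have "([(s, True), (s, True)], []) \<in> pres_cong S (coxeter_relations S m)"
    using relation_P[OF s s, of 1] by simp
  then have "cls [(s, True), (s, True)] = cls []" using s by (simp add: pres_class_eq_iff)
  then show ?thesis using h_mult[of "[(s, True)]" "[(s, True)]"] s by (simp add: h_True h_Nil)
qed

text \<open>A generator is an involution in \<open>W\<close>, so its formal inverse has the same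
  image, and signs of letters can be forgotten when words are evaluated.\<close>

lemma h_letter: "s \<in> S \<Longrightarrow> h (cls [(s, b)]) = s"
proof (cases b)
  case False
  assume s: "s \<in> S"
  have "([(s, False), (s, True)], []) \<in> pres_cong S (coxeter_relations S m)"
    using s pres_cong.cancel[of "[]" S "[]" s False] by simp
  then have "cls [(s, False), (s, True)] = cls []" using s by (simp add: pres_class_eq_iff)
  then have "h (cls [(s, False)]) \<otimes> s = s \<otimes> s"
    using h_mult[of "[(s, False)]" "[(s, True)]"] s by (simp add: h_True h_Nil S_invol)
  moreover have "h (cls [(s, False)]) \<in> carrier W"
    using h_hom s by (auto simp: hom_def)
  ultimately show ?thesis using s S_closed False by auto
qed (simp add: h_True)

lemma h_word: "u \<in> gwords S \<Longrightarrow> h (cls u) = wprod W (map fst u)"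
proof (induction u)
  case (Cons a u)
  then show ?case using h_mult[of "[a]" u] h_letter[of "fst a" "snd a"] by simp
qed (simp add: h_Nil)

end

sublocale coxeter_presented \<subseteq> involution_generated W S
proof
  show "S \<subseteq> carrier W" by (rule S_closed)
  show "a \<otimes> a = \<one>" if "a \<in> S" for a using that by (rule S_invol)
  show "\<exists>as. set as \<subseteq> S \<and> wprod W as = g" if "g \<in> carrier W" for g
  proof -
    obtain u where "u \<in> gwords S" "g = h (cls u)"
      using \<open>g \<in> carrier W\<close> h_surj by (auto simp: presented_group_simps)
    then show ?thesis using h_word by (intro exI[of _ "map fst u"]) (auto simp: gwords_def)
  qed
qed

context coxeter_presented
begin

lemma pres_cong_of_wprod_eq:
  assumes "set us \<subseteq> S" "set vs \<subseteq> S" "wprod W us = wprod W vs"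
  shows "(map (\<lambda>s. (s, True)) us, map (\<lambda>s. (s, True)) vs) \<in> pres_cong S (coxeter_relations S m)"
proof -
  let ?u = "map (\<lambda>s. (s, True)) us" and ?v = "map (\<lambda>s. (s, True)) vs"
  have uv: "?u \<in> gwords S" "?v \<in> gwords S" using assms by auto
  then have "h (cls ?u) = h (cls ?v)" using assms(3) by (simp add: h_word comp_def)
  then have "cls ?u = cls ?v" using h_inj uv by (auto dest: inj_onD)
  then show ?thesis using uv by (simp add: pres_class_eq_iff)
qed

text \<open>Every defining relation and every cancellation removes an even number of letters. This
  is the sign character.\<close>

lemma pres_cong_parity:
  "(u, v) \<in> pres_cong S (coxeter_relations S m) \<Longrightarrow> even (length u) = even (length v)"
proof (induction rule: pres_cong.induct)
  case (relation p q l r)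
  then obtain s t n where "l = concat (replicate n [(s, True), (t, True)])" "r = []"
    by (auto simp: coxeter_relations_def)
  moreover have "even (length (concat (replicate n [x, y])))" for n and x y :: "'a \<times> bool"
    by (induction n) auto
  ultimately show ?case by simp
qed auto

lemma pres_cong_act:
  "(u, v) \<in> pres_cong S (coxeter_relations S m) \<Longrightarrow> act (map fst u) = act (map fst v)"
proof (induction rule: pres_cong.induct)
  case (relation p q l r)
  then obtain s t n where l: "l = concat (replicate n [(s, True), (t, True)])" "r = []"
    and st: "s \<in> S" "t \<in> S" "m s t = enat n"
    by (auto simp: coxeter_relations_def)
  have "map fst l = concat (replicate n [s, t])" unfolding l by (induction n) auto
  then show ?case using act_relation[OF st] l by (auto simp: act_append fun_eq_iff)
qed (auto simp: act_append srefl_srefl fun_eq_iff)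

lemma parity: "\<lbrakk>set us \<subseteq> S; set vs \<subseteq> S; wprod W us = wprod W vs\<rbrakk> \<Longrightarrow>
    even (length us) = even (length vs)"
  using pres_cong_parity[OF pres_cong_of_wprod_eq[of us vs]] by simp

lemma act_cong: "\<lbrakk>set us \<subseteq> S; set vs \<subseteq> S; wprod W us = wprod W vs\<rbrakk> \<Longrightarrow> act us = act vs"
  using pres_cong_act[OF pres_cong_of_wprod_eq[of us vs]] by (simp add: comp_def)

lemma wprod_relation:
  assumes "s \<in> S" "t \<in> S" "m s t = enat n"
  shows "wprod W (concat (replicate n [s, t])) = \<one>"
proof -
  let ?l = "concat (replicate n [(s, True), (t, True)])"
  have "?l \<in> gwords S" using assms(1,2) by (induction n) auto
  moreover have "map fst ?l = concat (replicate n [s, t])" by (induction n) auto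
  ultimately show ?thesis
    using relation_P[OF assms] h_word[of ?l] by (simp add: pres_class_eq_iff[symmetric] h_Nil)
qed

definition rho :: "'a \<Rightarrow> ('a \<times> bool \<Rightarrow>\<^sub>0 real) \<Rightarrow> ('a \<times> bool \<Rightarrow>\<^sub>0 real)" where
  "rho x = act (SOME us. set us \<subseteq> S \<and> wprod W us = x)"

lemma rho_wprod: "set us \<subseteq> S \<Longrightarrow> rho (wprod W us) = act us"
  unfolding rho_def
  by (rule someI2[where P = "\<lambda>vs. set vs \<subseteq> S \<and> wprod W vs = wprod W us"])
     (auto intro: act_cong)

lemma rho_mult: "\<lbrakk>x \<in> carrier W; y \<in> carrier W\<rbrakk> \<Longrightarrow> rho (x \<otimes> y) v = rho x (rho y v)"
proof -
  assume "x \<in> carrier W" "y \<in> carrier W"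
  then obtain us vs where "set us \<subseteq> S" "wprod W us = x" "set vs \<subseteq> S" "wprod W vs = y"
    using gens_generate by metis
  then show ?thesis using rho_wprod[of "us @ vs"] rho_wprod[of us] rho_wprod[of vs]
    by (auto simp: wprod_append act_append)
qed

lemma rho_one [simp]: "rho \<one> v = v"
  using rho_wprod[of "[]"] by simp

lemma rho_gen: "s \<in> S \<Longrightarrow> rho s v = srefl s v"
  using rho_wprod[of "[s]"] by simp

lemma rho_inv_left [simp]: "x \<in> carrier W \<Longrightarrow> rho (inv x) (rho x v) = v"
  and rho_inv_right [simp]: "x \<in> carrier W \<Longrightarrow> rho x (rho (inv x) v) = v"
  by (simp_all flip: rho_mult)

lemma rho_simps:
  assumes "x \<in> carrier W"
  shows "rho x (v + w) = rho x v + rho x w" "rho x (v - w) = rho x v - rho x w"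
    "rho x (- v) = - rho x v" "rho x (r *\<^sub>R v) = r *\<^sub>R rho x v" "B (rho x v) (rho x w) = B v w"
  using gens_generate[OF assms] rho_wprod by (auto simp: act_simps B_act)

end

section \<open>Positive and negative roots\<close>

lemma alt_add: "alt (j + k) s t = (if even k then alt j s t else alt j t s) @ alt k s t"
  by (induction k arbitrary: s t) auto

context coxeter_presented
begin

lemma len_parity: "set us \<subseteq> S \<Longrightarrow> even (len (wprod W us)) = even (length us)"
  using len_word[of "wprod W us"] parity[of _ us] by (metis gens_list_closed wprod_closed)

lemma len_mult_gen_parity:
  assumes "x \<in> carrier W" "s \<in> S"
  shows "even (len (x \<otimes> s)) \<noteq> even (len x)"
proof -
  obtain us where us: "set us \<subseteq> S" "length us = len x" "wprod W us = x"
    using len_word[OF assms(1)] .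
  have "wprod W (us @ [s]) = x \<otimes> s" using us assms by (simp add: wprod_append)
  then have "even (len (x \<otimes> s)) = even (Suc (length us))"
    using len_parity[of "us @ [s]"] us(1) assms(2) by simp
  then show ?thesis using us(2) by simp
qed

lemma len_mult_gen_cases:
  assumes "x \<in> carrier W" "s \<in> S"
  obtains "len (x \<otimes> s) = Suc (len x)" | "len x = Suc (len (x \<otimes> s))"
proof -
  have "len (x \<otimes> s) \<le> len x + 1"
    using len_mult[of x s] len_gen_le[of s] assms by fastforce
  moreover have "x \<otimes> s \<otimes> s = x" using assms by (simp add: m_assoc gens_invol)
  then have "len x \<le> len (x \<otimes> s) + 1"
    using len_mult[of "x \<otimes> s" s] len_gen_le[of s] assms by fastforce
  moreover have "len x \<noteq> len (x \<otimes> s)" using len_mult_gen_parity[OF assms] by metis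
  ultimately show ?thesis using that by linarith
qed

text \<open>Cut the trivial word of length 2n in the middle: its first half is the inverse of the
  other alternating word of length n.\<close>

lemma wprod_alt_braid:
  assumes "s \<in> S" "t \<in> S" "m s t = enat n"
  shows "wprod W (alt n s t) = wprod W (alt n t s)"
proof -
  have closed: "set (alt n a b) \<subseteq> S" if "a \<in> {s, t}" "b \<in> {s, t}" for a b
    using set_alt[of n a b] assms that by auto
  let ?A = "if even n then alt n s t else alt n t s"
  have cA: "set ?A \<subseteq> S" "set (alt n s t) \<subseteq> S" "set (alt n t s) \<subseteq> S" using closed by auto
  have "?A = rev (alt n t s)" by (auto simp: rev_alt)
  then have inv: "wprod W ?A = inv (wprod W (alt n t s))"
    using wprod_rev closed by simp
  have "wprod W (?A @ alt n s t) = \<one>"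
    using wprod_relation[OF assms] unfolding alt_even[symmetric] mult_2 alt_add .
  then have "inv (wprod W (alt n t s)) \<otimes> wprod W (alt n s t) = \<one>"
    using cA by (simp only: wprod_append gens_list_closed inv)
  then show ?thesis using cA by (simp add: inv_solve_left')
qed

text \<open>
  Split off from \<open>x\<close> a maximal reduced alternating tail in \<open>s\<close> and the last letter \<open>t\<close> of a reduced
  word. It maps the simple root of \<open>s\<close> to a nonnegative combination of those of \<open>s\<close> and \<open>t\<close>, and by
  maximality the induction hypothesis applies to both of them and the remaining factor \<open>v\<close>.
\<close>

lemma rho_sroot_nonneg:
  assumes "x \<in> carrier W" "s \<in> S" "len x < len (x \<otimes> s)"
  shows "0 \<le> Poly_Mapping.lookup (rho x (sroot s)) i"
  using assms
proof (induction "len x" arbitrary: x s rule: less_induct)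
  case less
  note x = less.prems(1) and s = less.prems(2)
  show ?case
  proof (cases "len x = 0")
    case True
    then show ?thesis using x by (simp add: len_eq_0 sroot_def lookup_single when_def)
  next
    case False
    obtain ws where ws: "set ws \<subseteq> S" "length ws = len x" "wprod W ws = x"
      using len_word[OF x] .
    then obtain us t where ust: "ws = us @ [t]" using False by (metis length_0_conv rev_exhaust)
    have t: "t \<in> S" and us: "set us \<subseteq> S" using ws ust by auto
    have xt: "x = wprod W us \<otimes> t" using ws ust us t by (simp add: wprod_append)
    have len_us: "len (wprod W us) \<le> length us" using len_le[of us] us by simp
    have xtt: "x \<otimes> t = wprod W us" using xt t us by (simp add: m_assoc gens_invol)
    have "s \<noteq> t" using less.prems(3) xtt len_us ws(2) ust by auto
    define Q where "Q k \<longleftrightarrow> (\<exists>v\<in>carrier W. x = v \<otimes> wprod W (alt k s t) \<and> len x = len v + k)" for k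
    have "len x \<le> len (wprod W us) + 1"
      using len_mult[of "wprod W us" t] len_gen_le[OF t] xt us t by fastforce
    then have Q1: "Q 1"
      unfolding Q_def using xt len_us ws(2) ust us t
      by (intro bexI[of _ "wprod W us"]) auto
    have Qb: "\<forall>k. Q k \<longrightarrow> k \<le> len x" by (auto simp: Q_def)
    define k where "k = (GREATEST k. Q k)"
    have "Q k" unfolding k_def using GreatestI_nat[of Q 1 "len x"] Q1 Qb by blast
    have "1 \<le> k" unfolding k_def using Greatest_le_nat[of Q 1 "len x"] Q1 Qb by blast
    have "\<not> Q (Suc k)" unfolding k_def using Greatest_le_nat[of Q "Suc k" "len x"] Qb k_def 
      by (metis not_less_eq_eq order_refl)
    obtain v where v: "v \<in> carrier W" "x = v \<otimes> wprod W (alt k s t)" "len x = len v + k"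
      using \<open>Q k\<close> by (auto simp: Q_def)
    have alt_S: "set (alt j a b) \<subseteq> S" if "a \<in> {s, t}" "b \<in> {s, t}" for j a b
      using set_alt[of j a b] s t that by auto
    have alt_C: "wprod W (alt j a b) \<in> carrier W" if "a \<in> {s, t}" "b \<in> {s, t}" for j a b
      using alt_S[OF that] by simp
    obtain k' where k': "k = Suc k'" using \<open>1 \<le> k\<close> by (cases k) auto
    have up: "len v < len (v \<otimes> r)" if "r \<in> {s, t}" for r
    proof (rule ccontr)
      assume neg: "\<not> len v < len (v \<otimes> r)"
      have r: "r \<in> S" using that s t by auto
      have dec: "len v = Suc (len (v \<otimes> r))" using len_mult_gen_cases[OF v(1) r] neg by auto
      \<comment> \<open>Either \<open>r\<close> prolongs the alternating tail to the left, against
        the maximality of \<open>k\<close>, or \<open>r\<close> is its first letter, and absorbing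
        it into \<open>v\<close> makes \<open>x\<close> too short.\<close>
      have "r = (if even k then t else s) \<or> r = (if even k' then t else s)"
        using that k' by auto
      then show False
      proof
        assume "r = (if even k then t else s)"
        then have "wprod W (alt (Suc k) s t) = r \<otimes> wprod W (alt k s t)"
          by (simp only: alt_Suc_Cons wprod_Cons)
        then have "x = v \<otimes> r \<otimes> wprod W (alt (Suc k) s t)"
          using v(1,2) r alt_C[of s t k] by (simp add: m_assoc mult_involution_cancel gens_invol)
        then have "Q (Suc k)" unfolding Q_def using v dec r by (intro bexI[of _ "v \<otimes> r"]) auto
        then show False using \<open>\<not> Q (Suc k)\<close> by simp
      next
        assume "r = (if even k' then t else s)"
        then have "wprod W (alt k s t) = r \<otimes> wprod W (alt k' s t)"
          by (simp only: k' alt_Suc_Cons wprod_Cons)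
        then have "x = v \<otimes> r \<otimes> wprod W (alt k' s t)"
          using v(1,2) r alt_C[of s t k'] by (simp add: m_assoc)
        then have "len x \<le> len (v \<otimes> r) + len (wprod W (alt k' s t))"
          using len_mult v(1) r alt_C[of s t k'] by simp
        also have "len (wprod W (alt k' s t)) \<le> k'" 
          using len_le[of "alt k' s t", OF _ HOL.refl] alt_S[of s t k'] by simp
        finally show False using v(3) dec k' by linarith
      qed
    qed
    \<comment> \<open>Otherwise a braid move inside the tail makes \<open>x\<close> end in
      \<open>s\<close>, so that \<open>x \<otimes> s\<close> is shorter than
      \<open>x\<close>.\<close>
    have km: "enat (Suc k) \<le> m s t"
    proof (rule ccontr)
      assume "\<not> enat (Suc k) \<le> m s t"
      then obtain n where n: "m s t = enat n" "n \<le> k" by (cases "m s t") auto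
      have "2 \<le> n" using order_ge_2[OF s t \<open>s \<noteq> t\<close>] n by simp
      then obtain n' where n': "n = Suc n'" by (cases n) auto
      define pre where "pre = (if even n then alt (k - n) s t else alt (k - n) t s)"
      have pre: "set pre \<subseteq> S" "length pre = k - n" unfolding pre_def using alt_S by auto
      have "alt k s t = pre @ alt n s t" 
        using alt_add[of "k - n" n s t] n(2) by (simp add: pre_def)
      then have "wprod W (alt k s t) = wprod W pre \<otimes> wprod W (alt n t s)"
        using wprod_alt_braid[OF s t n(1)] pre alt_S[of s t n] by (simp add: wprod_append)
      also have "\<dots> = wprod W pre \<otimes> (wprod W (alt n' s t) \<otimes> s)"
        using alt_S[of s t n'] s by (simp add: n' wprod_append)
      finally have xs: "x \<otimes> s = v \<otimes> wprod W (pre @ alt n' s t)"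
        using v(1,2) s pre alt_S[of s t n'] by (simp add: m_assoc wprod_append gens_invol)
      have "len (wprod W (pre @ alt n' s t)) \<le> (k - n) + n'"
        using len_le[of "pre @ alt n' s t", OF _ HOL.refl] pre alt_S[of s t n'] by simp
      moreover have "wprod W (pre @ alt n' s t) \<in> carrier W"
        using pre alt_S[of s t n'] by simp
      then have "len (x \<otimes> s) \<le> len v + len (wprod W (pre @ alt n' s t))"
        unfolding xs by (rule len_mult[OF v(1)])
      ultimately have "len (x \<otimes> s) \<le> len v + ((k - n) + n')" by linarith
      then show False using less.prems(3) v(3) n n' by simp
    qed
    then have km': "enat k \<le> m s t" by (meson Suc_ile_eq order_less_imp_le)
    define p where "p = cheb (- tits_entry m s t)"
    have p: "0 \<le> p k" "0 \<le> p (Suc k)"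
      using cheb_entry_nonneg[OF s t \<open>s \<noteq> t\<close>] km km' by (auto simp: p_def)
    obtain a b where ab: "0 \<le> a" "0 \<le> b"
      "act (alt k s t) (sroot s) = a *\<^sub>R sroot s + b *\<^sub>R sroot t"
      using act_alt_sroot[OF s t, of k] p unfolding p_def by metis
    have "rho x (sroot s) = rho v (rho (wprod W (alt k s t)) (sroot s))"
      using v(1,2) alt_C[of s t k] by (simp add: rho_mult)
    also have "\<dots> = a *\<^sub>R rho v (sroot s) + b *\<^sub>R rho v (sroot t)"
      using alt_S[of s t k] v(1) by (simp add: rho_wprod ab(3) rho_simps)
    finally have "Poly_Mapping.lookup (rho x (sroot s)) i =
        a * Poly_Mapping.lookup (rho v (sroot s)) i + b * Poly_Mapping.lookup (rho v (sroot t)) i"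
      by (simp add: lookup_add)
    moreover have "len v < len x" using v(3) \<open>1 \<le> k\<close> by simp
    then have "0 \<le> Poly_Mapping.lookup (rho v (sroot s)) i"
      "0 \<le> Poly_Mapping.lookup (rho v (sroot t)) i"
      using less.hyps[of v s] less.hyps[of v t] v(1) s t up[of s] up[of t] by blast+
    ultimately show ?thesis using ab by simp
  qed
qed

section \<open>Roots, their signs and their reflections\<close>

definition pos :: "('a \<times> bool \<Rightarrow>\<^sub>0 real) \<Rightarrow> bool" where
  "pos v \<longleftrightarrow> v \<noteq> 0 \<and> (\<forall>i. 0 \<le> Poly_Mapping.lookup v i)"

lemma pos_uminus: "pos v \<Longrightarrow> \<not> pos (- v)"
  by (auto simp: pos_def intro!: poly_mapping_eqI antisym)

lemma pos_scaleR: "\<lbrakk>pos v; 0 < r\<rbrakk> \<Longrightarrow> pos (r *\<^sub>R v)"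
  by (simp add: pos_def)

lemma pos_add: "\<lbrakk>pos v; pos w\<rbrakk> \<Longrightarrow> pos (v + w)"
proof -
  assume v: "pos v" and w: "pos w"
  have "v + w \<noteq> 0"
  proof
    assume "v + w = 0"
    then have "- v = w" by (rule minus_unique)
    then show False using v w pos_uminus by metis
  qed
  then show ?thesis using v w by (simp add: pos_def lookup_add)
qed

text \<open>A relation rather than a function of \<open>t\<close>, because each reflection has two
  opposite roots.\<close>

definition is_root :: "'a \<Rightarrow> ('a \<times> bool \<Rightarrow>\<^sub>0 real) \<Rightarrow> bool" where
  "is_root t \<beta> \<longleftrightarrow> (\<exists>x\<in>carrier W. \<exists>s\<in>S. t = x \<otimes> s \<otimes> inv x \<and> \<beta> = rho x (sroot s))"

lemma is_root_closed: "is_root t \<beta> \<Longrightarrow> t \<in> carrier W"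
  by (auto simp: is_root_def)

lemma is_root_gen: "s \<in> S \<Longrightarrow> is_root s (sroot s)"
  unfolding is_root_def by (intro bexI[of _ \<one>] bexI[of _ s]) auto

lemma is_root_conj:
  assumes "is_root t \<beta>" "y \<in> carrier W"
  shows "is_root (y \<otimes> t \<otimes> inv y) (rho y \<beta>)"
proof -
  obtain x s where "x \<in> carrier W" "s \<in> S" "t = x \<otimes> s \<otimes> inv x" "\<beta> = rho x (sroot s)"
    using assms(1) by (auto simp: is_root_def)
  then show ?thesis
    unfolding is_root_def using assms(2)
    by (intro bexI[of _ "y \<otimes> x"] bexI[of _ s]) (simp_all add: m_assoc inv_mult_group rho_mult)
qed

lemma is_root_uminus:
  assumes "is_root t \<beta>"
  shows "is_root t (- \<beta>)"
proof -
  obtain x s where xs: "x \<in> carrier W" "s \<in> S" "t = x \<otimes> s \<otimes> inv x" "\<beta> = rho x (sroot s)"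
    using assms by (auto simp: is_root_def)
  have "rho (x \<otimes> s) (sroot s) = - \<beta>"
    using xs by (simp add: rho_mult rho_gen srefl_sroot rho_simps)
  moreover have "x \<otimes> s \<otimes> s \<otimes> inv (x \<otimes> s) = t"
    using xs by (simp add: m_assoc inv_mult_group inv_gen gens_invol mult_involution_cancel)
  ultimately show ?thesis
    unfolding is_root_def using xs by (intro bexI[of _ "x \<otimes> s"] bexI[of _ s]) auto
qed

lemma root_norm: "is_root t \<beta> \<Longrightarrow> B \<beta> \<beta> = 2"
  by (auto simp: is_root_def rho_simps B_sroot_self)

lemma root_nonzero: "is_root t \<beta> \<Longrightarrow> \<beta> \<noteq> 0"
  using root_norm by fastforce

lemma rho_root:
  assumes "is_root t \<beta>"
  shows "rho t v = v - B v \<beta> *\<^sub>R \<beta>"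
proof -
  obtain x s where xs: "x \<in> carrier W" "s \<in> S" "t = x \<otimes> s \<otimes> inv x" "\<beta> = rho x (sroot s)"
    using assms by (auto simp: is_root_def)
  have "B (rho (inv x) v) (sroot s) = B v \<beta>"
    using rho_simps(5)[of x "rho (inv x) v" "sroot s"] xs by simp
  then show ?thesis
    using xs by (simp add: rho_mult rho_gen srefl_def rho_simps)
qed

lemma root_pos_or_neg:
  assumes "is_root t \<beta>"
  shows "pos \<beta> \<or> pos (- \<beta>)"
proof -
  obtain x s where xs: "x \<in> carrier W" "s \<in> S" "\<beta> = rho x (sroot s)"
    using assms by (auto simp: is_root_def)
  have nz: "\<beta> \<noteq> 0" using assms by (rule root_nonzero)
  from xs(1,2) show ?thesis
  proof (cases rule: len_mult_gen_cases)
    case 1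
    then show ?thesis using rho_sroot_nonneg[OF xs(1,2)] nz xs(3) by (simp add: pos_def)
  next
    case 2
    have "x \<otimes> s \<otimes> s = x" using xs by (simp add: m_assoc gens_invol)
    then have "0 \<le> Poly_Mapping.lookup (rho (x \<otimes> s) (sroot s)) i" for i
      using rho_sroot_nonneg[of "x \<otimes> s" s] xs 2 by simp
    moreover have "rho (x \<otimes> s) (sroot s) = - \<beta>"
      using xs by (simp add: rho_mult rho_gen srefl_sroot rho_simps)
    ultimately show ?thesis using nz by (simp add: pos_def)
  qed
qed

text \<open>The last letter of a reduced word for \<open>x\<close> gives a simple root that
  \<open>x\<close> sends to a negative vector, so \<open>x\<close> does not act trivially.\<close>

lemma rho_faithful:
  assumes "x \<in> carrier W" "\<And>v. rho x v = v"
  shows "x = \<one>"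
proof (rule ccontr)
  assume "x \<noteq> \<one>"
  obtain ws where ws: "set ws \<subseteq> S" "length ws = len x" "wprod W ws = x"
    using len_word[OF assms(1)] .
  then obtain us s where us: "ws = us @ [s]" 
    using \<open>x \<noteq> \<one>\<close> by (metis rev_exhaust wprod_Nil)
  have s: "s \<in> S" "set us \<subseteq> S" using ws us by auto
  have x: "x = wprod W us \<otimes> s" using ws us s by (simp add: wprod_append)
  have "len (wprod W us) < len x" using len_le[OF s(2) HOL.refl] ws(2) us by simp
  then have "0 \<le> Poly_Mapping.lookup (rho (wprod W us) (sroot s)) (s, False)"
    using rho_sroot_nonneg[of "wprod W us" s] s x by simp
  moreover have "rho (wprod W us) (sroot s) = - rho x (sroot s)"
    using s by (simp add: x rho_mult rho_gen srefl_sroot rho_simps)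
  ultimately show False using assms(2) by (simp add: sroot_def)
qed

lemma rho_inj:
  assumes "x \<in> carrier W" "y \<in> carrier W" "\<And>v. rho x v = rho y v"
  shows "x = y"
proof -
  have "inv y \<otimes> x = \<one>" using assms by (intro rho_faithful) (simp_all add: rho_mult)
  then show ?thesis using assms by (simp add: inv_solve_left')
qed

text \<open>All roots have the same value of the form, so proportional roots agree up to sign.
  Opposite roots define the same linear map, and the representation is faithful.\<close>

lemma scaled_root:
  assumes "is_root t \<beta>" "is_root t' (c *\<^sub>R \<beta>)"
  shows "c = 1 \<or> c = -1" "t = t'"
proof -
  have "c * c = 1" using root_norm[OF assms(1)] root_norm[OF assms(2)] by (simp add: B_simps)
  then show "c = 1 \<or> c = -1" by (simp add: square_eq_1_iff)
  show "t = t'"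
    by (rule rho_inj)
       (use assms \<open>c * c = 1\<close> in \<open>auto simp: is_root_closed rho_root B_simps ac_simps\<close>)
qed

lemma root_unique:
  assumes "is_root t \<beta>" "is_root t \<gamma>"
  shows "\<gamma> = \<beta> \<or> \<gamma> = - \<beta>"
proof -
  have "\<beta> - B \<beta> \<gamma> *\<^sub>R \<gamma> = - \<beta>"
    using rho_root[OF assms(1), of \<beta>] rho_root[OF assms(2), of \<beta>] root_norm[OF assms(1)]
    by (simp add: scaleR_2)
  then have "2 *\<^sub>R \<beta> = B \<beta> \<gamma> *\<^sub>R \<gamma>" by (simp add: scaleR_2 algebra_simps)
  then have "(1/2) *\<^sub>R (2 *\<^sub>R \<beta>) = (1/2) *\<^sub>R (B \<beta> \<gamma> *\<^sub>R \<gamma>)" by simp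
  then have "\<beta> = (B \<beta> \<gamma> / 2) *\<^sub>R \<gamma>" by simp
  then show ?thesis using scaled_root(1)[of t \<gamma> t "B \<beta> \<gamma> / 2"] assms 
    by (metis scaleR_minus1_left scaleR_one minus_minus)
qed

text \<open>\<open>\<beta>\<close> has a positive coordinate away from \<open>s\<close>, which
  \<open>srefl s\<close> leaves unchanged. Since every root is positive or negative, one such
  coordinate decides the sign.\<close>

lemma srefl_pos:
  assumes "is_root t \<beta>" "pos \<beta>" "s \<in> S" "t \<noteq> s"
  shows "pos (srefl s \<beta>)"
proof -
  have "\<exists>i. i \<noteq> (s, False) \<and> Poly_Mapping.lookup \<beta> i \<noteq> 0"
  proof (rule ccontr)
    assume "\<not> ?thesis"
    then have "\<beta> = Poly_Mapping.lookup \<beta> (s, False) *\<^sub>R sroot s"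
      by (intro poly_mapping_eqI) (auto simp: sroot_def lookup_single when_def)
    then show False using scaled_root(2)[OF is_root_gen[OF assms(3)]] assms(1,4) by metis
  qed
  then obtain i where i: "i \<noteq> (s, False)" "Poly_Mapping.lookup \<beta> i > 0"
    using assms(2) by (metis less_eq_real_def pos_def)
  then have "Poly_Mapping.lookup (srefl s \<beta>) i > 0"
    by (simp add: srefl_def sroot_def lookup_minus lookup_single when_def)
  then have "\<not> pos (- srefl s \<beta>)" unfolding pos_def by (metis lookup_uminus neg_0_le_iff_le not_le)
  moreover have "is_root (s \<otimes> t \<otimes> inv s) (srefl s \<beta>)"
    using is_root_conj[OF assms(1), of s] assms(3) by (simp add: rho_gen)
  ultimately show ?thesis using root_pos_or_neg by blast
qed

end

section \<open>Linear algebra in a plane\<close>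

definition span2 :: "'v \<Rightarrow> 'v \<Rightarrow> 'v::real_vector set" where
  "span2 v w = {a *\<^sub>R v + b *\<^sub>R w | a b. True}"

lemma span2_combination:
  assumes "x \<in> span2 v w" "y \<in> span2 v w"
  shows "a *\<^sub>R x + b *\<^sub>R y \<in> span2 v w"
proof -
  obtain p q r s where "x = p *\<^sub>R v + q *\<^sub>R w" "y = r *\<^sub>R v + s *\<^sub>R w"
    using assms by (auto simp: span2_def)
  then have "a *\<^sub>R x + b *\<^sub>R y = (a * p + b * r) *\<^sub>R v + (a * q + b * s) *\<^sub>R w"
    by (simp add: algebra_simps)
  then show ?thesis unfolding span2_def by blast
qed

lemma span2_scaleR: "x \<in> span2 v w \<Longrightarrow> c *\<^sub>R x \<in> span2 v w"
  using span2_combination[of x v w x c 0] by simp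

lemma span2_left: "v \<in> span2 v w" and span2_right: "w \<in> span2 v w"
  unfolding span2_def
  by (rule CollectI, rule exI[of _ 1], rule exI[of _ 0], simp)
     (rule CollectI, rule exI[of _ 0], rule exI[of _ 1], simp)

lemma span2_subset: "\<lbrakk>x \<in> span2 v w; y \<in> span2 v w\<rbrakk> \<Longrightarrow> span2 x y \<subseteq> span2 v w"
  using span2_combination by (auto simp: span2_def[of x y])

text \<open>The coefficients are the three 2 x 2 minors of the coordinates, each nonzero because the
  two vectors concerned are not proportional.\<close>

lemma span2_dependent:
  assumes "x \<in> span2 v w" "y \<in> span2 v w" "z \<in> span2 v w"
    and "\<And>c. x \<noteq> c *\<^sub>R y" "\<And>c. y \<noteq> c *\<^sub>R z" "\<And>c. z \<noteq> c *\<^sub>R x"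
  obtains a b c where "a \<noteq> 0" "b \<noteq> 0" "c \<noteq> 0" "a *\<^sub>R x + b *\<^sub>R y + c *\<^sub>R z = 0"
proof -
  have det: "p * s - q * r \<noteq> 0"
    if "x = p *\<^sub>R v + q *\<^sub>R w" "y = r *\<^sub>R v + s *\<^sub>R w" "\<And>c. x \<noteq> c *\<^sub>R y" "y \<noteq> 0"
    for x y p q r s
  proof
    assume "p * s - q * r = 0"
    then have pq: "p * s = q * r" by simp
    then have 1: "r *\<^sub>R x = p *\<^sub>R y" "s *\<^sub>R x = q *\<^sub>R y"
      by (simp_all add: that(1,2) algebra_simps)
    have "r \<noteq> 0 \<or> s \<noteq> 0" using that(2,4) by auto
    then have "x = (p / r) *\<^sub>R y \<or> x = (q / s) *\<^sub>R y"
    proof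
      assume "r \<noteq> 0"
      then have "x = (1 / r) *\<^sub>R (r *\<^sub>R x)" by simp
      then show ?thesis using 1(1) by simp
    next
      assume "s \<noteq> 0"
      then have "x = (1 / s) *\<^sub>R (s *\<^sub>R x)" by simp
      then show ?thesis using 1(2) by simp
    qed
    then show False using that(3) by blast
  qed
  obtain x1 x2 y1 y2 z1 z2 where xyz: "x = x1 *\<^sub>R v + x2 *\<^sub>R w" "y = y1 *\<^sub>R v + y2 *\<^sub>R w"
    "z = z1 *\<^sub>R v + z2 *\<^sub>R w"
    using assms(1-3) by (auto simp: span2_def)
  have nz: "x \<noteq> 0" "y \<noteq> 0" "z \<noteq> 0" using assms(4-6)[of 0] by auto
  show ?thesis
  proof (rule that)
    show "y1 * z2 - y2 * z1 \<noteq> 0" by (rule det[OF xyz(2,3) assms(5) nz(3)])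
    show "z1 * x2 - z2 * x1 \<noteq> 0" by (rule det[OF xyz(3,1) assms(6) nz(1)])
    show "x1 * y2 - x2 * y1 \<noteq> 0" by (rule det[OF xyz(1,2) assms(4) nz(2)])
    show "(y1 * z2 - y2 * z1) *\<^sub>R x + (z1 * x2 - z2 * x1) *\<^sub>R y + (x1 * y2 - x2 * y1) *\<^sub>R z = 0"
      unfolding xyz by (simp add: algebra_simps)
  qed
qed

text \<open>\<open>p\<close> and \<open>q\<close> may coincide and need only lie in
  \<open>B\<close>, which covers sets \<open>A\<close> with fewer than two elements.\<close>

lemma subset_pair:
  assumes "\<And>x y z. \<lbrakk>x \<in> A; y \<in> A; z \<in> A; x \<noteq> y; y \<noteq> z; z \<noteq> x\<rbrakk> \<Longrightarrow> False"
    and "A \<subseteq> B" "B \<noteq> {}"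
  obtains p q where "p \<in> B" "q \<in> B" "A \<subseteq> {p, q}"
proof (cases "\<exists>p q. p \<in> A \<and> q \<in> A \<and> p \<noteq> q")
  case True
  then obtain p q where "p \<in> A" "q \<in> A" "p \<noteq> q" by blast
  then have "A \<subseteq> {p, q}" using assms(1) by blast
  then show ?thesis using that \<open>p \<in> A\<close> \<open>q \<in> A\<close> assms(2) by blast
next
  case False
  show ?thesis
  proof (cases "A = {}")
    case True
    then show ?thesis using that assms(3) by blast
  next
    case nonempty: False
    then obtain p where "p \<in> A" by blast
    then have "A \<subseteq> {p, p}" using False by blast
    then show ?thesis using that \<open>p \<in> A\<close> assms(2) by blast
  qed
qed

section \<open>Reflections as a generating set\<close>

context coxeter_presented
begin

abbreviation T where "T \<equiv> reflections W S"

lemma reflectionE: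
  assumes "t \<in> T"
  obtains x s where "x \<in> carrier W" "s \<in> S" "t = x \<otimes> s \<otimes> inv x"
  using assms unfolding reflections_def by blast

lemma reflection_conj: "\<lbrakk>y \<in> carrier W; t \<in> T\<rbrakk> \<Longrightarrow> y \<otimes> t \<otimes> inv y \<in> T"
proof -
  assume y: "y \<in> carrier W" and "t \<in> T"
  then obtain x s where "x \<in> carrier W" "s \<in> S" "t = x \<otimes> s \<otimes> inv x"
    by (blast elim: reflectionE)
  then have "y \<otimes> t \<otimes> inv y = (y \<otimes> x) \<otimes> s \<otimes> inv (y \<otimes> x)"
    using y by (simp add: m_assoc inv_mult_group)
  then show ?thesis
    unfolding reflections_def using y \<open>x \<in> carrier W\<close> \<open>s \<in> S\<close> by blast
qed

lemma gen_reflection: "s \<in> S \<Longrightarrow> s \<in> T"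
  unfolding reflections_def by (rule CollectI, rule exI[of _ \<one>], rule exI[of _ s]) simp

end

sublocale coxeter_presented \<subseteq> refl: involution_generated W "reflections W S"
proof
  show "T \<subseteq> carrier W" by (auto simp: reflections_def)
  show "t \<otimes> t = \<one>" if "t \<in> T" for t
    using that by (auto simp: reflections_def m_assoc mult_involution_cancel gens_invol)
  show "\<exists>ts. set ts \<subseteq> T \<and> wprod W ts = g" if "g \<in> carrier W" for g
    using gens_generate[OF that] gen_reflection by blast
qed

context coxeter_presented
begin

lemma is_root_reflection: "is_root t \<beta> \<Longrightarrow> t \<in> T"
  unfolding is_root_def reflections_def by blast

definition pos_root :: "'a \<Rightarrow> ('a \<times> bool \<Rightarrow>\<^sub>0 real)" where
  "pos_root t = (SOME \<beta>. is_root t \<beta> \<and> pos \<beta>)"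

lemma pos_root:
  assumes "t \<in> T"
  shows "is_root t (pos_root t)" "pos (pos_root t)"
proof -
  obtain x s where "x \<in> carrier W" "s \<in> S" "t = x \<otimes> s \<otimes> inv x"
    using assms by (blast elim: reflectionE)
  then have "is_root t (rho x (sroot s))" unfolding is_root_def by blast
  then have "\<exists>\<beta>. is_root t \<beta> \<and> pos \<beta>"
    using root_pos_or_neg is_root_uminus by blast
  then have "is_root t (pos_root t) \<and> pos (pos_root t)"
    unfolding pos_root_def by (rule someI_ex)
  then show "is_root t (pos_root t)" "pos (pos_root t)" by auto
qed

lemma pos_root_eq:
  assumes "is_root t \<beta>" "pos \<beta>"
  shows "pos_root t = \<beta>"
  using root_unique[OF assms(1) pos_root(1)] pos_root(2) pos_uminus assms is_root_reflection
  by metis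

lemma pos_root_conj:
  assumes "t \<in> T" "x \<in> carrier W"
  obtains "pos_root (x \<otimes> t \<otimes> inv x) = rho x (pos_root t)"
  | "pos_root (x \<otimes> t \<otimes> inv x) = - rho x (pos_root t)"
proof -
  have "is_root (x \<otimes> t \<otimes> inv x) (rho x (pos_root t))"
    using is_root_conj[OF pos_root(1)] assms by blast
  then show ?thesis using root_pos_or_neg pos_root_eq is_root_uminus that by metis
qed

lemma pos_root_scaled:
  assumes "t \<in> T" "t' \<in> T" "pos_root t = c *\<^sub>R pos_root t'"
  shows "t = t'"
  using scaled_root(2)[OF pos_root(1)[OF assms(2)], of t c] pos_root(1)[OF assms(1)] assms(3)
  by metis

lemma len_parity_mult:
  assumes "x \<in> carrier W" "y \<in> carrier W"
  shows "even (len (x \<otimes> y)) \<longleftrightarrow> even (len x) = even (len y)"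
proof -
  obtain us where us: "set us \<subseteq> S" "wprod W us = x" using len_word[OF assms(1)] .
  obtain vs where vs: "set vs \<subseteq> S" "wprod W vs = y" using len_word[OF assms(2)] .
  have "wprod W (us @ vs) = x \<otimes> y" using us vs by (simp add: wprod_append)
  then show ?thesis
    using len_parity[of "us @ vs"] len_parity[of us] len_parity[of vs] us vs by simp
qed

lemma reflection_odd: "t \<in> T \<Longrightarrow> odd (len t)"
proof -
  assume "t \<in> T"
  then obtain x s where x: "x \<in> carrier W" "s \<in> S" "t = x \<otimes> s \<otimes> inv x"
    by (blast elim: reflectionE)
  have "odd (len s)" using len_parity[of "[s]"] x(2) by simp
  then show ?thesis using x by (auto simp: len_parity_mult len_inv)
qed

lemma reflection_word_parity: "set ts \<subseteq> T \<Longrightarrow> even (len (wprod W ts)) = even (length ts)"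
  by (induction ts) (auto simp: len_parity_mult reflection_odd)

section \<open>Dihedral reflection subgroups\<close>

text \<open>Such a \<open>C\<close> plays the role of the set of all reflections in a reflection
  subgroup.\<close>

definition conj_closed :: "'a set \<Rightarrow> bool" where
  "conj_closed C \<longleftrightarrow> C \<subseteq> T \<and> (\<forall>t\<in>C. \<forall>r\<in>C. t \<otimes> r \<otimes> inv t \<in> C)"

text \<open>Dyer's canonical generators of the reflection subgroup generated by \<open>C\<close>.\<close>

definition canonical :: "'a set \<Rightarrow> 'a set" where
  "canonical C = {t \<in> C. \<forall>r\<in>C. r \<noteq> t \<longrightarrow> pos (rho t (pos_root r))}"

lemma gen_canonical:
  assumes "conj_closed C" "s \<in> S" "s \<in> C"
  shows "s \<in> canonical C"
proof -
  have "pos (rho s (pos_root r))" if "r \<in> C" "r \<noteq> s" for r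
  proof -
    have "r \<in> T" using that(1) assms(1) by (auto simp: conj_closed_def)
    then show ?thesis
      using srefl_pos[OF pos_root assms(2) that(2)] assms(2) by (simp add: rho_gen)
  qed
  then show ?thesis using assms(3) by (simp add: canonical_def)
qed

text \<open>A simple reflection changes the sign of no positive root but its own. As
  \<open>r\<close> is not in \<open>C\<close>, conjugation by \<open>r\<close> preserves the signs
  of all roots of reflections in \<open>C\<close>, hence also the condition defining canonical
  generators.\<close>

lemma canonical_conj_gen:
  assumes C: "conj_closed C" and r: "r \<in> S" "r \<notin> C"
    and q: "q \<in> canonical ((\<lambda>c. r \<otimes> c \<otimes> inv r) ` C)"
  shows "r \<otimes> q \<otimes> inv r \<in> canonical C"
proof -
  let ?c = "\<lambda>c. r \<otimes> c \<otimes> inv r"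
  have CT: "c \<in> T" if "c \<in> C" for c using C that by (auto simp: conj_closed_def)
  have cc: "?c (?c c) = c" if "c \<in> carrier W" for c
    using that r by (simp add: inv_gen m_assoc gens_invol mult_involution_cancel)
  obtain q0 where q0: "q0 \<in> C" "q = ?c q0" using q by (auto simp: canonical_def)
  have rq: "?c q = q0" using cc q0 CT by simp
  have carr: "q \<in> carrier W" "q0 \<in> carrier W" using q0 CT r by auto
  have "pos (rho q0 (pos_root p))" if p: "p \<in> C" "p \<noteq> q0" for p
  proof -
    have pT: "p \<in> T" using CT p by simp
    have "?c p \<noteq> q" using cc[of p] pT p(2) rq by auto
    then have 1: "pos (rho q (pos_root (?c p)))" using q p(1) by (auto simp: canonical_def)
    have "p \<noteq> r" using p r by auto
    then have "pos (rho r (pos_root p))"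
      using srefl_pos[OF pos_root[OF pT] r(1)] r(1) by (simp add: rho_gen)
    then have "pos_root (?c p) = rho r (pos_root p)"
      using pos_root_eq is_root_conj[OF pos_root(1)[OF pT], of r] r(1) by simp
    then have "pos (rho (q \<otimes> r) (pos_root p))" using 1 carr r(1) by (simp add: rho_mult)
    moreover have "q \<otimes> r = r \<otimes> q0" using q0(2) carr r(1) by (simp add: m_assoc)
    ultimately have 2: "pos (rho r (rho q0 (pos_root p)))" using carr r(1) by (simp add: rho_mult)
    let ?g = "rho q0 (pos_root p)"
    have g: "is_root (q0 \<otimes> p \<otimes> inv q0) ?g"
      using is_root_conj[OF pos_root(1)[OF pT]] carr by simp
    have "q0 \<otimes> p \<otimes> inv q0 \<noteq> r" using C q0(1) p(1) r(2) unfolding conj_closed_def by metis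
    then have "\<not> pos (- ?g)"
      using srefl_pos[OF is_root_uminus[OF g] _ r(1)] 2 pos_uminus r(1)
      by (auto simp: rho_gen srefl_simps)
    then show ?thesis using root_pos_or_neg[OF g] by blast
  qed
  then show ?thesis unfolding rq using q0(1) by (auto simp: canonical_def)
qed

text \<open>Induction on the conjugating word. If its first letter \<open>r\<close> lies in
  \<open>C\<close>, then \<open>r\<close> is itself canonical and the shorter conjugate is again in
  \<open>C\<close>. If not, \<open>C\<close> is replaced by its conjugate under \<open>r\<close>,
  which is why \<open>C\<close> varies in the induction.\<close>

lemma canonical_generate_word:
  assumes "set us \<subseteq> S" "s \<in> S" "conj_closed C" "wprod W us \<otimes> s \<otimes> inv (wprod W us) \<in> C"
  shows "\<exists>ts. set ts \<subseteq> canonical C \<and> wprod W ts = wprod W us \<otimes> s \<otimes> inv (wprod W us)"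
  using assms
proof (induction us arbitrary: C)
  case Nil
  then have "s \<in> canonical C" using gen_canonical by simp
  then show ?case using \<open>s \<in> S\<close> by (intro exI[of _ "[s]"]) simp
next
  case (Cons r us)
  let ?c = "\<lambda>c. r \<otimes> c \<otimes> inv r"
  have r: "r \<in> S" and us: "set us \<subseteq> S" using Cons.prems by auto
  define t' where "t' = wprod W us \<otimes> s \<otimes> inv (wprod W us)"
  define t where "t = wprod W (r # us) \<otimes> s \<otimes> inv (wprod W (r # us))"
  have carr: "t' \<in> carrier W" using us Cons.prems(2) by (simp add: t'_def)
  have t: "t = ?c t'" using r us Cons.prems(2) by (simp add: t_def t'_def m_assoc inv_mult_group)
  have cc: "?c (?c c) = c" if "c \<in> carrier W" for c
    using that r by (simp add: inv_gen m_assoc gens_invol mult_involution_cancel)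
  have tC: "t \<in> C" using Cons.prems(4) by (simp add: t_def)
  have C: "conj_closed C" by fact
  show ?case
  proof (cases "r \<in> C")
    case True
    have "?c t \<in> C" using C True tC by (simp add: conj_closed_def)
    then have "t' \<in> C" using cc[OF carr] t by simp
    then obtain ts where ts: "set ts \<subseteq> canonical C" "wprod W ts = t'"
      using Cons.IH[OF us Cons.prems(2) C] unfolding t'_def by blast
    have "set ts \<subseteq> carrier W" using ts(1) C by (auto simp: canonical_def conj_closed_def)
    then have "wprod W (r # ts @ [r]) = t"
      using ts(2) r carr by (simp add: wprod_append t inv_gen m_assoc)
    moreover have "set (r # ts @ [r]) \<subseteq> canonical C" using gen_canonical[OF C r True] ts(1) by simp
    ultimately show ?thesis unfolding t_def by blast
  next
    case False
    let ?C = "?c ` C"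
    have CT: "C \<subseteq> T" using C by (simp add: conj_closed_def)
    have "conj_closed ?C"
      unfolding conj_closed_def
    proof (intro conjI ballI)
      show "?C \<subseteq> T" using CT reflection_conj r by auto
      fix a b assume "a \<in> ?C" "b \<in> ?C"
      then obtain a0 b0 where ab: "a0 \<in> C" "b0 \<in> C" "a = ?c a0" "b = ?c b0" by auto
      have "a0 \<in> carrier W" "b0 \<in> carrier W" using ab CT by auto
      then have "a \<otimes> b \<otimes> inv a = ?c (a0 \<otimes> b0 \<otimes> inv a0)"
        using r by (simp add: ab m_assoc inv_mult_group)
      then show "a \<otimes> b \<otimes> inv a \<in> ?C" using C ab by (auto simp: conj_closed_def)
    qed
    moreover have "t' \<in> ?C" using tC t cc[OF carr] by (metis imageI)
    ultimately obtain ts where ts: "set ts \<subseteq> canonical ?C" "wprod W ts = t'"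
      using Cons.IH[OF us Cons.prems(2), of ?C] unfolding t'_def by blast
    have "set (map ?c ts) \<subseteq> canonical C" using canonical_conj_gen[OF C r False] ts(1) by auto
    moreover have "?C \<subseteq> carrier W" using CT r by auto
    then have "set ts \<subseteq> carrier W"
      using ts(1) unfolding canonical_def by blast
    then have "wprod W (map ?c ts) = t" using wprod_conj[of r ts] ts(2) r t by simp
    ultimately show ?thesis unfolding t_def by blast
  qed
qed

lemma canonical_generate:
  assumes "conj_closed C" "t \<in> C"
  obtains ts where "set ts \<subseteq> canonical C" "wprod W ts = t"
proof -
  obtain x s where x: "x \<in> carrier W" "s \<in> S" "t = x \<otimes> s \<otimes> inv x"
    using assms unfolding conj_closed_def by (blast elim: reflectionE)
  obtain us where "set us \<subseteq> S" "wprod W us = x" using gens_generate[OF x(1)] by blast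
  then show ?thesis using canonical_generate_word[of us s C] x assms that by blast
qed

definition plane_reflections where
  "plane_reflections v w = {t \<in> T. pos_root t \<in> span2 v w}"

lemma plane_conj_closed: "conj_closed (plane_reflections v w)"
  unfolding conj_closed_def
proof (intro conjI ballI)
  show "plane_reflections v w \<subseteq> T" by (auto simp: plane_reflections_def)
  fix t r assume "t \<in> plane_reflections v w" "r \<in> plane_reflections v w"
  then have t: "t \<in> T" "pos_root t \<in> span2 v w" and r: "r \<in> T" "pos_root r \<in> span2 v w"
    by (auto simp: plane_reflections_def)
  have "rho t (pos_root r) = 1 *\<^sub>R pos_root r + (- B (pos_root r) (pos_root t)) *\<^sub>R pos_root t"
    using rho_root[OF pos_root(1)[OF t(1)]] by simp
  then have *: "rho t (pos_root r) \<in> span2 v w" using span2_combination t(2) r(2) by metis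
  then have "- rho t (pos_root r) \<in> span2 v w"
    using span2_scaleR[of "rho t (pos_root r)" v w "-1"] by simp
  then have "pos_root (t \<otimes> r \<otimes> inv t) \<in> span2 v w"
    using * pos_root_conj[OF r(1) refl.gen_closed[OF t(1)]] by metis
  moreover have "t \<otimes> r \<otimes> inv t \<in> T" using reflection_conj t(1) r(1) by simp
  ultimately show "t \<otimes> r \<otimes> inv t \<in> plane_reflections v w" by (simp add: plane_reflections_def)
qed

text \<open>
  A canonical generator keeps the positive roots of the other two positive, but not its own, so
  its root is not a positive combination of theirs.
\<close>

lemma canonical_no_positive_relation:
  assumes "conj_closed C" "r1 \<in> canonical C" "r2 \<in> canonical C" "r3 \<in> canonical C"
    and "r1 \<noteq> r3" "r2 \<noteq> r3" "0 < a" "0 < b"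
  shows "a *\<^sub>R pos_root r1 + b *\<^sub>R pos_root r2 \<noteq> c *\<^sub>R pos_root r3"
proof
  assume eq: "a *\<^sub>R pos_root r1 + b *\<^sub>R pos_root r2 = c *\<^sub>R pos_root r3"
  have T: "r1 \<in> T" "r2 \<in> T" "r3 \<in> T" using assms by (auto simp: canonical_def conj_closed_def)
  note p = pos_root[OF T(1)] pos_root[OF T(2)] pos_root[OF T(3)]
  have 1: "pos (c *\<^sub>R pos_root r3)"
    unfolding eq[symmetric] using p assms by (intro pos_add pos_scaleR)
  have "pos (a *\<^sub>R rho r3 (pos_root r1) + b *\<^sub>R rho r3 (pos_root r2))"
    using assms by (intro pos_add pos_scaleR) (auto simp: canonical_def)
  also have "a *\<^sub>R rho r3 (pos_root r1) + b *\<^sub>R rho r3 (pos_root r2) = rho r3 (c *\<^sub>R pos_root r3)"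
    using T by (simp add: rho_simps flip: eq)
  also have "\<dots> = - (c *\<^sub>R pos_root r3)"
    using T rho_root[OF p(5), of "pos_root r3"] root_norm[OF p(5)] by (simp add: rho_simps scaleR_2)
  finally show False using 1 pos_uminus by blast
qed

text \<open>Three pairwise nonproportional vectors in a plane satisfy a linear relation with nonzero
  coefficients. Two of these have the same sign, and moving the third term to the other side
  contradicts the preceding lemma.\<close>

lemma canonical_plane_no_three:
  assumes "r1 \<in> canonical (plane_reflections v w)" "r2 \<in> canonical (plane_reflections v w)"
    "r3 \<in> canonical (plane_reflections v w)" "r1 \<noteq> r2" "r2 \<noteq> r3" "r3 \<noteq> r1"
  shows False
proof -
  have T: "r1 \<in> T" "r2 \<in> T" "r3 \<in> T"
    and sp: "pos_root r1 \<in> span2 v w" "pos_root r2 \<in> span2 v w" "pos_root r3 \<in> span2 v w"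
    using assms by (auto simp: canonical_def plane_reflections_def)
  obtain a b c where abc: "a \<noteq> 0" "b \<noteq> 0" "c \<noteq> 0"
    "a *\<^sub>R pos_root r1 + b *\<^sub>R pos_root r2 + c *\<^sub>R pos_root r3 = 0"
    using span2_dependent[OF sp] pos_root_scaled T assms(4-6) by metis
  have no: "x *\<^sub>R pos_root p + y *\<^sub>R pos_root q + z *\<^sub>R pos_root r \<noteq> 0" 
    if "p \<in> canonical (plane_reflections v w)" "q \<in> canonical (plane_reflections v w)"
    "r \<in> canonical (plane_reflections v w)" "p \<noteq> r" "q \<noteq> r" "0 < x * y" for p q r x y z
  proof
    assume eq: "x *\<^sub>R pos_root p + y *\<^sub>R pos_root q + z *\<^sub>R pos_root r = 0"
    then have 1: "x *\<^sub>R pos_root p + y *\<^sub>R pos_root q = (- z) *\<^sub>R pos_root r"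
      by (simp add: eq_neg_iff_add_eq_0)
    then have "- (x *\<^sub>R pos_root p + y *\<^sub>R pos_root q) = - ((- z) *\<^sub>R pos_root r)" by (rule arg_cong)
    then have 2: "(- x) *\<^sub>R pos_root p + (- y) *\<^sub>R pos_root q = z *\<^sub>R pos_root r" by simp
    have "0 < x \<and> 0 < y \<or> 0 < - x \<and> 0 < - y" using \<open>0 < x * y\<close> by (auto simp: zero_less_mult_iff)
    then show False
      using canonical_no_positive_relation[OF plane_conj_closed that(1-5)] 1 2 by blast
  qed
  have "0 < a * b \<or> 0 < b * c \<or> 0 < c * a"
    using abc(1-3) by (auto simp: zero_less_mult_iff linorder_neq_iff)
  then show False
    using no[of r1 r2 r3 a b c] no[of r2 r3 r1 b c a] no[of r3 r1 r2 c a b] abc(4) assms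
    by (auto simp: ac_simps)
qed

text \<open>A further letter either prolongs the alternating word or cancels its first letter. For
  the empty word \<open>a\<close> and \<open>b\<close> may have to be exchanged, because
  \<open>alt\<close> prescribes the last letter.\<close>

lemma wprod_two_involutions:
  assumes "p \<in> T" "q \<in> T" "set ws \<subseteq> {p, q}"
  shows "\<exists>k. \<exists>a\<in>T. \<exists>b\<in>T. {a, b} = {p, q} \<and>
    wprod W ws = wprod W (alt k a b) \<and> even k = even (length ws)"
  using assms(3)
proof (induction ws)
  case Nil
  then show ?case using assms by (intro exI[of _ 0] bexI[of _ p] bexI[of _ q]) auto
next
  case (Cons c ws)
  then obtain k a b where k: "a \<in> T" "b \<in> T" "{a, b} = {p, q}"
    "wprod W ws = wprod W (alt k a b)" "even k = even (length ws)" by auto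
  have c: "c \<in> {a, b}" using Cons.prems k(3) by simp
  then have cT: "c \<in> T" using k by auto
  have alt_T: "set (alt j a b) \<subseteq> T" "set (alt j b a) \<subseteq> T" for j
    using set_alt[of j a b] set_alt[of j b a] k(1,2) by blast+
  show ?case
  proof (cases "c = (if even k then b else a)")
    case True
    then have "wprod W (c # ws) = wprod W (alt (Suc k) a b)"
      by (simp only: alt_Suc_Cons wprod_Cons k(4))
    then show ?thesis using k
      by (intro exI[of _ "Suc k"] bexI[of _ a] bexI[of _ b]) auto
  next
    case False
    show ?thesis
    proof (cases k)
      case 0
      then have "c = a" using False c by simp
      then have "wprod W (c # ws) = wprod W (alt 1 b a)" using 0 k by simp
      then show ?thesis using k 0
        by (intro exI[of _ 1] bexI[of _ b] bexI[of _ a]) auto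
    next
      case (Suc j)
      then have "c = (if even j then b else a)" using False c by (auto split: if_splits)
      then have "wprod W (alt k a b) = c \<otimes> wprod W (alt j a b)"
        by (simp only: Suc alt_Suc_Cons wprod_Cons)
      then have "wprod W (c # ws) = wprod W (alt j a b)"
        using k(4) cT alt_T[of j] by (simp add: mult_involution_cancel refl.gens_invol)
      then show ?thesis using k Suc
        by (intro exI[of _ j] bexI[of _ a] bexI[of _ b]) auto
    qed
  qed
qed

text \<open>An alternating word of odd length is a palindrome, hence a conjugate of its middle
  letter.\<close>

lemma wprod_alt_odd:
  assumes "a \<in> T" "b \<in> T"
  shows "wprod W (alt (Suc (2 * j)) a b) \<in> T"
  using assms
proof (induction j arbitrary: a b)
  case 0
  then show ?case by simp
next
  case (Suc j)
  have "alt (Suc (2 * Suc j)) a b = b # alt (Suc (2 * j)) b a @ [b]"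
    using alt_Suc_Cons[of "Suc (2 * j)" b a] by simp
  moreover have "set (alt (Suc (2 * j)) b a) \<subseteq> T" using set_alt[of "Suc (2 * j)" b a] Suc.prems by blast
  ultimately have "wprod W (alt (Suc (2 * Suc j)) a b) = b \<otimes> wprod W (alt (Suc (2 * j)) b a) \<otimes> inv b"
    using Suc.prems by (simp add: wprod_append refl.inv_gen m_assoc del: alt.simps)
  then show ?case using Suc reflection_conj by simp
qed

text \<open>Each of the three is a word in at most two canonical generators, of odd length because
  reflections have sign -1. The concatenation is again odd, and odd words in two involutions are
  reflections.\<close>

lemma coplanar_triple_reflection:
  assumes "t1 \<in> plane_reflections v w" "t2 \<in> plane_reflections v w" "t3 \<in> plane_reflections v w"
  shows "t1 \<otimes> t2 \<otimes> t3 \<in> T"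
proof -
  let ?C = "plane_reflections v w"
  have CT: "canonical ?C \<subseteq> T" "?C \<subseteq> T" by (auto simp: canonical_def plane_reflections_def)
  obtain p q where pq: "p \<in> T" "q \<in> T" "canonical ?C \<subseteq> {p, q}"
  proof (rule subset_pair[OF canonical_plane_no_three[of _ v w] CT(1)])
    show "T \<noteq> {}" using assms(1) CT(2) by blast
  qed
  obtain as where as: "set as \<subseteq> canonical ?C" "wprod W as = t1"
    using canonical_generate[OF plane_conj_closed assms(1)] .
  obtain bs where bs: "set bs \<subseteq> canonical ?C" "wprod W bs = t2"
    using canonical_generate[OF plane_conj_closed assms(2)] .
  obtain cs where cs: "set cs \<subseteq> canonical ?C" "wprod W cs = t3"
    using canonical_generate[OF plane_conj_closed assms(3)] .
  have sT: "set as \<subseteq> T" "set bs \<subseteq> T" "set cs \<subseteq> T" using as bs cs CT by auto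
  have tT: "t1 \<in> T" "t2 \<in> T" "t3 \<in> T" using assms CT(2) by auto
  have "odd (length as)" "odd (length bs)" "odd (length cs)"
    using reflection_word_parity[OF sT(1)] reflection_word_parity[OF sT(2)]
      reflection_word_parity[OF sT(3)] tT[THEN reflection_odd] as(2) bs(2) cs(2) by auto
  then have odd: "odd (length (as @ bs @ cs))" by simp
  have "set (as @ bs @ cs) \<subseteq> {p, q}" using as bs cs pq(3) by auto
  then obtain k a b where k: "a \<in> T" "b \<in> T" "wprod W (as @ bs @ cs) = wprod W (alt k a b)" "odd k"
    using wprod_two_involutions[OF pq(1,2)] odd by metis
  obtain j where "k = Suc (2 * j)" using k(4) by (metis oddE Suc_eq_plus1)
  then have "wprod W (as @ bs @ cs) \<in> T" using wprod_alt_odd k by simp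
  moreover have "wprod W (as @ bs @ cs) = t1 \<otimes> t2 \<otimes> t3"
    using sT as(2) bs(2) cs(2) tT by (simp add: wprod_append m_assoc)
  ultimately show ?thesis by simp
qed

section \<open>Coplanarity from equal products of two reflections\<close>

lemma root_lookup_dual:
  assumes "is_root t \<beta>"
  shows "Poly_Mapping.lookup \<beta> (r, True) = 0"
proof -
  obtain x s where x: "x \<in> carrier W" "s \<in> S" "\<beta> = rho x (sroot s)"
    using assms by (auto simp: is_root_def)
  obtain us where us: "set us \<subseteq> S" "wprod W us = x" using gens_generate[OF x(1)] by blast
  have "Poly_Mapping.lookup (act us (sroot s)) (r, True) = 0"
    by (induction us) (simp_all add: srefl_def sroot_def lookup_minus lookup_single)
  then show ?thesis using rho_wprod us x(3) by metis
qed

text \<open>Pairing with the dual vectors reads off the coordinates at the simple roots; the other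
  coordinates vanish by assumption, as they do for roots.\<close>

lemma B_nondegenerate:
  assumes "\<And>s. Poly_Mapping.lookup v (s, True) = 0" "\<And>w. B w v = 0"
  shows "v = 0"
proof (rule poly_mapping_eqI)
  fix i :: "'a \<times> bool"
  have "Poly_Mapping.lookup v (s, False) = 0" for s
    using assms(2)[of "Poly_Mapping.single (s, True) 1"] by (simp add: B_dual coord_def)
  then show "Poly_Mapping.lookup v i = Poly_Mapping.lookup 0 i"
    using assms(1) by (cases i; cases "snd i") auto
qed

text \<open>
  Both factorisations have the same fixed space, the common kernel of the two root functionals
  of either of them.
\<close>

lemma equal_products_coplanar:
  assumes T: "a \<in> T" "b \<in> T" "c \<in> T" "d \<in> T" and "a \<noteq> b" and eq: "a \<otimes> b = c \<otimes> d"
  shows "pos_root c \<in> span2 (pos_root a) (pos_root b)"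
proof -
  define \<alpha> \<beta> \<gamma> \<delta> where "\<alpha> = pos_root a" and "\<beta> = pos_root b" and "\<gamma> = pos_root c"
    and "\<delta> = pos_root d"
  have r: "is_root a \<alpha>" "is_root b \<beta>" "is_root c \<gamma>" "is_root d \<delta>"
    using T pos_root by (auto simp: \<alpha>_def \<beta>_def \<gamma>_def \<delta>_def)
  have cl: "a \<in> carrier W" "b \<in> carrier W" "c \<in> carrier W" "d \<in> carrier W" using T by auto
  have "c \<noteq> d"
  proof
    assume "c = d"
    then have "a \<otimes> b = \<one>" using eq T refl.gens_invol by simp
    then have "a = inv b" using cl by (simp add: inv_equality)
    then show False using refl.inv_gen T(2) \<open>a \<noteq> b\<close> by simp
  qed
  have kernel: "B v \<gamma> = 0" if "B v \<alpha> = 0" "B v \<beta> = 0" for v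
  proof (rule ccontr)
    assume nz: "B v \<gamma> \<noteq> 0"
    have "rho c (rho d v) = rho a (rho b v)" using eq cl by (simp flip: rho_mult)
    also have "\<dots> = v" using that rho_root r by simp
    finally have "rho c (rho c (rho d v)) = rho c v" by simp
    moreover have "rho c (rho c (rho d v)) = rho d v"
      using cl refl.gens_invol[OF T(3)] by (simp add: mult_involution_cancel flip: rho_mult)
    ultimately have "rho d v = rho c v" by simp
    then have "B v \<delta> *\<^sub>R \<delta> = B v \<gamma> *\<^sub>R \<gamma>" using rho_root r(3,4) by simp
    then have "(1 / B v \<gamma>) *\<^sub>R (B v \<delta> *\<^sub>R \<delta>) = (1 / B v \<gamma>) *\<^sub>R (B v \<gamma> *\<^sub>R \<gamma>)" by simp
    then have "\<gamma> = (B v \<delta> / B v \<gamma>) *\<^sub>R \<delta>" using nz by simp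
    then show False using pos_root_scaled[OF T(3,4)] \<open>c \<noteq> d\<close> by (auto simp: \<gamma>_def \<delta>_def)
  qed
  have lk: "Poly_Mapping.lookup \<alpha> (s, True) = 0" "Poly_Mapping.lookup \<beta> (s, True) = 0"
    "Poly_Mapping.lookup \<gamma> (s, True) = 0" for s using root_lookup_dual r by auto
  \<comment> \<open>The two roots are not proportional, so some \<open>u\<close> together with
    \<open>\<alpha>\<close> separates their functionals.\<close>
  have "\<exists>v. 2 * B v \<beta> \<noteq> B \<alpha> \<beta> * B v \<alpha>"
  proof (rule ccontr)
    assume "\<not> ?thesis"
    then have "B v (2 *\<^sub>R \<beta> - B \<alpha> \<beta> *\<^sub>R \<alpha>) = 0" for v by (simp add: B_simps)
    then have "2 *\<^sub>R \<beta> - B \<alpha> \<beta> *\<^sub>R \<alpha> = 0"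
      by (intro B_nondegenerate) (simp_all add: lookup_minus lk)
    then have "(1/2) *\<^sub>R (2 *\<^sub>R \<beta>) = (1/2) *\<^sub>R (B \<alpha> \<beta> *\<^sub>R \<alpha>)" by simp
    then have "\<beta> = (B \<alpha> \<beta> / 2) *\<^sub>R \<alpha>" by simp
    then show False using pos_root_scaled[OF T(2,1)] \<open>a \<noteq> b\<close> by (auto simp: \<alpha>_def \<beta>_def)
  qed
  then obtain u where u: "2 * B u \<beta> \<noteq> B \<alpha> \<beta> * B u \<alpha>" by blast
  \<comment> \<open>Up to sign, \<open>D\<close> is the determinant of the two functionals on
    \<open>\<alpha>\<close> and \<open>u\<close>, with 2 for \<open>B \<alpha> \<alpha>\<close>. By
    Cramer's rule, \<open>y\<close> and \<open>z\<close> make the functional of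
    \<open>\<gamma>\<close> agree on these two vectors with the combination of the other
    two.\<close>
  define D where "D = B u \<alpha> * B \<alpha> \<beta> - 2 * B u \<beta>"
  have D: "D \<noteq> 0" using u by (simp add: D_def mult.commute)
  define y where "y = (B \<alpha> \<beta> * B u \<gamma> - B u \<beta> * B \<alpha> \<gamma>) / D"
  define z where "z = (B u \<alpha> * B \<alpha> \<gamma> - 2 * B u \<gamma>) / D"
  have Da: "B \<alpha> \<alpha> = 2" using root_norm r by simp
  have "B v (D *\<^sub>R \<gamma> - (D * y) *\<^sub>R \<alpha> - (D * z) *\<^sub>R \<beta>) = 0" for v
  proof -
    \<comment> \<open>\<open>D\<close> times the projection of \<open>v\<close> along
      \<open>\<alpha>\<close> and \<open>u\<close> onto the common kernel.\<close>
    define w where "w = D *\<^sub>R v - (B v \<alpha> * B \<alpha> \<beta> - 2 * B v \<beta>) *\<^sub>R u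
      - (B u \<alpha> * B v \<beta> - B v \<alpha> * B u \<beta>) *\<^sub>R \<alpha>"
    have "B w \<alpha> = 0" "B w \<beta> = 0"
      by (simp_all add: w_def B_simps D_def Da algebra_simps)
    then have "B w \<gamma> = 0" by (rule kernel)
    then have "D * B v \<gamma> = (B v \<alpha> * B \<alpha> \<beta> - 2 * B v \<beta>) * B u \<gamma>
      + (B u \<alpha> * B v \<beta> - B v \<alpha> * B u \<beta>) * B \<alpha> \<gamma>"
      by (simp add: w_def B_simps)
    moreover have "D * y = B \<alpha> \<beta> * B u \<gamma> - B u \<beta> * B \<alpha> \<gamma>" "D * z = B u \<alpha> * B \<alpha> \<gamma> - 2 * B u \<gamma>"
      using D by (simp_all add: y_def z_def)
    ultimately have "D * B v \<gamma> - D * y * B v \<alpha> - D * z * B v \<beta> = 0" by algebra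
    then show ?thesis by (simp add: B_simps)
  qed
  then have "D *\<^sub>R \<gamma> - (D * y) *\<^sub>R \<alpha> - (D * z) *\<^sub>R \<beta> = 0"
    by (intro B_nondegenerate) (simp_all add: lookup_minus lk)
  then have "D *\<^sub>R \<gamma> = D *\<^sub>R (y *\<^sub>R \<alpha> + z *\<^sub>R \<beta>)" by (simp add: algebra_simps)
  then have "\<gamma> = y *\<^sub>R \<alpha> + z *\<^sub>R \<beta>" using D by simp
  then show ?thesis unfolding span2_def \<alpha>_def \<beta>_def \<gamma>_def by blast
qed

text \<open>In use, \<open>t1 \<otimes> p\<close> and \<open>t1 \<otimes> q\<close> are distinct
  elements of length 2 above both \<open>t1\<close> and \<open>t2\<close>, and the last assumption
  places both below one element. Coplanarity is applied to the products
  \<open>t1 \<otimes> t2 = p \<otimes> p'\<close>, \<open>t1 \<otimes> t2 = q \<otimes> q'\<close>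
  and \<open>p \<otimes> q = t \<otimes> t'\<close>.\<close>

lemma two_common_factors_reflection:
  assumes T: "t1 \<in> T" "t2 \<in> T" "p \<in> T" "p' \<in> T" "q \<in> T" "q' \<in> T" "t \<in> T" "t' \<in> T"
    and "t1 \<noteq> t2" "p \<noteq> q"
    and u: "t1 \<otimes> p = t2 \<otimes> p'" and v: "t1 \<otimes> q = t2 \<otimes> q'"
    and w: "t1 \<otimes> p \<otimes> t = t1 \<otimes> q \<otimes> t'"
  shows "t1 \<otimes> p \<otimes> t \<in> T"
proof -
  have cl: "t1 \<in> carrier W" "t2 \<in> carrier W" "p \<in> carrier W" "p' \<in> carrier W" "q \<in> carrier W"
    "q' \<in> carrier W" "t \<in> carrier W" "t' \<in> carrier W" using T by auto
  have comm: "t1 \<otimes> t2 = r \<otimes> r'" 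
    if "t1 \<otimes> r = t2 \<otimes> r'" "r \<in> T" "r' \<in> T" for r r'
  proof -
    have "t1 \<otimes> (t1 \<otimes> r) \<otimes> r' = t1 \<otimes> (t2 \<otimes> r') \<otimes> r'" using that(1) by simp
    then show ?thesis
      using that(2,3) T cl by (simp add: m_assoc mult_involution_cancel refl.gens_invol)
  qed
  let ?C = "plane_reflections (pos_root t1) (pos_root t2)"
  have "pos_root p \<in> span2 (pos_root t1) (pos_root t2)" "pos_root q \<in> span2 (pos_root t1) (pos_root t2)"
    using equal_products_coplanar[OF T(1,2)] comm[OF u] comm[OF v] T \<open>t1 \<noteq> t2\<close> by auto
  moreover have "p \<otimes> t = q \<otimes> t'" using w cl by (simp add: m_assoc)
  then have "q \<otimes> (p \<otimes> t) \<otimes> t = q \<otimes> (q \<otimes> t') \<otimes> t" by simp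
  then have "q \<otimes> p = t' \<otimes> t"
    using T cl by (simp add: m_assoc mult_involution_cancel refl.gens_invol)
  then have "inv (q \<otimes> p) = inv (t' \<otimes> t)" by simp
  then have "p \<otimes> q = t \<otimes> t'" using T cl by (simp add: inv_mult_group refl.inv_gen)
  then have "pos_root t \<in> span2 (pos_root p) (pos_root q)"
    using equal_products_coplanar[of p q t t'] T \<open>p \<noteq> q\<close> by simp
  ultimately have "t1 \<in> ?C" "p \<in> ?C" "t \<in> ?C"
    using T span2_left span2_subset unfolding plane_reflections_def by blast+
  then show ?thesis by (rule coplanar_triple_reflection)
qed

end

section \<open>Greatest common divisors from least common multiples\<close>

lemma opposite_simps [simp]:
  "carrier (opposite M) = carrier M"
  "a \<otimes>\<^bsub>opposite M\<^esub> b = b \<otimes>\<^bsub>M\<^esub> a"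
  "\<one>\<^bsub>opposite M\<^esub> = \<one>\<^bsub>M\<^esub>"
  by (simp_all add: opposite_def)

locale graded_monoid = monoid_cancel M for M :: "('a, 'b) monoid_scheme" (structure) +
  fixes len :: "'a \<Rightarrow> nat"
  assumes len_mult: "\<lbrakk>a \<in> carrier M; b \<in> carrier M\<rbrakk> \<Longrightarrow> len (a \<otimes> b) = len a + len b"
    and len_eq_0: "\<lbrakk>a \<in> carrier M; len a = 0\<rbrakk> \<Longrightarrow> a = \<one>"
begin

lemma graded_monoid_opposite: "graded_monoid (opposite M) len"
  by unfold_locales (auto simp: m_assoc len_mult len_eq_0 intro: l_cancel r_cancel)

text \<open>Take a longest common divisor \<open>d\<close>. Its least common multiple with any other
  common divisor is again a common divisor, hence not longer than \<open>d\<close>, hence equal to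
  \<open>d\<close>.\<close>

lemma gcd_exists:
  assumes lcm: "\<And>a b. \<lbrakk>a \<in> carrier M; b \<in> carrier M\<rbrakk> \<Longrightarrow> \<exists>d\<in>carrier M. d lcmof a b"
    and ab: "a \<in> carrier M" "b \<in> carrier M"
  shows "\<exists>d\<in>carrier M. d gcdof a b"
proof -
  define C where "C = {d \<in> carrier M. d divides a \<and> d divides b}"
  have "\<one> \<in> C" using ab by (auto simp: C_def intro: dividesI)
  moreover have "\<forall>d. d \<in> C \<longrightarrow> len d < Suc (len a)"
    by (auto simp: C_def len_mult factor_def)
  ultimately obtain d where d: "d \<in> C" "\<And>e. e \<in> C \<Longrightarrow> len e \<le> len d"
    using ex_has_greatest_nat[of "\<lambda>d. d \<in> C" \<one> len "Suc (len a)"] by auto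
  have dM: "d \<in> carrier M" using d(1) by (simp add: C_def)
  have "e divides d" if e: "e \<in> C" for e
  proof -
    have eM: "e \<in> carrier M" using e by (simp add: C_def)
    obtain m where m: "m \<in> carrier M" "m lcmof d e" using lcm[OF dM eM] by blast
    then have "m \<in> C" using d(1) e ab by (auto simp: C_def islcm_def)
    obtain c where c: "c \<in> carrier M" "m = d \<otimes> c" using m(2) by (auto simp: islcm_def factor_def)
    then have "len c = 0" using d(2)[OF \<open>m \<in> C\<close>] dM by (simp add: len_mult)
    then have "m = d" using c dM len_eq_0[OF c(1)] by simp
    then show ?thesis using m(2) by (simp add: islcm_def)
  qed
  then show ?thesis using d(1) by (auto simp: C_def isgcd_def)
qed

text \<open>The greatest common divisor of the two products is a multiple
  \<open>c \<otimes> f\<close> of \<open>c\<close>, and cancelling \<open>c\<close> shows that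
  \<open>f\<close> divides \<open>g\<close>.\<close>

lemma gcd_mult_left:
  assumes gcd: "\<And>a b. \<lbrakk>a \<in> carrier M; b \<in> carrier M\<rbrakk> \<Longrightarrow> \<exists>d\<in>carrier M. d gcdof a b"
    and M: "x \<in> carrier M" "y \<in> carrier M" "c \<in> carrier M" "g \<in> carrier M" "z \<in> carrier M"
    and g: "g gcdof x y" and z: "z divides c \<otimes> x" "z divides c \<otimes> y"
  shows "z divides c \<otimes> g"
proof -
  obtain e where e: "e \<in> carrier M" "e gcdof (c \<otimes> x) (c \<otimes> y)" using gcd M by (metis m_closed)
  have "c divides e" using e M by (auto simp: isgcd_def intro: dividesI)
  then obtain f where f: "f \<in> carrier M" "e = c \<otimes> f" by (auto simp: factor_def)
  then have "f divides x" "f divides y" using e M by (auto simp: isgcd_def)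
  then have "f divides g" using g f by (simp add: isgcd_def)
  then have "e divides c \<otimes> g" using f M by simp
  moreover have "z divides e" using e z M by (simp add: isgcd_def)
  ultimately show ?thesis using divides_trans M(5) by blast
qed

lemma divides_opposite: "a divides\<^bsub>opposite M\<^esub> b \<longleftrightarrow> (\<exists>c\<in>carrier M. b = c \<otimes> a)"
  by (simp add: factor_def)

text \<open>
  Complements with respect to a power of \<open>\<Delta>\<close> turn right multiples into left divisors.
\<close>

lemma right_lcm_exists:
  assumes gcd: "\<And>a b. \<lbrakk>a \<in> carrier M; b \<in> carrier M\<rbrakk> \<Longrightarrow> \<exists>d\<in>carrier M. d gcdof a b"
    and \<Delta>: "\<Delta> \<in> carrier M"
    and power: "\<And>a. a \<in> carrier M \<Longrightarrow> \<exists>k::nat. \<exists>y\<in>carrier M. \<Delta> [^] k = y \<otimes> a"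
    and ab: "a \<in> carrier M" "b \<in> carrier M"
  shows "\<exists>m\<in>carrier M. m lcmof\<^bsub>opposite M\<^esub> a b"
proof -
  \<comment> \<open>Exponents can be raised, so two elements can be completed to the same
    power.\<close>
  have larger: "\<exists>y\<in>carrier M. \<Delta> [^] (j + k) = y \<otimes> a"
    if "a \<in> carrier M" "y \<in> carrier M" "\<Delta> [^] k = y \<otimes> a" for j k :: nat and a y
  proof -
    have "\<Delta> [^] (j + k) = \<Delta> [^] j \<otimes> (y \<otimes> a)" using \<Delta> that(3) by (simp add: nat_pow_mult[symmetric])
    also have "\<dots> = \<Delta> [^] j \<otimes> y \<otimes> a" using \<Delta> that by (simp add: m_assoc)
    finally show ?thesis using \<Delta> that(2) by blast
  qed
  obtain k1 y1 where "y1 \<in> carrier M" "\<Delta> [^] (k1::nat) = y1 \<otimes> a" using power ab by blast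
  moreover obtain k2 y2 where "y2 \<in> carrier M" "\<Delta> [^] (k2::nat) = y2 \<otimes> b" using power ab by blast
  ultimately obtain a' b' where a': "a' \<in> carrier M" "\<Delta> [^] (k2 + k1) = a' \<otimes> a"
    and b': "b' \<in> carrier M" "\<Delta> [^] (k2 + k1) = b' \<otimes> b"
    using larger[of a y1 k1 k2] larger[of b y2 k2 k1] ab by (metis add.commute)
  define k where "k = k2 + k1"
  obtain g where g: "g \<in> carrier M" "g gcdof a' b'" using gcd a' b' by blast
  obtain a1 b1 where a1: "a1 \<in> carrier M" "a' = g \<otimes> a1" and b1: "b1 \<in> carrier M" "b' = g \<otimes> b1"
    using g by (auto simp: isgcd_def factor_def)
  define m where "m = a1 \<otimes> a"
  have m: "m \<in> carrier M" using a1 ab by (simp add: m_def)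
  have gm: "\<Delta> [^] k = g \<otimes> m" using a' a1 g ab by (simp add: k_def m_def m_assoc)
  have "g \<otimes> (b1 \<otimes> b) = g \<otimes> m" using gm b' b1 g ab by (simp add: k_def m_assoc)
  then have mb: "m = b1 \<otimes> b" using l_cancel[of g "b1 \<otimes> b" m] g(1) b1(1) ab m by simp
  have "m lcmof\<^bsub>opposite M\<^esub> a b"
    unfolding islcm_def
  proof (intro conjI ballI impI)
    show "a divides\<^bsub>opposite M\<^esub> m" "b divides\<^bsub>opposite M\<^esub> m"
      unfolding divides_opposite using a1(1) b1(1) mb m_def by blast+
    fix z assume z: "z \<in> carrier (opposite M)" "a divides\<^bsub>opposite M\<^esub> z \<and> b divides\<^bsub>opposite M\<^esub> z"
    then obtain p q where pq: "p \<in> carrier M" "q \<in> carrier M" "z = p \<otimes> a" "z = q \<otimes> b"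
      by (auto simp: divides_opposite)
    have zM: "z \<in> carrier M" using z by simp
    obtain j0 y0 where "y0 \<in> carrier M" "\<Delta> [^] (j0::nat) = y0 \<otimes> z" using power zM by blast
    then obtain y where y: "y \<in> carrier M" "\<Delta> [^] (k + j0) = y \<otimes> z"
      using larger[of z y0 j0 k] zM by blast
    have Dj: "\<Delta> [^] j0 \<in> carrier M" using \<Delta> by simp
    have pow: "\<Delta> [^] (k + j0) = \<Delta> [^] j0 \<otimes> \<Delta> [^] k" using \<Delta> by (simp add: nat_pow_mult add.commute)
    have "(y \<otimes> p) \<otimes> a = (\<Delta> [^] j0 \<otimes> a') \<otimes> a"
      using y pow pq a' Dj ab by (simp add: k_def m_assoc)
    then have 1: "\<Delta> [^] j0 \<otimes> a' = y \<otimes> p" 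
      using r_cancel[of "y \<otimes> p" a] y pq a' Dj ab by simp
    have "(y \<otimes> q) \<otimes> b = (\<Delta> [^] j0 \<otimes> b') \<otimes> b"
      using y pow pq(2,4) b' Dj ab by (simp add: k_def m_assoc)
    then have 2: "\<Delta> [^] j0 \<otimes> b' = y \<otimes> q"
      using r_cancel[of "y \<otimes> q" b] y pq b' Dj ab by simp
    \<comment> \<open>\<open>y\<close> divides both \<open>\<Delta> [^] j0 \<otimes> a'\<close> and
      \<open>\<Delta> [^] j0 \<otimes> b'\<close>, hence also
      \<open>\<Delta> [^] j0 \<otimes> g\<close>. The quotient is the cofactor of \<open>m\<close>
      in \<open>z\<close>.\<close>
    have "y divides \<Delta> [^] j0 \<otimes> g"
      using gcd_mult_left[OF gcd a'(1) b'(1) Dj g(1) y(1) g(2)] 1 2 pq by (auto intro: dividesI)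
    then obtain e where e: "e \<in> carrier M" "\<Delta> [^] j0 \<otimes> g = y \<otimes> e" by (auto simp: factor_def)
    have "y \<otimes> z = y \<otimes> (e \<otimes> m)"
      using y(2) pow gm e Dj g(1) m y(1) by (metis m_assoc)
    then have "z = e \<otimes> m" using l_cancel y(1) zM e m by blast
    then show "m divides\<^bsub>opposite M\<^esub> z" using e by (auto simp: divides_opposite)
  qed
  then show ?thesis using m by blast
qed

end

section \<open>Grids of complements\<close>

text \<open>
  For \<open>c u v\<close> a complement of \<open>v\<close> with respect to \<open>u\<close>, so that \<open>u (c u v)\<close> is the join of \<open>u\<close> and
  \<open>v\<close>, the words \<open>residual c us vs\<close> and \<open>residual c vs us\<close> are read off the far sides of the grid
  with sides \<open>us\<close> and \<open>vs\<close>.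
\<close>

fun push :: "('a \<Rightarrow> 'a \<Rightarrow> 'a) \<Rightarrow> 'a \<Rightarrow> 'a list \<Rightarrow> 'a" where
  "push c x [] = x"
| "push c x (v # vs) = push c (c v x) vs"

fun residual1 :: "('a \<Rightarrow> 'a \<Rightarrow> 'a) \<Rightarrow> 'a \<Rightarrow> 'a list \<Rightarrow> 'a list" where
  "residual1 c x [] = []"
| "residual1 c x (v # vs) = c x v # residual1 c (c v x) vs"

fun residual :: "('a \<Rightarrow> 'a \<Rightarrow> 'a) \<Rightarrow> 'a list \<Rightarrow> 'a list \<Rightarrow> 'a list" where
  "residual c [] vs = vs"
| "residual c (u # us) vs = residual c us (residual1 c u vs)"

lemma residual1_append:
  "residual1 c x (vs @ vs') = residual1 c x vs @ residual1 c (push c x vs) vs'"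
  by (induction vs arbitrary: x) simp_all

lemma residual_Nil_right [simp]: "residual c us [] = []"
  by (induction us) simp_all

lemma residual_append_left: "residual c (us @ us') vs = residual c us' (residual c us vs)"
  by (induction us arbitrary: vs) simp_all

text \<open>The recursion of \<open>residual\<close> peels off its first word; this is the unfolding
  in the other direction, where \<open>push\<close> gives the far end of the strip removed.\<close>

lemma residual_Cons_right:
  "residual c vs (u # us) = push c u vs # residual c (residual1 c u vs) us"
  by (induction vs arbitrary: u us) simp_all

lemma residual_append_right:
  "residual c us (vs @ vs') = residual c us vs @ residual c (residual c vs us) vs'"
  by (induction us arbitrary: vs vs') (simp_all add: residual1_append residual_Cons_right)

section \<open>The interval below a balanced element\<close>

locale norm_group = group G for G :: "('a, 'b) monoid_scheme" (structure) +
  fixes l :: "'a \<Rightarrow> nat"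
  assumes l_mult: "\<lbrakk>g \<in> carrier G; h \<in> carrier G\<rbrakk> \<Longrightarrow> l (g \<otimes> h) \<le> l g + l h"
    and l_inv: "g \<in> carrier G \<Longrightarrow> l (inv g) = l g"
    and l_eq_0: "g \<in> carrier G \<Longrightarrow> l g = 0 \<longleftrightarrow> g = \<one>"
    and l_conj: "\<lbrakk>g \<in> carrier G; h \<in> carrier G\<rbrakk> \<Longrightarrow> l (g \<otimes> h \<otimes> inv g) = l h"
begin

definition le :: "'a \<Rightarrow> 'a \<Rightarrow> bool" where
  "le u v \<longleftrightarrow> l u + l (inv u \<otimes> v) = l v"

lemma l_one [simp]: "l \<one> = 0" using l_eq_0 by simp

lemma le_mult_iff: "\<lbrakk>u \<in> carrier G; v \<in> carrier G\<rbrakk> \<Longrightarrow> le u (u \<otimes> v) \<longleftrightarrow> l u + l v = l (u \<otimes> v)"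
  by (simp add: le_def)

lemma le_refl: "u \<in> carrier G \<Longrightarrow> le u u"
  by (simp add: le_def)

lemma le_one: "u \<in> carrier G \<Longrightarrow> le \<one> u"
  by (simp add: le_def)

lemma le_l: "le u v \<Longrightarrow> l u \<le> l v"
  by (simp add: le_def)

lemma le_l_eq:
  assumes "u \<in> carrier G" "v \<in> carrier G" "le u v" "l v \<le> l u"
  shows "u = v"
proof -
  have "l (inv u \<otimes> v) = 0" using assms by (simp add: le_def)
  then have "inv u \<otimes> v = \<one>" using l_eq_0 assms by simp
  then show ?thesis using assms by (metis inv_closed inv_equality inv_inv l_inv_ex inv_unique')
qed

lemma le_antisym: "\<lbrakk>u \<in> carrier G; v \<in> carrier G; le u v; le v u\<rbrakk> \<Longrightarrow> u = v"
  using le_l_eq le_l by blast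

lemma le_trans:
  assumes "u \<in> carrier G" "v \<in> carrier G" "x \<in> carrier G" "le u v" "le v x"
  shows "le u x"
proof -
  have "(inv u \<otimes> v) \<otimes> (inv v \<otimes> x) = inv u \<otimes> x" using assms by (simp add: m_assoc)
  then have "l (inv u \<otimes> x) \<le> l (inv u \<otimes> v) + l (inv v \<otimes> x)"
    using l_mult[of "inv u \<otimes> v" "inv v \<otimes> x"] assms by simp
  moreover have "l x \<le> l u + l (inv u \<otimes> x)"
    using l_mult[of u "inv u \<otimes> x"] assms by simp
  ultimately show ?thesis using assms(4,5) by (simp add: le_def)
qed

text \<open>Conjugation invariance of \<open>l\<close> makes left and right divisors agree.\<close>

lemma le_quotient:
  assumes "u \<in> carrier G" "v \<in> carrier G" "le u v"
  shows "le (inv u \<otimes> v) v"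
proof -
  have "inv (inv u \<otimes> v) \<otimes> v = inv v \<otimes> u \<otimes> inv (inv v)"
    using assms by (simp add: inv_mult_group)
  then have "l (inv (inv u \<otimes> v) \<otimes> v) = l u" using l_conj[of "inv v" u] assms by simp
  then show ?thesis using assms(3) by (simp add: le_def)
qed

text \<open>Removing the factor \<open>u\<close> on the left respects the order above
  \<open>u\<close>, since both relations involve the same quotient
  \<open>inv a \<otimes> b\<close>.\<close>

lemma le_left_factor:
  assumes "u \<in> carrier G" "a \<in> carrier G" "b \<in> carrier G" "le u a"
  shows "le (inv u \<otimes> a) (inv u \<otimes> b) \<Longrightarrow> le u b \<Longrightarrow> le a b"
    and "le a b \<Longrightarrow> le (inv u \<otimes> a) (inv u \<otimes> b)"
proof -
  have 1: "inv (inv u \<otimes> a) \<otimes> (inv u \<otimes> b) = inv a \<otimes> b"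
    using assms by (simp add: inv_mult_group m_assoc)
  show "le a b" if "le (inv u \<otimes> a) (inv u \<otimes> b)" "le u b"
    using that assms(4) 1 by (simp add: le_def)
  show "le (inv u \<otimes> a) (inv u \<otimes> b)" if "le a b"
  proof -
    have "le u b" using le_trans[OF assms(1-3) assms(4) that] .
    then show ?thesis using that assms(4) 1 by (simp add: le_def)
  qed
qed

end

text \<open>Binary joins are all that grids need; greatest common divisors are recovered later from
  the grading of the monoid.\<close>

locale interval_lattice = norm_group +
  fixes w :: 'a
  assumes w_closed: "w \<in> carrier G"
    and join_exists: "\<lbrakk>u \<in> carrier G; le u w; v \<in> carrier G; le v w\<rbrakk> \<Longrightarrow>
      \<exists>j\<in>carrier G. le j w \<and> le u j \<and> le v j \<and>
        (\<forall>z\<in>carrier G. le z w \<longrightarrow> le u z \<longrightarrow> le v z \<longrightarrow> le j z)"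
begin

definition D :: "'a set" where "D = {u \<in> carrier G. le u w}"

lemma D_closed [simp]: "u \<in> D \<Longrightarrow> u \<in> carrier G"
  by (simp add: D_def)

lemma D_down: "\<lbrakk>u \<in> carrier G; v \<in> D; le u v\<rbrakk> \<Longrightarrow> u \<in> D"
  unfolding D_def using le_trans[of u v w] w_closed by simp

lemma one_D [simp]: "\<one> \<in> D" and w_D [simp]: "w \<in> D"
  unfolding D_def using w_closed by (simp_all add: le_one le_refl)

definition join :: "'a \<Rightarrow> 'a \<Rightarrow> 'a" where
  "join u v = (SOME j. j \<in> D \<and> le u j \<and> le v j \<and> (\<forall>z\<in>D. le u z \<longrightarrow> le v z \<longrightarrow> le j z))"

lemma join:
  assumes "u \<in> D" "v \<in> D"
  shows "join u v \<in> D" "le u (join u v)" "le v (join u v)"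
    "\<And>z. \<lbrakk>z \<in> D; le u z; le v z\<rbrakk> \<Longrightarrow> le (join u v) z"
proof -
  have "\<exists>j. j \<in> D \<and> le u j \<and> le v j \<and> (\<forall>z\<in>D. le u z \<longrightarrow> le v z \<longrightarrow> le j z)"
    using join_exists[of u v] assms unfolding D_def by blast
  then have "join u v \<in> D \<and> le u (join u v) \<and> le v (join u v) \<and>
      (\<forall>z\<in>D. le u z \<longrightarrow> le v z \<longrightarrow> le (join u v) z)"
    unfolding join_def by (rule someI_ex)
  then show "join u v \<in> D" "le u (join u v)" "le v (join u v)"
    "\<And>z. \<lbrakk>z \<in> D; le u z; le v z\<rbrakk> \<Longrightarrow> le (join u v) z" by auto
qed

lemma join_eqI:
  assumes "u \<in> D" "v \<in> D" "j \<in> D" "le u j" "le v j"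
    "\<And>z. \<lbrakk>z \<in> D; le u z; le v z\<rbrakk> \<Longrightarrow> le j z"
  shows "join u v = j"
  using assms join[OF assms(1,2)] by (intro le_antisym) auto

lemma join_commute: "\<lbrakk>u \<in> D; v \<in> D\<rbrakk> \<Longrightarrow> join u v = join v u"
  by (rule join_eqI) (auto intro: join)

lemma join_absorb: "\<lbrakk>u \<in> D; v \<in> D; le u v\<rbrakk> \<Longrightarrow> join u v = v"
  by (rule join_eqI) (auto intro: le_refl)

lemma join_assoc_le: "\<lbrakk>u \<in> D; v \<in> D; x \<in> D; le u v\<rbrakk> \<Longrightarrow> join v (join u x) = join v x"
proof (rule join_eqI)
  assume D: "u \<in> D" "v \<in> D" "x \<in> D" and "le u v"
  have "le u (join v x)" using le_trans[of u v "join v x"] D \<open>le u v\<close> join[OF D(2,3)] by simp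
  then show "le (join u x) (join v x)" using join[OF D(1,3)] join[OF D(2,3)] by simp
  show "le (join v x) z" if "z \<in> D" "le v z" "le (join u x) z" for z
    using join[OF D(2,3)] join[OF D(1,3)] that D le_trans[of x "join u x" z] by simp
qed (auto intro: join)

lemma quotient_D:
  assumes "u \<in> carrier G" "v \<in> D" "le u v"
  shows "inv u \<otimes> v \<in> D"
  using D_down[of "inv u \<otimes> v" v] le_quotient[of u v] assms by simp

text \<open>The join \<open>j\<close> of the quotients lies below
  \<open>inv u \<otimes> join a b\<close>, so \<open>u \<otimes> j\<close> lies below
  \<open>join a b\<close> with lengths adding up, and in particular in the interval. Being above
  \<open>a\<close> and \<open>b\<close>, it is their join.\<close>

lemma join_quotient:
  assumes "u \<in> D" "a \<in> D" "b \<in> D" "le u a" "le u b"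
  shows "join (inv u \<otimes> a) (inv u \<otimes> b) = inv u \<otimes> join a b"
proof -
  note J = join[OF assms(2,3)]
  let ?q = "inv u \<otimes> join a b"
  have uJ: "le u (join a b)" using le_trans[of u a "join a b"] assms J by simp
  have aD: "inv u \<otimes> a \<in> D" "inv u \<otimes> b \<in> D" "?q \<in> D"
    using quotient_D assms J(1) uJ by auto
  have ub: "le (inv u \<otimes> a) ?q" "le (inv u \<otimes> b) ?q"
    using le_left_factor(2) assms J by auto
  define j where "j = join (inv u \<otimes> a) (inv u \<otimes> b)"
  note j = join[OF aD(1,2), folded j_def]
  have "le j ?q" using j aD ub by blast
  then have "l ?q = l j + l (inv j \<otimes> ?q)" by (simp add: le_def)
  moreover have jqu: "inv (u \<otimes> j) \<otimes> join a b = inv j \<otimes> ?q"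
    using assms j(1) J(1) by (simp add: inv_mult_group m_assoc)
  moreover have "l (join a b) \<le> l (u \<otimes> j) + l (inv (u \<otimes> j) \<otimes> join a b)"
    using l_mult[of "u \<otimes> j" "inv (u \<otimes> j) \<otimes> join a b"] assms j(1) J(1) by simp
  moreover have "l (u \<otimes> j) \<le> l u + l j" using l_mult assms j(1) by simp
  ultimately have lj: "l (u \<otimes> j) = l u + l j" and le1: "le (u \<otimes> j) (join a b)"
    using uJ by (simp_all add: le_def)
  have ujD: "u \<otimes> j \<in> D" using D_down[OF _ J(1) le1] assms j(1) by simp
  have uj: "le u (u \<otimes> j)" using lj le_mult_iff assms(1) j(1) by simp
  have "inv u \<otimes> (u \<otimes> j) = j" using assms(1) j(1) by simp
  then have "le a (u \<otimes> j)" "le b (u \<otimes> j)"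
    using le_left_factor(1)[of u a "u \<otimes> j"] le_left_factor(1)[of u b "u \<otimes> j"] uj assms ujD j(2,3) by auto
  then have "le (join a b) (u \<otimes> j)" using J(4) ujD by blast
  then have "join a b = u \<otimes> j" using le1 le_antisym J(1) ujD by simp
  then have "?q = j" using assms(1) j(1) by simp
  then show ?thesis by (simp add: j_def)
qed

section \<open>Complements and their compatibility with the defining relations\<close>

definition compl :: "'a \<Rightarrow> 'a \<Rightarrow> 'a" where
  "compl u v = inv u \<otimes> join u v"

definition reduced :: "'a \<Rightarrow> 'a \<Rightarrow> bool" where
  "reduced u v \<longleftrightarrow> u \<in> D \<and> v \<in> D \<and> u \<otimes> v \<in> D \<and> l u + l v = l (u \<otimes> v)"

lemma reduced_le: "reduced u v \<Longrightarrow> le u (u \<otimes> v)"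
  by (simp add: reduced_def le_mult_iff)

lemma reduced_quotient:
  "\<lbrakk>u \<in> carrier G; v \<in> D; le u v\<rbrakk> \<Longrightarrow> reduced u (inv u \<otimes> v)"
  using quotient_D D_down[of u v] by (simp add: reduced_def le_def)

lemma compl_D [simp]: "\<lbrakk>u \<in> D; v \<in> D\<rbrakk> \<Longrightarrow> compl u v \<in> D"
  unfolding compl_def using quotient_D join by simp

lemma reduced_compl: "\<lbrakk>u \<in> D; v \<in> D\<rbrakk> \<Longrightarrow> reduced u (compl u v)"
  unfolding compl_def using reduced_quotient join by simp

lemma mult_compl: "\<lbrakk>u \<in> D; v \<in> D\<rbrakk> \<Longrightarrow> u \<otimes> compl u v = join u v"
  unfolding compl_def using join by simp

lemma compl_one_left: "u \<in> D \<Longrightarrow> compl \<one> u = u"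
  and compl_one_right: "u \<in> D \<Longrightarrow> compl u \<one> = \<one>"
  and compl_self: "u \<in> D \<Longrightarrow> compl u u = \<one>"
  using join_commute[of u \<one>] 
  by (simp_all add: compl_def join_absorb le_one le_refl)

text \<open>Crossing \<open>u\<close> and then \<open>v\<close> has the same effect on
  \<open>x\<close> as crossing the product, because joining with \<open>u \<otimes> v\<close>
  absorbs the join with \<open>u\<close>.\<close>

lemma compl_mult_left:
  assumes "reduced u v" "x \<in> D"
  shows "compl v (compl u x) = compl (u \<otimes> v) x"
proof -
  have D: "u \<in> D" "v \<in> D" "u \<otimes> v \<in> D" using assms by (auto simp: reduced_def)
  note J = join[OF D(1) assms(2)]
  have "join v (compl u x) = join (inv u \<otimes> (u \<otimes> v)) (inv u \<otimes> join u x)"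
    using D by (simp add: compl_def)
  also have "\<dots> = inv u \<otimes> join (u \<otimes> v) (join u x)"
    using join_quotient[OF D(1,3) J(1) reduced_le[OF assms(1)] J(2)] .
  also have "join (u \<otimes> v) (join u x) = join (u \<otimes> v) x"
    using join_assoc_le D assms(2) reduced_le[OF assms(1)] by simp
  finally show ?thesis
    using D join[OF D(3) assms(2)] by (simp add: compl_def inv_mult_group m_assoc)
qed

text \<open>Crossing \<open>x\<close> turns a defining relation into a single defining relation, so
  complements of words can be compared without inserting chains of relations.\<close>

lemma compl_mult_right:
  assumes "reduced u v" "x \<in> D"
  shows "reduced (compl x u) (compl (compl u x) v)"
    and "compl x u \<otimes> compl (compl u x) v = compl x (u \<otimes> v)"
proof -
  have D: "u \<in> D" "v \<in> D" "u \<otimes> v \<in> D" using assms by (auto simp: reduced_def)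
  have le: "le u (u \<otimes> v)" by (rule reduced_le[OF assms(1)])
  note J = join[OF assms(2) D(1)] and K = join[OF assms(2) D(3)] 
  have Jc: "join u x = join x u" using join_commute D(1) assms(2) by simp
  have JK: "le (join x u) (join x (u \<otimes> v))"
    using J K D le le_trans[of u "u \<otimes> v" "join x (u \<otimes> v)"] by simp
  have "join (compl u x) v = join (inv u \<otimes> join x u) (inv u \<otimes> (u \<otimes> v))"
    using D by (simp add: compl_def Jc)
  also have "\<dots> = inv u \<otimes> join (join x u) (u \<otimes> v)"
    using join_quotient[OF D(1) J(1) D(3) J(3) le] .
  also have "join (join x u) (u \<otimes> v) = join x (u \<otimes> v)"
    using join_assoc_le[OF D(1,3) assms(2) le] join_commute J(1) D(3) assms(2) Jc by simp
  finally have c: "compl (compl u x) v = inv (join x u) \<otimes> join x (u \<otimes> v)"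
    using D J(1) K(1) by (simp add: compl_def[of _ v]) (simp add: compl_def Jc inv_mult_group m_assoc)
  have c': "inv (join x u) \<otimes> join x (u \<otimes> v) =
      inv (inv x \<otimes> join x u) \<otimes> (inv x \<otimes> join x (u \<otimes> v))"
    using assms(2) J(1) K(1) by (simp add: inv_mult_group m_assoc)
  show "compl x u \<otimes> compl (compl u x) v = compl x (u \<otimes> v)"
    unfolding c using assms(2) J(1) K(1) by (simp add: compl_def m_assoc)
  have "le (compl x u) (compl x (u \<otimes> v))"
    unfolding compl_def using le_left_factor(2) assms(2) J K JK by simp
  then have "reduced (compl x u) (inv (compl x u) \<otimes> compl x (u \<otimes> v))"
    using reduced_quotient assms(2) D by simp
  then show "reduced (compl x u) (compl (compl u x) v)"
    unfolding c c' by (simp add: compl_def)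
qed

end

section \<open>The interval monoid\<close>

context interval_lattice
begin

abbreviation res :: "'a list \<Rightarrow> 'a list \<Rightarrow> 'a list" where "res \<equiv> residual compl"

lemma residual1_D: "\<lbrakk>x \<in> D; set vs \<subseteq> D\<rbrakk> \<Longrightarrow> set (residual1 compl x vs) \<subseteq> D"
  by (induction vs arbitrary: x) simp_all

lemma res_D: "\<lbrakk>set us \<subseteq> D; set vs \<subseteq> D\<rbrakk> \<Longrightarrow> set (res us vs) \<subseteq> D"
  by (induction us arbitrary: vs) (simp_all add: residual1_D)

text \<open>The relation for \<open>\<one>\<close> has to be imposed in a monoid; in the group it
  follows from \<open>\<one> \<otimes> \<one> = \<one>\<close> by cancellation.\<close>

definition base :: "'a list \<Rightarrow> 'a list \<Rightarrow> bool" where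
  "base a b \<longleftrightarrow> (\<exists>u v. reduced u v \<and> a = [u, v] \<and> b = [u \<otimes> v]) \<or> a = [\<one>] \<and> b = []"

inductive weq :: "'a list \<Rightarrow> 'a list \<Rightarrow> bool" where
  weq_refl: "set xs \<subseteq> D \<Longrightarrow> weq xs xs"
| weq_sym: "weq xs ys \<Longrightarrow> weq ys xs"
| weq_trans: "weq xs ys \<Longrightarrow> weq ys zs \<Longrightarrow> weq xs zs"
| weq_base: "base a b \<Longrightarrow> set p \<subseteq> D \<Longrightarrow> set q \<subseteq> D \<Longrightarrow> weq (p @ a @ q) (p @ b @ q)"

lemma base_D: "base a b \<Longrightarrow> set a \<subseteq> D \<and> set b \<subseteq> D"
  by (auto simp: base_def reduced_def)

lemma weq_D: "weq xs ys \<Longrightarrow> set xs \<subseteq> D \<and> set ys \<subseteq> D"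
  by (induction rule: weq.induct) (auto dest: base_D)

lemma weq_context: "\<lbrakk>weq a b; set p \<subseteq> D; set q \<subseteq> D\<rbrakk> \<Longrightarrow> weq (p @ a @ q) (p @ b @ q)"
proof (induction rule: weq.induct)
  case (weq_base a b p' q')
  then show ?case using weq.weq_base[of a b "p @ p'" "q' @ q"] by simp
qed (simp add: weq.weq_refl, blast intro: weq.weq_sym, blast intro: weq.weq_trans)

lemma weq_append: "\<lbrakk>weq a b; weq c d\<rbrakk> \<Longrightarrow> weq (a @ c) (b @ d)"
  using weq_context[of a b "[]" c] weq_context[of c d b "[]"] weq_D weq_trans by fastforce

lemma weq_prepend: "\<lbrakk>weq a b; set p \<subseteq> D\<rbrakk> \<Longrightarrow> weq (p @ a) (p @ b)"
  using weq_context[of a b p "[]"] by simp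

lemma weq_postpend: "\<lbrakk>weq a b; set q \<subseteq> D\<rbrakk> \<Longrightarrow> weq (a @ q) (b @ q)"
  using weq_context[of a b "[]" q] by simp

lemma weq_reduced: "reduced u v \<Longrightarrow> weq [u, v] [u \<otimes> v]"
  using weq_base[of "[u, v]" "[u \<otimes> v]" "[]" "[]"] by (auto simp: base_def)

lemma weq_one: "weq [\<one>] []"
  using weq_base[of "[\<one>]" "[]" "[]" "[]"] by (simp add: base_def)

lemma weq_ones: "weq (replicate n \<one>) []"
proof (induction n)
  case (Suc n)
  show ?case using weq_append[OF weq_one Suc] by simp
qed (simp add: weq_refl)

lemma base_residual_single:
  assumes "base a b" "x \<in> D"
  shows "res a [x] = res b [x]" "base (res [x] a) (res [x] b)"
proof -
  from assms(1) consider u v where "reduced u v" "a = [u, v]" "b = [u \<otimes> v]" | "a = [\<one>]" "b = []"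
    by (auto simp: base_def)
  then have "res a [x] = res b [x] \<and> base (res [x] a) (res [x] b)"
  proof cases
    case 1
    then show ?thesis
      using compl_mult_left[OF 1(1) assms(2)] compl_mult_right[OF 1(1) assms(2)]
      by (auto simp: base_def)
  next
    case 2
    then show ?thesis
      using assms(2) compl_one_left compl_one_right by (auto simp: base_def)
  qed
  then show "res a [x] = res b [x]" "base (res [x] a) (res [x] b)" by auto
qed

lemma base_residual:
  assumes "base a b" "set vs \<subseteq> D"
  shows "res a vs = res b vs \<and> base (res vs a) (res vs b)"
  using assms
proof (induction vs arbitrary: a b)
  case (Cons x vs)
  have x: "x \<in> D" using Cons.prems by simp
  have "base (res [x] a) (res [x] b)" using base_residual_single(2)[OF Cons.prems(1) x] .
  then have IH: "res (res [x] a) vs = res (res [x] b) vs \<and>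
      base (res vs (res [x] a)) (res vs (res [x] b))"
    using Cons by simp
  have "res c (x # vs) = res c [x] @ res (res [x] c) vs" for c
    using residual_append_right[of compl c "[x]" vs] by simp
  moreover have "res (x # vs) c = res vs (res [x] c)" for c
    using residual_append_left[of compl "[x]" vs c] by simp
  ultimately show ?case
    using IH base_residual_single(1)[OF Cons.prems(1) x] by metis
qed simp

text \<open>The first part is an equality of words, not just an equivalence: the letters to the
  right of an applied relation then meet the same word and contribute the same residuals.\<close>

lemma weq_residual:
  assumes "weq us us'" "set vs \<subseteq> D"
  shows "res us vs = res us' vs \<and> weq (res vs us) (res vs us')"
  using assms
proof (induction arbitrary: vs rule: weq.induct)
  case (weq_refl xs)
  then show ?case by (simp add: res_D weq.weq_refl)
next
  case (weq_sym xs ys)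
  then show ?case by (metis weq.weq_sym)
next
  case (weq_trans xs ys zs)
  then show ?case by (metis weq.weq_trans)
next
  case (weq_base a b p q)
  have ab: "set a \<subseteq> D" "set b \<subseteq> D" using base_D[OF weq_base(1)] by auto
  have pv: "set (res p vs) \<subseteq> D" and vp: "set (res vs p) \<subseteq> D"
    using weq_base by (simp_all add: res_D)
  have 1: "res a (res p vs) = res b (res p vs)" "base (res (res p vs) a) (res (res p vs) b)"
    using base_residual[OF weq_base(1) pv] by auto
  have "set (res (res b (res p vs)) q) \<subseteq> D" using ab pv weq_base by (intro res_D) auto
  then show ?case
    using 1 vp weq.weq_base
    by (simp add: residual_append_left residual_append_right)
qed

lemma residual1_one: "set vs \<subseteq> D \<Longrightarrow> residual1 compl \<one> vs = vs"
  and push_one: "set vs \<subseteq> D \<Longrightarrow> push compl \<one> vs = \<one>"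
  by (induction vs) (simp_all add: compl_one_left compl_one_right)

lemma res_ones_left: "set vs \<subseteq> D \<Longrightarrow> res (replicate n \<one>) vs = vs"
  by (induction n) (simp_all add: residual1_one)

lemma res_ones_right: "set us \<subseteq> D \<Longrightarrow> res us (replicate n \<one>) = replicate n \<one>"
  by (induction n) (simp_all add: residual_Cons_right push_one residual1_one)

lemma res_self: "set us \<subseteq> D \<Longrightarrow> res us us = replicate (length us) \<one>"
  by (induction us) (simp_all add: compl_self residual1_one residual_Cons_right push_one)

text \<open>The residual of \<open>us @ xs\<close> after \<open>us\<close> is \<open>xs\<close> up
  to units, and residuals respect \<open>weq\<close>.\<close>

lemma weq_left_cancel:
  assumes "weq (us @ xs) (us @ ys)"
  shows "weq xs ys"
proof -
  have D: "set us \<subseteq> D" "set xs \<subseteq> D" "set ys \<subseteq> D" using weq_D[OF assms] by auto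
  have "res us (us @ zs) = replicate (length us) \<one> @ zs" if "set zs \<subseteq> D" for zs
    using that D(1) by (simp add: residual_append_right res_self res_ones_left)
  then have eq: "weq (replicate (length us) \<one> @ xs) (replicate (length us) \<one> @ ys)"
    using weq_residual[OF assms D(1)] D by simp
  have "weq (replicate (length us) \<one> @ zs) zs" if "set zs \<subseteq> D" for zs
    using weq_postpend[OF weq_ones that] by simp
  then show ?thesis
    using weq_trans[OF weq_sym weq_trans[OF eq]] D(2,3) by simp
qed

lemma weq_compl_commute:
  assumes "x \<in> D" "v \<in> D"
  shows "weq [x, compl x v] [v, compl v x]"
  using weq_reduced[OF reduced_compl[OF assms]] weq_reduced[OF reduced_compl[OF assms(2,1)]] assms
    join_commute[OF assms] by (metis mult_compl weq_sym weq_trans)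

lemma weq_push:
  assumes "x \<in> D" "set vs \<subseteq> D"
  shows "weq (x # residual1 compl x vs) (vs @ [push compl x vs])"
  using assms
proof (induction vs arbitrary: x)
  case Nil
  then show ?case by (simp add: weq_refl)
next
  case (Cons v vs)
  have D: "x \<in> D" "v \<in> D" "set vs \<subseteq> D" using Cons.prems by auto
  have "weq ([x, compl x v] @ residual1 compl (compl v x) vs)
      ([v, compl v x] @ residual1 compl (compl v x) vs)"
    using D by (intro weq_postpend weq_compl_commute residual1_D) simp_all
  moreover have "weq ([v] @ compl v x # residual1 compl (compl v x) vs)
      ([v] @ vs @ [push compl (compl v x) vs])"
    using D by (intro weq_prepend Cons.IH) simp_all
  ultimately show ?case by (auto intro: weq_trans)
qed

lemma weq_residual_commute:
  assumes "set us \<subseteq> D" "set vs \<subseteq> D"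
  shows "weq (us @ res us vs) (vs @ res vs us)"
  using assms
proof (induction us arbitrary: vs)
  case Nil
  then show ?case by (simp add: weq_refl)
next
  case (Cons u us)
  have D: "u \<in> D" "set us \<subseteq> D" "set vs \<subseteq> D" using Cons.prems by auto
  have r1: "set (residual1 compl u vs) \<subseteq> D" using residual1_D D by simp
  have "weq ([u] @ us @ res us (residual1 compl u vs))
      ([u] @ residual1 compl u vs @ res (residual1 compl u vs) us)"
    using D r1 by (intro weq_prepend Cons.IH) simp_all
  moreover have "weq ((u # residual1 compl u vs) @ res (residual1 compl u vs) us)
      ((vs @ [push compl u vs]) @ res (residual1 compl u vs) us)"
    using D r1 by (intro weq_postpend weq_push res_D) simp_all
  ultimately show ?case by (auto simp: residual_Cons_right intro: weq_trans)
qed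

text \<open>Nothing but units remains of \<open>vs\<close> after a multiple of \<open>vs\<close>.
  Read for \<open>us @ as\<close>, this says that \<open>as\<close> exhausts
  \<open>res us vs\<close>, so \<open>as\<close> is a multiple of it.\<close>

lemma weq_common_multiple:
  assumes zs: "weq zs (us @ as)" "weq zs (vs @ bs)"
  shows "\<exists>cs. set cs \<subseteq> D \<and> weq zs (us @ res us vs @ cs)"
proof -
  have D: "set us \<subseteq> D" "set as \<subseteq> D" "set vs \<subseteq> D" "set bs \<subseteq> D" 
    using weq_D zs by force+
  define c where "c = res us vs"
  have cD: "set c \<subseteq> D" using D by (simp add: c_def res_D)
  have "res as c = res (us @ as) vs" by (simp add: c_def residual_append_left)
  also have "\<dots> = res (vs @ bs) vs"
    using weq_residual[OF zs(1) D(3)] weq_residual[OF zs(2) D(3)] by simp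
  also have "\<dots> = replicate (length vs) \<one>"
    using D by (simp add: residual_append_left res_self res_ones_right)
  finally have ones: "weq (res as c) []" by (simp add: weq_ones)
  have "weq (as @ []) (as @ res as c)" using weq_prepend[OF weq_sym[OF ones] D(2)] .
  then have "weq as (c @ res c as)"
    using weq_residual_commute[OF D(2) cD] by (auto intro: weq_trans)
  then have "weq (us @ as) (us @ c @ res c as)" using D(1) weq_prepend by simp
  then show ?thesis
    using zs(1) res_D[OF cD D(2)] weq_trans unfolding c_def by blast
qed

definition weight :: "'a list \<Rightarrow> nat" where "weight xs = sum_list (map l xs)"

lemma weq_weight: "weq xs ys \<Longrightarrow> weight xs = weight ys"
  by (induction rule: weq.induct) (auto simp: weight_def base_def reduced_def)

lemma weight_0: "\<lbrakk>set xs \<subseteq> D; weight xs = 0\<rbrakk> \<Longrightarrow> weq xs []"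
proof -
  assume "set xs \<subseteq> D" "weight xs = 0"
  then have "x = \<one>" if "x \<in> set xs" for x
    using that l_eq_0[of x] by (auto simp: weight_def)
  then have "xs = replicate (length xs) \<one>" by (intro replicate_eqI) auto
  then show ?thesis using weq_ones by metis
qed

section \<open>Conjugation by \<open>w\<close> and quasi-centrality\<close>

definition conj_by :: "'a \<Rightarrow> 'a \<Rightarrow> 'a" where "conj_by z x = z \<otimes> x \<otimes> inv z"

lemma conj_by_mult:
  "\<lbrakk>z \<in> carrier G; x \<in> carrier G; y \<in> carrier G\<rbrakk> \<Longrightarrow> conj_by z (x \<otimes> y) = conj_by z x \<otimes> conj_by z y"
  by (simp add: conj_by_def m_assoc)

lemma conj_by_D:
  assumes z: "z \<in> carrier G" "conj_by z w = w" and x: "x \<in> D"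
  shows "conj_by z x \<in> D"
proof -
  have "inv (conj_by z x) \<otimes> w = inv (conj_by z x) \<otimes> conj_by z w" using z by simp
  also have "\<dots> = z \<otimes> (inv x \<otimes> w) \<otimes> inv z"
    using z(1) x w_closed by (simp add: conj_by_def inv_mult_group m_assoc)
  finally have "l (inv (conj_by z x) \<otimes> w) = l (inv x \<otimes> w)"
    using z(1) x w_closed by (simp add: l_conj)
  moreover have "l (conj_by z x) = l x" using z(1) x by (simp add: conj_by_def l_conj)
  moreover have "conj_by z x \<in> carrier G" using z(1) x by (simp add: conj_by_def)
  ultimately show ?thesis using x unfolding D_def le_def by simp
qed

lemma weq_conj_by:
  assumes z: "z \<in> carrier G" "conj_by z w = w" and "weq xs ys"
  shows "weq (map (conj_by z) xs) (map (conj_by z) ys)"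
  using assms(3)
proof (induction rule: weq.induct)
  case (weq_refl xs)
  then show ?case using conj_by_D[OF z] by (intro weq.weq_refl) auto
next
  case (weq_base a b p q)
  have pq: "set (map (conj_by z) p) \<subseteq> D" "set (map (conj_by z) q) \<subseteq> D"
    using weq_base conj_by_D[OF z] by auto
  have "base (map (conj_by z) a) (map (conj_by z) b)"
  proof (cases "a = [\<one>] \<and> b = []")
    case True
    then show ?thesis using z(1) by (simp add: base_def conj_by_def)
  next
    case False
    then obtain u v where uv: "reduced u v" "a = [u, v]" "b = [u \<otimes> v]"
      using weq_base(1) by (auto simp: base_def)
    then have D: "u \<in> D" "v \<in> D" "u \<otimes> v \<in> D" "l u + l v = l (u \<otimes> v)" by (auto simp: reduced_def)
    have lz: "l (conj_by z x) = l x" if "x \<in> D" for x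
      using that z(1) by (simp add: conj_by_def l_conj)
    have m: "conj_by z (u \<otimes> v) = conj_by z u \<otimes> conj_by z v" using conj_by_mult z(1) D by simp
    have "reduced (conj_by z u) (conj_by z v)"
      using D lz conj_by_D[OF z] unfolding reduced_def m[symmetric] by simp
    then show ?thesis using uv m by (auto simp: base_def)
  qed
  then show ?case using weq.weq_base[OF _ pq] by simp
qed (auto intro: weq.weq_sym weq.weq_trans)

abbreviation \<psi> where "\<psi> \<equiv> conj_by (inv w)"

lemma conj_by_w: "conj_by w w = w" "\<psi> w = w"
  using w_closed by (simp_all add: conj_by_def m_assoc)

lemma conj_by_inverse: "x \<in> D \<Longrightarrow> conj_by w (\<psi> x) = x" "x \<in> D \<Longrightarrow> \<psi> (conj_by w x) = x"
  using w_closed by (simp_all add: conj_by_def m_assoc)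

lemma \<psi>_D: "set xs \<subseteq> D \<Longrightarrow> set (map \<psi> xs) \<subseteq> D"
  and conj_by_w_D: "set xs \<subseteq> D \<Longrightarrow> set (map (conj_by w) xs) \<subseteq> D"
  using conj_by_D w_closed conj_by_w by auto

lemma map_conj_by_inverse:
  "set xs \<subseteq> D \<Longrightarrow> map (conj_by w) (map \<psi> xs) = xs"
  "set xs \<subseteq> D \<Longrightarrow> map \<psi> (map (conj_by w) xs) = xs"
  by (induction xs) (simp_all add: conj_by_inverse)

lemma weq_\<psi>: "weq xs ys \<Longrightarrow> weq (map \<psi> xs) (map \<psi> ys)"
  and weq_conj_by_w: "weq xs ys \<Longrightarrow> weq (map (conj_by w) xs) (map (conj_by w) ys)"
  using weq_conj_by w_closed conj_by_w by auto

lemma D_le: "x \<in> D \<Longrightarrow> le x w"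
  unfolding D_def by simp

lemma reduced_right_complement: "x \<in> D \<Longrightarrow> reduced x (inv x \<otimes> w)"
  using reduced_quotient[of x w] D_le by simp

lemma w_left_complement:
  assumes "x \<in> D"
  shows "weq [w] [x, inv x \<otimes> w]"
  using weq_sym[OF weq_reduced[OF reduced_right_complement[OF assms]]] assms w_closed by simp

lemma w_right_complement:
  assumes "x \<in> D"
  shows "w \<otimes> inv x \<in> D" "weq [w] [w \<otimes> inv x, x]"
proof -
  have xG: "x \<in> carrier G" using assms by simp
  have "w \<otimes> inv x = x \<otimes> (inv x \<otimes> w) \<otimes> inv x" using xG w_closed by (simp add: m_assoc)
  then have l: "l (w \<otimes> inv x) = l (inv x \<otimes> w)" using l_conj[of x "inv x \<otimes> w"] xG w_closed by simp
  have "le x w" using assms by (rule D_le)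
  then have l': "l (w \<otimes> inv x) + l x = l w" using l by (simp add: le_def)
  have "inv (w \<otimes> inv x) \<otimes> w = x" using xG w_closed by (simp add: inv_mult_group m_assoc)
  then show wx: "w \<otimes> inv x \<in> D"
    unfolding D_def using xG w_closed l' by (simp add: le_def)
  have "reduced (w \<otimes> inv x) x"
    using wx assms l' xG w_closed by (simp add: reduced_def m_assoc)
  then show "weq [w] [w \<otimes> inv x, x]"
    using weq_sym[OF weq_reduced] xG w_closed by (fastforce simp: m_assoc)
qed

text \<open>With c = \<open>inv x \<otimes> w\<close>, both x c and c (\<open>\<psi> x\<close>) are
  factorisations of \<open>w\<close>. Inserting the second into x w and contracting the first moves
  \<open>w\<close> to the left.\<close>

lemma weq_w_single:
  assumes "x \<in> D"
  shows "weq [x, w] [w, \<psi> x]"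
proof -
  have xG: "x \<in> carrier G" using assms by simp
  have c: "inv x \<otimes> w \<in> D" using reduced_right_complement[OF assms] by (simp add: reduced_def)
  have "inv (inv x \<otimes> w) \<otimes> w = \<psi> x"
    using xG w_closed by (simp add: conj_by_def inv_mult_group m_assoc)
  then have "weq ([x] @ [w]) ([x] @ [inv x \<otimes> w, \<psi> x])"
    using w_left_complement[OF c] assms by (intro weq_prepend) simp_all
  moreover have "weq ([x, inv x \<otimes> w] @ [\<psi> x]) ([w] @ [\<psi> x])"
    using \<psi>_D[of "[x]"] assms by (intro weq_postpend weq_sym[OF w_left_complement]) simp_all
  ultimately show ?thesis by (auto intro: weq_trans)
qed

lemma weq_w_commute:
  assumes "set xs \<subseteq> D"
  shows "weq (xs @ [w]) (w # map \<psi> xs)"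
  using assms
proof (induction xs)
  case Nil
  then show ?case by (simp add: weq_refl)
next
  case (Cons x xs)
  have "weq ([x] @ xs @ [w]) ([x] @ w # map \<psi> xs)" using Cons by (intro weq_prepend) auto
  moreover have "weq ([x, w] @ map \<psi> xs) ([w, \<psi> x] @ map \<psi> xs)"
    using Cons.prems by (intro weq_postpend weq_w_single \<psi>_D) auto
  ultimately show ?case by (auto intro: weq_trans)
qed

text \<open>Quasi-centrality moves \<open>w\<close> to the front, where left cancellation applies;
  conjugation by \<open>w\<close> then undoes \<open>\<psi>\<close>.\<close>

lemma weq_w_right_cancel:
  assumes "weq (xs @ [w]) (ys @ [w])"
  shows "weq xs ys"
proof -
  have D: "set xs \<subseteq> D" "set ys \<subseteq> D" using weq_D[OF assms] by auto
  have "weq (w # map \<psi> xs) (w # map \<psi> ys)"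
    by (rule weq_trans[OF weq_sym[OF weq_w_commute[OF D(1)]] weq_trans[OF assms weq_w_commute[OF D(2)]]])
  then have "weq (map \<psi> xs) (map \<psi> ys)" using weq_left_cancel[of "[w]"] by simp
  then show ?thesis using weq_conj_by_w[of "map \<psi> xs"] map_conj_by_inverse(1) D by metis
qed

lemma weq_power_right_cancel:
  "weq (xs @ replicate k w) (ys @ replicate k w) \<Longrightarrow> weq xs ys"
proof (induction k)
  case (Suc k)
  have "replicate (Suc k) w = replicate k w @ [w]" by (simp add: replicate_append_same)
  then show ?case using Suc weq_w_right_cancel[of "xs @ replicate k w" "ys @ replicate k w"]
    by (simp del: replicate_Suc)
qed simp

lemma weq_power_divides:
  assumes "set us \<subseteq> D"
  shows "\<exists>k ys. set ys \<subseteq> D \<and> weq (replicate k w) (ys @ us)"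
  using assms
proof (induction us)
  case Nil
  then show ?case by (intro exI[of _ 0] exI[of _ "[]"]) (simp add: weq_refl)
next
  case (Cons x us)
  then obtain k ys where ky: "set ys \<subseteq> D" "weq (replicate k w) (ys @ us)" by auto
  have x: "x \<in> D" "set us \<subseteq> D" using Cons.prems by auto
  \<comment> \<open>Chosen so that moving \<open>w\<close> from the right of \<open>zs\<close> to
    its left restores \<open>ys\<close>. One more \<open>w\<close> is spent on the letter
    \<open>x\<close>, as \<open>w \<otimes> inv x\<close> followed by \<open>x\<close>.\<close>
  define zs where "zs = map (conj_by w) ys"
  have zD: "set zs \<subseteq> D" using conj_by_w_D ky by (simp add: zs_def)
  have "map \<psi> zs = ys" using map_conj_by_inverse(2) ky by (simp add: zs_def)
  then have "weq (zs @ [w]) (w # ys)" using weq_w_commute[OF zD] by simp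
  then have "weq (w # ys @ us) (zs @ w # us)"
    using weq_postpend[OF weq_sym x(2), of "zs @ [w]" "w # ys"] by simp
  moreover have "weq (w # replicate k w) (w # ys @ us)"
    using weq_prepend[OF ky(2), of "[w]"] by simp
  moreover have "weq (zs @ w # us) (zs @ (w \<otimes> inv x) # x # us)"
    using weq_context[OF w_right_complement(2)[OF x(1)] zD x(2)] by simp
  ultimately have "weq (w # replicate k w) (zs @ (w \<otimes> inv x) # x # us)"
    by (meson weq_trans)
  then show ?case using zD w_right_complement(1)[OF x(1)]
    by (intro exI[of _ "Suc k"] exI[of _ "zs @ [w \<otimes> inv x]"]) auto
qed

section \<open>Embedding the monoid in the interval group\<close>

definition rels :: "('a gword \<times> 'a gword) set" where
  "rels = {([(u, True), (v, True)], [(x, True)]) | u v x.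
    u \<in> D \<and> v \<in> D \<and> x \<in> D \<and> u \<otimes> v = x \<and> l u + l v = l x}"

text \<open>
  The pair \<open>(as, n)\<close> stands for the fraction \<open>as w\<^sup>-\<^sup>n\<close>, using \<open>x\<^sup>-\<^sup>1 = (x\<^sup>-\<^sup>1 w) w\<^sup>-\<^sup>1\<close> and
  \<open>w\<^sup>-\<^sup>1 as = \<psi>(as) w\<^sup>-\<^sup>1\<close>.
\<close>

fun letter_action :: "'a \<times> bool \<Rightarrow> 'a list \<times> nat \<Rightarrow> 'a list \<times> nat" where
  "letter_action (x, True) (as, n) = (x # as, n)"
| "letter_action (x, False) (as, n) = ((inv x \<otimes> w) # map \<psi> as, Suc n)"

text \<open>Cross multiplication as for commutative denominators, which is possible because all
  denominators are powers of one element.\<close>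

definition fraction_eq :: "'a list \<times> nat \<Rightarrow> 'a list \<times> nat \<Rightarrow> bool" where
  "fraction_eq p q \<longleftrightarrow> weq (fst p @ replicate (snd q) w) (fst q @ replicate (snd p) w)"

lemma fraction_eq_refl: "set (fst p) \<subseteq> D \<Longrightarrow> fraction_eq p p"
  by (auto simp: fraction_eq_def intro!: weq_refl)

lemma fraction_eq_sym: "fraction_eq p q \<Longrightarrow> fraction_eq q p"
  by (auto simp: fraction_eq_def intro: weq_sym)

lemma powers_D: "set (replicate n w) \<subseteq> D"
  by auto

text \<open>Multiply by the outer denominators and cancel the middle one; only right cancellation of
  powers of \<open>w\<close> is needed.\<close>

lemma fraction_eq_trans:
  assumes "fraction_eq p q" "fraction_eq q r"
  shows "fraction_eq p r"
proof -
  obtain a i b j c k where pqr: "p = (a, i)" "q = (b, j)" "r = (c, k)" by (metis prod.exhaust)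
  let ?w = "\<lambda>n. replicate n w"
  have 1: "weq (a @ ?w j) (b @ ?w i)" "weq (b @ ?w k) (c @ ?w j)"
    using assms by (auto simp: fraction_eq_def pqr)
  have comm: "?w m @ ?w n = ?w n @ ?w m" for m n
    by (simp add: add.commute flip: replicate_add)
  have "weq ((a @ ?w j) @ ?w k) ((b @ ?w i) @ ?w k)" by (rule weq_postpend[OF 1(1) powers_D])
  moreover have "weq ((b @ ?w k) @ ?w i) ((c @ ?w j) @ ?w i)" by (rule weq_postpend[OF 1(2) powers_D])
  ultimately have "weq ((a @ ?w k) @ ?w j) ((c @ ?w i) @ ?w j)"
    using comm[of j k] comm[of i k] comm[of j i] by (auto intro: weq_trans)
  then show ?thesis using weq_power_right_cancel by (simp add: fraction_eq_def pqr)
qed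

lemma letter_action_D:
  "\<lbrakk>fst a \<in> D; set (fst p) \<subseteq> D\<rbrakk> \<Longrightarrow> set (fst (letter_action a p)) \<subseteq> D"
  by (induction a p rule: letter_action.induct)
     (use reduced_right_complement \<psi>_D in \<open>auto simp: reduced_def\<close>)

lemma word_action_D:
  "\<lbrakk>u \<in> gwords D; set (fst p) \<subseteq> D\<rbrakk> \<Longrightarrow> set (fst (foldr letter_action u p)) \<subseteq> D"
  by (induction u) (simp_all add: letter_action_D)

lemma letter_action_cong:
  assumes "fst a \<in> D" "fraction_eq p q"
  shows "fraction_eq (letter_action a p) (letter_action a q)"
proof -
  obtain x b as i bs j where [simp]: "a = (x, b)" "p = (as, i)" "q = (bs, j)" by (metis prod.exhaust)
  have x: "x \<in> D" using assms by simp
  have eq: "weq (as @ replicate j w) (bs @ replicate i w)" using assms by (simp add: fraction_eq_def)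
  show ?thesis
  proof (cases b)
    case True
    then show ?thesis using weq_prepend[OF eq, of "[x]"] x by (simp add: fraction_eq_def)
  next
    case False
    have "weq (map \<psi> as @ replicate j w) (map \<psi> bs @ replicate i w)"
      using weq_\<psi>[OF eq] by (simp add: conj_by_w)
    then have "weq ([inv x \<otimes> w] @ (map \<psi> as @ replicate j w) @ [w])
        ([inv x \<otimes> w] @ (map \<psi> bs @ replicate i w) @ [w])"
      using reduced_right_complement[OF x] by (intro weq_context) (auto simp: reduced_def)
    then show ?thesis using False
      by (simp add: fraction_eq_def replicate_append_same)
  qed
qed

lemma word_action_cong:
  "\<lbrakk>u \<in> gwords D; fraction_eq p q\<rbrakk> \<Longrightarrow> fraction_eq (foldr letter_action u p) (foldr letter_action u q)"
  by (induction u) (simp_all add: letter_action_cong)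

text \<open>Both orders produce a factorisation of \<open>w\<close>: \<open>x\<close> followed by c
  = \<open>inv x \<otimes> w\<close>, or c followed by \<open>\<psi> x\<close>. The resulting
  \<open>w\<close> then moves to the right and cancels the extra denominator.\<close>

lemma letter_action_cancel:
  assumes x: "x \<in> D" and p: "set (fst p) \<subseteq> D"
  shows "fraction_eq (letter_action (x, b) (letter_action (x, \<not> b) p)) p"
proof -
  obtain as n where [simp]: "p = (as, n)" by (metis prod.exhaust)
  have as: "set as \<subseteq> D" "set (map \<psi> as) \<subseteq> D" using p \<psi>_D by auto
  have "weq ([x, inv x \<otimes> w] @ map \<psi> as) ([w] @ map \<psi> as)"
    using x as by (intro weq_postpend weq_sym[OF w_left_complement])
  moreover have xG: "x \<in> carrier G" using x by simp
  have c: "inv x \<otimes> w \<in> D" using reduced_right_complement[OF x] by (simp add: reduced_def)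
  have "inv (inv x \<otimes> w) \<otimes> w = \<psi> x"
    using xG w_closed by (simp add: conj_by_def inv_mult_group m_assoc)
  then have "weq ([inv x \<otimes> w, \<psi> x] @ map \<psi> as) ([w] @ map \<psi> as)"
    using weq_postpend[OF weq_sym[OF w_left_complement[OF c]] as(2)] by simp
  ultimately have eq: "weq (fst (letter_action (x, b) (letter_action (x, \<not> b) p))) (w # map \<psi> as)"
    by (cases b) auto
  have "weq (fst (letter_action (x, b) (letter_action (x, \<not> b) p))) (as @ [w])"
    using weq_trans[OF eq weq_sym[OF weq_w_commute[OF as(1)]]] .
  then have "weq (fst (letter_action (x, b) (letter_action (x, \<not> b) p)) @ replicate n w)
      ((as @ [w]) @ replicate n w)"
    by (rule weq_postpend) (rule powers_D)
  then show ?thesis by (cases b) (auto simp: fraction_eq_def)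
qed

text \<open>Letting words act on fractions avoids defining a product of fractions: only the
  relations have to be checked.\<close>

lemma pres_cong_fraction_eq:
  assumes "(u, v) \<in> pres_cong D rels" "set (fst p) \<subseteq> D"
  shows "fraction_eq (foldr letter_action u p) (foldr letter_action v p)"
  using assms
proof (induction rule: pres_cong.induct)
  case (refl u)
  then show ?case using fraction_eq_refl word_action_D by blast
next
  case (sym u v)
  then show ?case using fraction_eq_sym by blast
next
  case (trans u v x)
  then show ?case using fraction_eq_trans by blast
next
  case (cancel r q x b)
  let ?q = "foldr letter_action q p"
  have "fraction_eq (letter_action (x, b) (letter_action (x, \<not> b) ?q)) ?q"
    using cancel by (intro letter_action_cancel word_action_D)
  then have "fraction_eq (foldr letter_action r (letter_action (x, b) (letter_action (x, \<not> b) ?q)))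
      (foldr letter_action r ?q)"
    using cancel word_action_cong by blast
  then show ?case by simp
next
  case (relation r q lh rh)
  let ?q = "foldr letter_action q p"
  obtain u v where uv: "lh = [(u, True), (v, True)]" "rh = [(u \<otimes> v, True)]" "reduced u v"
    using relation by (auto simp: rels_def reduced_def)
  obtain as n where q: "?q = (as, n)" by (metis prod.exhaust)
  have "set (fst ?q) \<subseteq> D" using relation by (intro word_action_D)
  then have "set (as @ replicate n w) \<subseteq> D" using q by auto
  then have "weq ([u, v] @ as @ replicate n w) ([u \<otimes> v] @ as @ replicate n w)"
    using weq_postpend[OF weq_reduced[OF uv(3)]] by blast
  then have "fraction_eq (foldr letter_action lh ?q) (foldr letter_action rh ?q)"
    by (simp add: q uv fraction_eq_def)
  then have "fraction_eq (foldr letter_action r (foldr letter_action lh ?q))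
      (foldr letter_action r (foldr letter_action rh ?q))"
    using relation word_action_cong by blast
  then show ?case by simp
qed

abbreviation F where "F \<equiv> presented_group D rels"

definition embed :: "'a list \<Rightarrow> 'a gword set" where
  "embed us = pres_class D rels (map (\<lambda>x. (x, True)) us)"

lemma word_action_positive:
  "foldr letter_action (map (\<lambda>x. (x, True)) us) ([], 0) = (us, 0)"
  by (induction us) simp_all

lemma pres_cong_reduced:
  "reduced u v \<Longrightarrow> ([(u, True), (v, True)], [(u \<otimes> v, True)]) \<in> pres_cong D rels"
  using pres_cong.relation[of "[]" D "[]" "[(u, True), (v, True)]" "[(u \<otimes> v, True)]" rels]
  by (simp add: reduced_def rels_def)

lemma pres_cong_one: "([(\<one>, True)], []) \<in> pres_cong D rels"
proof -
  let ?R = "pres_cong D rels"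
  have "reduced \<one> \<one>" by (simp add: reduced_def)
  then have "([(\<one>, True), (\<one>, True)], [(\<one>, True)]) \<in> ?R" using pres_cong_reduced[of \<one> \<one>] by simp
  then have 1: "([(\<one>, True), (\<one>, True), (\<one>, False)], [(\<one>, True), (\<one>, False)]) \<in> ?R"
    using pres_cong_append_context[of _ _ D rels "[]" "[(\<one>, False)]"] by fastforce
  have 2: "([(\<one>, True), (\<one>, False)], []) \<in> ?R"
    using pres_cong.cancel[of "[]" D "[]" \<one> True rels] by simp
  then have "([(\<one>, True), (\<one>, True), (\<one>, False)], [(\<one>, True)]) \<in> ?R"
    using pres_cong_append_context[OF 2, of "[(\<one>, True)]" "[]"] by simp
  then show ?thesis using 1 2 pres_cong.sym pres_cong.trans by metis
qed

lemma weq_pres_cong: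
  "weq us vs \<Longrightarrow> (map (\<lambda>x. (x, True)) us, map (\<lambda>x. (x, True)) vs) \<in> pres_cong D rels"
proof (induction rule: weq.induct)
  case (weq_refl xs)
  then show ?case by (intro pres_cong.refl) simp
next
  case (weq_base a b p q)
  have "(map (\<lambda>x. (x, True)) a, map (\<lambda>x. (x, True)) b) \<in> pres_cong D rels"
    using weq_base(1) pres_cong_reduced pres_cong_one by (auto simp: base_def)
  from pres_cong_append_context[OF this, of "map (\<lambda>x. (x, True)) p" "map (\<lambda>x. (x, True)) q"]
  show ?case using weq_base by simp
qed (auto intro: pres_cong.sym pres_cong.trans)

text \<open>A positive word is recovered up to \<open>weq\<close> from its action on the trivial
  fraction \<open>([], 0)\<close>.\<close>

lemma embed_eq_iff:
  assumes "set us \<subseteq> D" "set vs \<subseteq> D"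
  shows "embed us = embed vs \<longleftrightarrow> weq us vs"
proof
  assume "embed us = embed vs"
  then have "(map (\<lambda>x. (x, True)) us, map (\<lambda>x. (x, True)) vs) \<in> pres_cong D rels"
    using assms by (simp add: embed_def pres_class_eq_iff)
  then have "fraction_eq (us, 0) (vs, 0)"
    using pres_cong_fraction_eq[of _ _ "([], 0)"] word_action_positive by fastforce
  then show "weq us vs" by (simp add: fraction_eq_def)
next
  assume "weq us vs"
  then show "embed us = embed vs"
    using weq_pres_cong assms by (simp add: embed_def pres_class_eq_iff)
qed

lemma embed_mult:
  "\<lbrakk>set us \<subseteq> D; set vs \<subseteq> D\<rbrakk> \<Longrightarrow> embed us \<otimes>\<^bsub>F\<^esub> embed vs = embed (us @ vs)"
  by (simp add: embed_def pres_class_mult)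

lemma embed_Nil: "embed [] = \<one>\<^bsub>F\<^esub>"
  by (simp add: embed_def presented_group_simps)

lemma embed_F: "set us \<subseteq> D \<Longrightarrow> embed us \<in> carrier F"
  by (simp add: embed_def)

text \<open>As a submonoid of a group, \<open>M\<close> inherits cancellation on both sides; that
  equality in it is described by \<open>weq\<close> is the content of the embedding.\<close>

definition M :: "'a gword set monoid" where
  "M = \<lparr>carrier = embed ` {us. set us \<subseteq> D}, mult = mult F, one = one F\<rparr>"

lemma M_simps:
  "carrier M = embed ` {us. set us \<subseteq> D}" "a \<otimes>\<^bsub>M\<^esub> b = a \<otimes>\<^bsub>F\<^esub> b" "\<one>\<^bsub>M\<^esub> = \<one>\<^bsub>F\<^esub>"
  by (simp_all add: M_def)

lemma embed_M: "set us \<subseteq> D \<Longrightarrow> embed us \<in> carrier M"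
  by (auto simp: M_simps)

lemma M_embed:
  assumes "a \<in> carrier M"
  obtains us where "set us \<subseteq> D" "a = embed us"
  using assms by (auto simp: M_simps)

lemma M_mult: "\<lbrakk>set us \<subseteq> D; set vs \<subseteq> D\<rbrakk> \<Longrightarrow> embed us \<otimes>\<^bsub>M\<^esub> embed vs = embed (us @ vs)"
  by (simp add: M_simps embed_mult)

lemma M_subset_F: "carrier M \<subseteq> carrier F"
  using embed_F by (auto simp: M_simps)

definition mlen :: "'a gword set \<Rightarrow> nat" where
  "mlen a = weight (SOME us. set us \<subseteq> D \<and> embed us = a)"

lemma mlen_embed: "set us \<subseteq> D \<Longrightarrow> mlen (embed us) = weight us"
  unfolding mlen_def
  by (rule someI2[where P = "\<lambda>vs. set vs \<subseteq> D \<and> embed vs = embed us"])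
     (auto simp: embed_eq_iff intro: weq_weight)

lemma graded_monoid_M: "graded_monoid M mlen"
proof -
  interpret F: group F by (rule group_presented_group)
  show ?thesis
  proof unfold_locales
    show "x \<otimes>\<^bsub>M\<^esub> y \<in> carrier M" if "x \<in> carrier M" "y \<in> carrier M" for x y
      using that by (elim M_embed) (simp add: M_mult embed_M)
    show "\<one>\<^bsub>M\<^esub> \<in> carrier M"
      using embed_M[of "[]"] embed_Nil by (simp add: M_simps)
    show "a = \<one>\<^bsub>M\<^esub>" if a: "a \<in> carrier M" "mlen a = 0" for a
    proof -
      obtain us where us: "set us \<subseteq> D" "a = embed us" using M_embed[OF a(1)] .
      then have "weq us []" using weight_0 mlen_embed a(2) by simp
      then have "embed us = embed []" using embed_eq_iff us by simp
      then show ?thesis using us embed_Nil by (simp add: M_simps)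
    qed
    show "mlen (a \<otimes>\<^bsub>M\<^esub> b) = mlen a + mlen b" if "a \<in> carrier M" "b \<in> carrier M" for a b
      using that by (elim M_embed) (simp add: M_mult mlen_embed weight_def)
  qed (use M_subset_F in \<open>auto simp: M_simps(2,3) F.m_assoc subset_iff\<close>)
qed

lemma M_divides:
  assumes "set us \<subseteq> D" "set vs \<subseteq> D"
  shows "embed us divides\<^bsub>M\<^esub> embed vs \<longleftrightarrow> (\<exists>cs. set cs \<subseteq> D \<and> weq vs (us @ cs))"
proof
  assume "embed us divides\<^bsub>M\<^esub> embed vs"
  then obtain c where "c \<in> carrier M" "embed vs = embed us \<otimes>\<^bsub>M\<^esub> c" by (auto simp: factor_def)
  then show "\<exists>cs. set cs \<subseteq> D \<and> weq vs (us @ cs)"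
    using assms by (auto elim!: M_embed simp: M_mult embed_eq_iff)
next
  assume "\<exists>cs. set cs \<subseteq> D \<and> weq vs (us @ cs)"
  then obtain cs where cs: "set cs \<subseteq> D" "weq vs (us @ cs)" by blast
  then have "embed vs = embed us \<otimes>\<^bsub>M\<^esub> embed cs"
    using assms embed_eq_iff[of vs "us @ cs"] by (simp add: M_mult)
  then show "embed us divides\<^bsub>M\<^esub> embed vs" using embed_M[OF cs(1)] by (rule dividesI')
qed

lemma M_left_lcm:
  assumes "a \<in> carrier M" "b \<in> carrier M"
  shows "\<exists>d\<in>carrier M. d lcmof\<^bsub>M\<^esub> a b"
proof -
  obtain us where us: "set us \<subseteq> D" "a = embed us" using M_embed[OF assms(1)] .
  obtain vs where vs: "set vs \<subseteq> D" "b = embed vs" using M_embed[OF assms(2)] .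
  let ?d = "us @ res us vs"
  have d: "set ?d \<subseteq> D" using us vs res_D by simp
  have "embed ?d lcmof\<^bsub>M\<^esub> a b"
    unfolding islcm_def
  proof (intro conjI ballI impI)
    show "a divides\<^bsub>M\<^esub> embed ?d"
      unfolding us(2) using M_divides[OF us(1) d] weq_refl[OF d] res_D[OF us(1) vs(1)] by blast
    show "b divides\<^bsub>M\<^esub> embed ?d"
      unfolding vs(2) using M_divides[OF vs(1) d] weq_residual_commute[OF us(1) vs(1)]
        res_D[OF vs(1) us(1)] by blast
    fix z assume z: "z \<in> carrier M" "a divides\<^bsub>M\<^esub> z \<and> b divides\<^bsub>M\<^esub> z"
    obtain zs where zs: "set zs \<subseteq> D" "z = embed zs" using M_embed[OF z(1)] .
    obtain as bs where "weq zs (us @ as)" "weq zs (vs @ bs)"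
      using z(2) us vs zs M_divides by metis
    then obtain cs where "set cs \<subseteq> D" "weq zs (?d @ cs)" using weq_common_multiple by force
    then show "embed ?d divides\<^bsub>M\<^esub> z" unfolding zs(2) using M_divides[OF d zs(1)] by blast
  qed
  then show ?thesis using embed_M[OF d] by blast
qed

lemma M_power: "embed [w] [^]\<^bsub>M\<^esub> (k::nat) = embed (replicate k w)"
proof -
  interpret M: graded_monoid M mlen by (rule graded_monoid_M)
  show ?thesis
  proof (induction k)
    case 0
    then show ?case by (simp add: embed_Nil M_simps)
  next
    case (Suc k)
    then show ?case using M_mult[of "replicate k w" "[w]"] powers_D by (simp add: replicate_append_same)
  qed
qed

lemma embed_w_commute:
  assumes "set us \<subseteq> D"
  shows "embed us \<otimes>\<^bsub>M\<^esub> embed [w] = embed [w] \<otimes>\<^bsub>M\<^esub> embed (map \<psi> us)"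
  using assms weq_w_commute[OF assms] \<psi>_D[OF assms] by (simp add: M_mult embed_eq_iff)

text \<open>From w = a c and c' w = w c follows c' a c = w c, and cancelling c gives c' a = w. The
  converse shifts the cofactor past \<open>w\<close> in the other direction.\<close>

lemma M_divisors_w:
  assumes "a \<in> carrier M"
  shows "a divides\<^bsub>M\<^esub> embed [w] \<longleftrightarrow> a divides\<^bsub>opposite M\<^esub> embed [w]"
proof -
  interpret M: graded_monoid M mlen by (rule graded_monoid_M)
  let ?w = "embed [w]"
  have w: "?w \<in> carrier M" using embed_M[of "[w]"] by simp
  show ?thesis
  proof
    assume "a divides\<^bsub>M\<^esub> ?w"
    then obtain c where c: "c \<in> carrier M" "?w = a \<otimes>\<^bsub>M\<^esub> c" by (auto simp: factor_def)
    obtain cs where cs: "set cs \<subseteq> D" "c = embed cs" using M_embed[OF c(1)] .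
    define c' where "c' = embed (map (conj_by w) cs)"
    have c': "c' \<in> carrier M" unfolding c'_def by (rule embed_M) (rule conj_by_w_D[OF cs(1)])
    have "c' \<otimes>\<^bsub>M\<^esub> ?w = ?w \<otimes>\<^bsub>M\<^esub> c"
      using embed_w_commute[OF conj_by_w_D[OF cs(1)]] map_conj_by_inverse(2)[OF cs(1)] cs(2)
      by (simp add: c'_def)
    then have "(c' \<otimes>\<^bsub>M\<^esub> a) \<otimes>\<^bsub>M\<^esub> c = ?w \<otimes>\<^bsub>M\<^esub> c" using c' c assms by (simp add: M.m_assoc)
    then have "c' \<otimes>\<^bsub>M\<^esub> a = ?w" using M.r_cancel c' c w assms by (metis M.m_closed)
    then show "a divides\<^bsub>opposite M\<^esub> ?w" using c' by (auto simp: M.divides_opposite)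
  next
    assume "a divides\<^bsub>opposite M\<^esub> ?w"
    then obtain c where c: "c \<in> carrier M" "?w = c \<otimes>\<^bsub>M\<^esub> a" by (auto simp: M.divides_opposite)
    obtain cs where cs: "set cs \<subseteq> D" "c = embed cs" using M_embed[OF c(1)] .
    define c' where "c' = embed (map \<psi> cs)"
    have c': "c' \<in> carrier M" unfolding c'_def by (rule embed_M) (rule \<psi>_D[OF cs(1)])
    have "c \<otimes>\<^bsub>M\<^esub> ?w = ?w \<otimes>\<^bsub>M\<^esub> c'" using embed_w_commute[OF cs(1)] cs(2) by (simp add: c'_def)
    also have "\<dots> = c \<otimes>\<^bsub>M\<^esub> (a \<otimes>\<^bsub>M\<^esub> c')" using c' c assms by (simp add: M.m_assoc)
    finally have "?w = a \<otimes>\<^bsub>M\<^esub> c'" using M.l_cancel c' c(1) w assms by (metis M.m_closed)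
    then show "a divides\<^bsub>M\<^esub> ?w" using c' by (auto simp: factor_def)
  qed
qed

text \<open>Grids give left least common multiples; left greatest common divisors, right least
  common multiples and right greatest common divisors follow in this order, each from the one
  before.\<close>

lemma quasi_garside_monoid_M: "quasi_garside_monoid M (embed [w])"
proof -
  interpret M: graded_monoid M mlen by (rule graded_monoid_M)
  interpret O: graded_monoid "opposite M" mlen by (rule M.graded_monoid_opposite)
  have w: "embed [w] \<in> carrier M" using embed_M[of "[w]"] by simp
  have power: "\<exists>k::nat. \<exists>y\<in>carrier M. embed [w] [^]\<^bsub>M\<^esub> k = y \<otimes>\<^bsub>M\<^esub> a" if a: "a \<in> carrier M" for a
  proof -
    obtain us where us: "set us \<subseteq> D" "a = embed us" using M_embed[OF a] .
    obtain k ys where "set ys \<subseteq> D" "weq (replicate k w) (ys @ us)"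
      using weq_power_divides[OF us(1)] by blast
    then have "embed [w] [^]\<^bsub>M\<^esub> k = embed ys \<otimes>\<^bsub>M\<^esub> a" "embed ys \<in> carrier M"
      using us embed_eq_iff[of "replicate k w" "ys @ us"] powers_D
      by (auto simp: M_power M_mult embed_M)
    then show ?thesis by blast
  qed
  have gcd: "\<exists>d\<in>carrier M. d gcdof\<^bsub>M\<^esub> a b" if "a \<in> carrier M" "b \<in> carrier M" for a b
    using M.gcd_exists[OF M_left_lcm that] .
  have rlcm: "\<exists>d\<in>carrier M. d lcmof\<^bsub>opposite M\<^esub> a b" if "a \<in> carrier M" "b \<in> carrier M" for a b
    using M.right_lcm_exists[OF gcd w power that] .
  have rgcd: "\<exists>d\<in>carrier M. d gcdof\<^bsub>opposite M\<^esub> a b" if "a \<in> carrier M" "b \<in> carrier M" for a b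
    using O.gcd_exists[of a b] rlcm that by simp
  show ?thesis
  proof (unfold_locales)
    show "embed [w] \<in> carrier M" by (rule w)
    show "\<exists>len :: 'a gword set \<Rightarrow> nat.
        (\<forall>a\<in>carrier M. \<forall>b\<in>carrier M. len a + len b \<le> len (a \<otimes>\<^bsub>M\<^esub> b)) \<and>
        (\<forall>a\<in>carrier M. a \<noteq> \<one>\<^bsub>M\<^esub> \<longrightarrow> len a \<noteq> 0)"
      using M.len_mult M.len_eq_0 by (intro exI[of _ mlen]) auto
    show "{a \<in> carrier M. a divides\<^bsub>M\<^esub> embed [w]} =
        {a \<in> carrier M. a divides\<^bsub>opposite M\<^esub> embed [w]}"
      using M_divisors_w by blast
    fix H assume H: "submonoid H M" "{a \<in> carrier M. a divides\<^bsub>M\<^esub> embed [w]} \<subseteq> H"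
    interpret H: submonoid H M by (rule H(1))
    have "embed us \<in> H" if "set us \<subseteq> D" for us
      using that
    proof (induction us)
      case Nil
      then show ?case using H.one_closed by (simp add: embed_Nil M_simps)
    next
      case (Cons x us)
      have x: "x \<in> D" using Cons by simp
      have "inv x \<otimes> w \<in> D" using reduced_right_complement[OF x] by (simp add: reduced_def)
      then have "embed [x] divides\<^bsub>M\<^esub> embed [w]"
        using M_divides[of "[x]" "[w]"] w_left_complement[OF x] x
        by (auto intro: exI[of _ "[inv x \<otimes> w]"])
      then have "embed [x] \<in> H" using H(2) embed_M[of "[x]"] x by auto
      then have "embed [x] \<otimes>\<^bsub>M\<^esub> embed us \<in> H" using Cons by simp
      then show ?case using Cons.prems M_mult[of "[x]" us] by simp
    qed
    then show "H = carrier M" using H.subset by (auto simp: M_simps)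
  qed (use gcd M_left_lcm rlcm rgcd in auto)
qed

text \<open>The bookkeeping of \<open>letter_action\<close> is also valid inside the group, which
  makes every element a fraction with a power of \<open>w\<close> as denominator.\<close>

lemma word_action_fraction:
  assumes "u \<in> gwords D" "foldr letter_action u ([], 0) = (as, n)"
  shows "pres_class D rels u \<otimes>\<^bsub>F\<^esub> embed (replicate n w) = embed as"
  using assms
proof (induction u arbitrary: as n)
  case Nil
  then show ?case by (simp add: embed_Nil embed_def pres_class_mult)
next
  case (Cons a u)
  interpret F: group F by (rule group_presented_group)
  obtain x b where a: "a = (x, b)" by (metis prod.exhaust)
  have x: "x \<in> D" and u: "u \<in> gwords D" using Cons.prems a by auto
  obtain bs k where bk: "foldr letter_action u ([], 0) = (bs, k)" by (metis prod.exhaust)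
  have bs: "set bs \<subseteq> D" using word_action_D[OF u, of "([], 0)"] bk by simp
  let ?u = "pres_class D rels u" and ?a = "pres_class D rels [a]"
  have IH: "?u \<otimes>\<^bsub>F\<^esub> embed (replicate k w) = embed bs" using Cons.IH[OF u bk] .
  have uF: "?u \<in> carrier F" "?a \<in> carrier F" using u x a by simp_all
  have au: "pres_class D rels (a # u) = ?a \<otimes>\<^bsub>F\<^esub> ?u"
    using u x a pres_class_mult[of "[a]" D u] by simp
  have eF: "embed (replicate i w) \<in> carrier F" for i using embed_F powers_D by blast
  show ?case
  proof (cases b)
    case True
    then have "as = x # bs" "n = k" using Cons.prems(2) bk a by auto
    moreover have "?a = embed [x]" using a True by (simp add: embed_def)
    ultimately show ?thesis
      using IH uF eF au F.m_assoc[OF uF(2,1) eF] embed_mult[of "[x]" bs] x bs by simp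
  next
    case False
    then have as: "as = (inv x \<otimes> w) # map \<psi> bs" "n = Suc k" using Cons.prems(2) bk a by auto
    have c: "inv x \<otimes> w \<in> D" using reduced_right_complement[OF x] by (simp add: reduced_def)
    have "([(x, False), (x, True)], []) \<in> pres_cong D rels"
      using pres_cong.cancel[of "[]" D "[]" x False rels] x by simp
    then have "?a \<otimes>\<^bsub>F\<^esub> embed [x] = \<one>\<^bsub>F\<^esub>"
      using x a False
      by (simp add: embed_def pres_class_mult presented_group_simps pres_class_eq_iff)
    \<comment> \<open>Here \<open>w\<close> is moved to the front of \<open>bs\<close> and split at
      \<open>x\<close>; the result is \<open>x\<close> followed by the new numerator
      \<open>as\<close>.\<close>
    moreover have "weq (bs @ [w]) (x # (inv x \<otimes> w) # map \<psi> bs)"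
      using weq_trans[OF weq_w_commute[OF bs]] weq_postpend[OF w_left_complement[OF x] \<psi>_D[OF bs]]
      by simp
    then have "embed (bs @ [w]) = embed ([x] @ as)"
      using embed_eq_iff[of "bs @ [w]" "[x] @ as"] bs x c \<psi>_D[OF bs] as by simp
    then have "embed bs \<otimes>\<^bsub>F\<^esub> embed [w] = embed [x] \<otimes>\<^bsub>F\<^esub> embed as"
      using embed_mult bs x c \<psi>_D[OF bs] as by simp
    moreover have "embed (replicate n w) = embed (replicate k w) \<otimes>\<^bsub>F\<^esub> embed [w]"
      using embed_mult[of "replicate k w" "[w]"] powers_D as by (simp add: replicate_append_same)
    moreover have F: "embed [w] \<in> carrier F" "embed [x] \<in> carrier F" "embed as \<in> carrier F"
      using embed_F[of "[w]"] embed_F[of "[x]"] embed_F[of as] x c \<psi>_D[OF bs] as by auto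
    ultimately have "pres_class D rels (a # u) \<otimes>\<^bsub>F\<^esub> embed (replicate n w) =
        ?a \<otimes>\<^bsub>F\<^esub> (embed [x] \<otimes>\<^bsub>F\<^esub> embed as)"
      using au uF eF IH by (metis F.m_assoc F.m_closed)
    also have "\<dots> = embed as"
      using \<open>?a \<otimes>\<^bsub>F\<^esub> embed [x] = \<one>\<^bsub>F\<^esub>\<close> uF F by (simp flip: F.m_assoc)
    finally show ?thesis .
  qed
qed

lemma group_of_fractions_M: "group_of_fractions M F (\<lambda>a. a)"
  unfolding group_of_fractions_def
proof (intro conjI ballI)
  interpret F: group F by (rule group_presented_group)
  show "group F" by (rule group_presented_group)
  show "(\<lambda>a. a) \<in> hom M F" using M_subset_F by (auto simp: hom_def M_simps(2))
  show "inj_on (\<lambda>a. a) (carrier M)" by simp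
  fix g assume "g \<in> carrier F"
  then obtain u where u: "u \<in> gwords D" "g = pres_class D rels u"
    by (auto simp: presented_group_simps)
  obtain as n where an: "foldr letter_action u ([], 0) = (as, n)" by (metis prod.exhaust)
  have as: "set as \<subseteq> D" using word_action_D[OF u(1), of "([], 0)"] an by simp
  have "g \<otimes>\<^bsub>F\<^esub> embed (replicate n w) = embed as" using word_action_fraction[OF u(1) an] u by simp
  then have "g = embed as \<otimes>\<^bsub>F\<^esub> inv\<^bsub>F\<^esub> embed (replicate n w)"
    using \<open>g \<in> carrier F\<close> embed_F[OF as] embed_F[OF powers_D] by (metis F.inv_solve_right)
  then show "\<exists>a\<in>carrier M. \<exists>b\<in>carrier M. g = a \<otimes>\<^bsub>F\<^esub> inv\<^bsub>F\<^esub> b"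
    using embed_M[OF as] embed_M[OF powers_D] by blast
qed

lemma quasi_garside_group_F: "quasi_garside_group F"
  unfolding quasi_garside_group_def
  using quasi_garside_monoid_M group_of_fractions_M by blast

end

section \<open>Elements of reflection length three\<close>

context coxeter_presented
begin

lemma norm_group_reflection_length: "norm_group W (reflection_length W S)"
  by unfold_locales
     (simp_all add: reflection_length_def refl.len_mult refl.len_inv refl.len_eq_0
       refl.len_conj reflection_conj)

text \<open>Comparable elements have an obvious join, and incomparable ones with no upper bound but
  \<open>w\<close> have join \<open>w\<close>. Any other common upper bound has length 2 and forces
  both elements to have length 1, where \<open>unique\<close> applies.\<close>

lemma interval_lattice_three:
  assumes w: "w \<in> carrier W" "reflection_length W S w = 3"
  shows "interval_lattice W (reflection_length W S) w"
proof -
  interpret N: norm_group W "reflection_length W S" by (rule norm_group_reflection_length)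
  let ?l = "reflection_length W S"
  have l1: "x \<in> T" if "x \<in> carrier W" "?l x = 1" for x
    using refl.len_eq_1[of x] that by (simp add: reflection_length_def)
  have lT: "?l x \<noteq> 3" if "x \<in> T" for x
    using refl.len_gen_le[OF that] by (simp add: reflection_length_def)
  have unique: "z = z'"
    if t: "t1 \<in> carrier W" "t2 \<in> carrier W" "?l t1 = 1" "?l t2 = 1" "t1 \<noteq> t2"
    and z: "z \<in> carrier W" "N.le t1 z" "N.le t2 z" "?l z = 2" "N.le z w"
    and z': "z' \<in> carrier W" "N.le t1 z'" "N.le t2 z'" "?l z' = 2" "N.le z' w"
    for t1 t2 z z'
  proof (rule ccontr)
    assume "z \<noteq> z'"
    have q: "inv a \<otimes> b \<in> T" if "a \<in> carrier W" "b \<in> carrier W" "N.le a b" "?l b = Suc (?l a)" for a b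
      using that l1 by (simp add: N.le_def)
    have T: "t1 \<in> T" "t2 \<in> T" "inv t1 \<otimes> z \<in> T" "inv t2 \<otimes> z \<in> T" "inv t1 \<otimes> z' \<in> T" "inv t2 \<otimes> z' \<in> T"
      "inv z \<otimes> w \<in> T" "inv z' \<otimes> w \<in> T"
      using t z z' w l1[of t1] l1[of t2] q[of t1 z] q[of t2 z] q[of t1 z'] q[of t2 z'] q[of z w]
        q[of z' w] by simp_all
    have "inv t1 \<otimes> z \<noteq> inv t1 \<otimes> z'" using \<open>z \<noteq> z'\<close> t z(1) z'(1) by simp
    then have "t1 \<otimes> (inv t1 \<otimes> z) \<otimes> (inv z \<otimes> w) \<in> T"
      using two_common_factors_reflection[OF T t(5)] t(1,2) z(1) z'(1) w(1) by (simp add: m_assoc)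
    then have "w \<in> T" using t(1) z(1) w(1) by (simp add: m_assoc)
    then show False using lT w(2) by blast
  qed
  show ?thesis
  proof unfold_locales
    show "w \<in> carrier W" by (rule w(1))
    fix u v assume u: "u \<in> carrier W" "N.le u w" and v: "v \<in> carrier W" "N.le v w"
    show "\<exists>j\<in>carrier W. N.le j w \<and> N.le u j \<and> N.le v j \<and>
      (\<forall>z\<in>carrier W. N.le z w \<longrightarrow> N.le u z \<longrightarrow> N.le v z \<longrightarrow> N.le j z)"
    proof (cases "N.le u v \<or> N.le v u")
      case True
      then show ?thesis using u v N.le_refl by blast
    next
      case incomparable: False
      show ?thesis
      proof (cases "\<exists>z\<in>carrier W. N.le z w \<and> N.le u z \<and> N.le v z \<and> z \<noteq> w")
        case False
        then have "\<forall>z\<in>carrier W. N.le z w \<longrightarrow> N.le u z \<longrightarrow> N.le v z \<longrightarrow> N.le w z"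
          using N.le_refl by blast
        then show ?thesis using u v w(1) N.le_refl by blast
      next
        case True
        then obtain z where z: "z \<in> carrier W" "N.le z w" "N.le u z" "N.le v z" "z \<noteq> w" by blast
        have pos: "?l x \<noteq> 0" if "x \<in> {u, v}" for x
          using that N.l_eq_0[of x] u(1) v(1) N.le_one incomparable by auto
        have strict: "?l x < ?l y" if "x \<in> carrier W" "y \<in> carrier W" "N.le x y" "x \<noteq> y" for x y
          using N.le_l_eq[OF that(1-3)] that(4) by linarith
        have lens: "?l y = 2 \<and> ?l u = 1 \<and> ?l v = 1"
          if y: "y \<in> carrier W" "N.le y w" "N.le u y" "N.le v y" "y \<noteq> w" for y
        proof -
          have "y \<noteq> u" "y \<noteq> v" using y incomparable by auto
          then have "?l u < ?l y" "?l v < ?l y" "?l y < 3" 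
            using strict[OF u(1) y(1,3)] strict[OF v(1) y(1,4)] strict[OF y(1) w(1) y(2,5)] w(2) by auto
          then show ?thesis using pos[of u] pos[of v] by auto
        qed
        have "u \<noteq> v" using incomparable N.le_refl u(1) by auto
        have "N.le z y" if y: "y \<in> carrier W" "N.le y w" "N.le u y" "N.le v y" for y
        proof (cases "y = w")
          case True
          then show ?thesis using z(2) by simp
        next
          case False
          have "z = y"
            using unique[OF u(1) v(1) _ _ \<open>u \<noteq> v\<close> z(1,3,4) _ z(2) y(1,3,4) _ y(2)]
              lens[OF z] lens[OF y False] by blast
          then show ?thesis using N.le_refl y(1) by simp
        qed
        then show ?thesis using z by blast
      qed
    qed
  qed
qed

lemma interval_group_three:
  assumes "w \<in> carrier W" "reflection_length W S w = 3"
  shows "quasi_garside_group (interval_group W S w)"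
proof -
  interpret I: interval_lattice W "reflection_length W S" w
    by (rule interval_lattice_three[OF assms])
  have D: "absolute_interval W S w = I.D"
    unfolding absolute_interval_def I.D_def absolute_le_def I.le_def ..
  have "interval_relations W S w = I.rels"
    unfolding interval_relations_def I.rels_def D ..
  then have "interval_group W S w = presented_group I.D I.rels"
    unfolding interval_group_def D by (rule arg_cong)
  then show ?thesis using I.quasi_garside_group_F by (rule ssubst)
qed

end

theorem corollary2p3:
  fixes W :: "('a, 'b) monoid_scheme" and S :: "'a set" and w :: 'a
  assumes "coxeter_system W S"
    and "w \<in> carrier W"
    and "reflection_length W S w = 3"
  shows "quasi_garside_group (interval_group W S w)"
proof -
  interpret coxeter_system W S by fact
  obtain m h where "coxeter_matrix S m"
    and "h \<in> iso (presented_group S (coxeter_relations S m)) W"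
    and "\<forall>s\<in>S. h (presented_gen S (coxeter_relations S m) s) = s"
    using coxeter_presentation by blast
  then interpret coxeter_presented W S m h
    using S_subset by unfold_locales auto
  show ?thesis using assms(2,3) by (rule interval_group_three)
qed

end
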